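(* Let $X$ be a smooth vector field on a smooth manifold $M$ with periodic flow (possibly with zeros), admitting a first integral $h\in C^\infty(M)$ that is regular on $\operatorname{supp}(X)$. Then $X$ is Hamiltonian on $M$ with respect to a Poisson structure $\pi=Y\wedge X$, where $Y=\langle\widetilde{Y}\rangle$ is the averaging, with respect to the $\mathbb{S}^1$-action induced by the flow of $X$, of a vector field $\widetilde{Y}\in\Gamma(TM)$ satisfying $\mathrm{d}h(\widetilde{Y})X=X$.
   Context: $X$ has periodic flow if it is complete and there is a smooth positive function $\varpi\in C^\infty(M)$, constant along trajectories of $X$, with $\mathrm{Fl}_X^{\varpi(x)}(x)=x$ for all $x\in M$. The induced $\mathbb{S}^1$-action ($\mathbb{S}^1=\mathbb{R}/2\pi\mathbb{Z}$) is the flow of $\Upsilon=\frac{\varpi}{2\pi}X$, and the averaging of a vector field is $\langle\widetilde Y\rangle=\frac{1}{2\pi}\int_0^{2\pi}(\mathrm{Fl}^t_\Upsilon)^*\widetilde Y\,\mathrm{d}t$. A first integral of $X$ is a function $h$ with $\mathrm{d}h(X)=0$; it is regular on a set if $\mathrm{d}h$ is nonzero at each of its points; $\operatorname{supp}(X)$ is the closure of $\{X\neq 0\}$. A Poisson structure is a bivector field $\pi$ with $[\pi,\pi]=0$ (Schouten–Nijenhuis bracket); $X$ is Hamiltonian on $M$ with respect to $\pi$ if $X=\pi^\sharp\mathrm{d}f=\pi(\mathrm{d}f,\cdot)$ for some $f\in C^\infty(M)$. *)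

theory Defs
  imports "HOL-Analysis.Analysis" "HOL-Combinatorics.Permutations"
begin

section \<open>Smooth manifolds\<close>

text \<open>\<open>k_times_diff_on\<close> is meant for open sets in finite-dimensional spaces, where
  being \<open>C\<^sup>k\<close> amounts to all iterated directional derivatives being continuous.\<close>

primrec k_times_diff_on ::
  "nat \<Rightarrow> 'd::euclidean_space set \<Rightarrow> ('d \<Rightarrow> 'e::euclidean_space) \<Rightarrow> bool" where
  "k_times_diff_on 0 S f \<longleftrightarrow> continuous_on S f"
| "k_times_diff_on (Suc k) S f \<longleftrightarrow>
     (\<forall>x\<in>S. f differentiable (at x)) \<and>
     (\<forall>v. k_times_diff_on k S (\<lambda>x. frechet_derivative f (at x) v))"

definition smooth_on :: "'d::euclidean_space set \<Rightarrow> ('d \<Rightarrow> 'e::euclidean_space) \<Rightarrow> bool" where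
  "smooth_on S f \<longleftrightarrow> (\<forall>k. k_times_diff_on k S f)"

type_synonym ('a, 'e) chart = "'a set \<times> ('a \<Rightarrow> 'e)"

text \<open>The manifold is the whole type \<open>'a\<close>, modelled on \<open>'e\<close>. The Hausdorff and second
  countability axioms are imposed through the type classes of \<open>'a\<close>. The smooth structure is the
  one generated by the given (not necessarily maximal) atlas.\<close>

definition smooth_atlas ::
  "('a::{t2_space, second_countable_topology}, 'e::euclidean_space) chart set \<Rightarrow> bool" where
  "smooth_atlas A \<longleftrightarrow>
     (\<forall>(U, \<phi>)\<in>A. open U \<and> open (\<phi> ` U) \<and> homeomorphism U (\<phi> ` U) \<phi> (inv_into U \<phi>)) \<and>
     (\<Union>(U, \<phi>)\<in>A. U) = UNIV \<and>
     (\<forall>(U, \<phi>)\<in>A. \<forall>(V, \<psi>)\<in>A. smooth_on (\<phi> ` (U \<inter> V)) (\<psi> \<circ> inv_into U \<phi>))"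

definition model_atlas :: "('e::euclidean_space, 'e) chart set" where
  "model_atlas = {(UNIV, id)}"

definition prod_atlas :: "('a, 'd) chart set \<Rightarrow> ('b, 'e) chart set \<Rightarrow> ('a \<times> 'b, 'd \<times> 'e) chart set" where
  "prod_atlas A B = {(U \<times> V, map_prod \<phi> \<psi>) | U \<phi> V \<psi>. (U, \<phi>) \<in> A \<and> (V, \<psi>) \<in> B}"

definition smooth_map ::
  "('a::topological_space, 'd::euclidean_space) chart set \<Rightarrow>
   ('b::topological_space, 'e::euclidean_space) chart set \<Rightarrow> ('a \<Rightarrow> 'b) \<Rightarrow> bool" where
  "smooth_map A B f \<longleftrightarrow> continuous_on UNIV f \<and>
     (\<forall>(U, \<phi>)\<in>A. \<forall>(V, \<psi>)\<in>B. smooth_on (\<phi> ` (U \<inter> f -` V)) (\<psi> \<circ> f \<circ> inv_into U \<phi>))"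

abbreviation smooth_fun ::
  "('a::topological_space, 'd::euclidean_space) chart set \<Rightarrow> ('a \<Rightarrow> real) \<Rightarrow> bool" where
  "smooth_fun A \<equiv> smooth_map A model_atlas"


section \<open>Tangent vectors and vector fields\<close>

text \<open>Tangent vectors at a point are the derivations at that point on the algebra of smooth
  functions. A derivation is a total HOL function, normalised to be 0 on functions that are not
  smooth, so that equality of tangent vectors is HOL equality and the zero vector is
  \<open>\<lambda>f. 0\<close>. A vector field maps each point to a tangent vector there; it is smooth if it maps
  smooth functions to smooth functions.\<close>

type_synonym 'a tangent = "('a \<Rightarrow> real) \<Rightarrow> real"
type_synonym 'a vector_field = "'a \<Rightarrow> 'a tangent"

definition tangent_space ::
  "('a::topological_space, 'e::euclidean_space) chart set \<Rightarrow> 'a \<Rightarrow> 'a tangent set" where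
  "tangent_space A p = {v.
     (\<forall>f g. smooth_fun A f \<longrightarrow> smooth_fun A g \<longrightarrow> v (\<lambda>x. f x + g x) = v f + v g) \<and>
     (\<forall>c f. smooth_fun A f \<longrightarrow> v (\<lambda>x. c * f x) = c * v f) \<and>
     (\<forall>f g. smooth_fun A f \<longrightarrow> smooth_fun A g \<longrightarrow> v (\<lambda>x. f x * g x) = f p * v g + g p * v f) \<and>
     (\<forall>f. \<not> smooth_fun A f \<longrightarrow> v f = 0)}"

definition smooth_vector_field ::
  "('a::topological_space, 'e::euclidean_space) chart set \<Rightarrow> 'a vector_field \<Rightarrow> bool" where
  "smooth_vector_field A X \<longleftrightarrow>
     (\<forall>p. X p \<in> tangent_space A p) \<and> (\<forall>f. smooth_fun A f \<longrightarrow> smooth_fun A (\<lambda>p. X p f))"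

definition scale_vf :: "('a \<Rightarrow> real) \<Rightarrow> 'a vector_field \<Rightarrow> 'a vector_field" where
  "scale_vf c X = (\<lambda>p f. c p * X p f)"

definition supp_vf :: "('a::topological_space) vector_field \<Rightarrow> 'a set" where
  "supp_vf X = closure {p. X p \<noteq> (\<lambda>f. 0)}"

text \<open>Covectors at \<open>p\<close> are linear functionals on the tangent space at \<open>p\<close>, normalised to be 0
  outside of it.\<close>

type_synonym 'a covector = "'a tangent \<Rightarrow> real"

definition cotangent_space ::
  "('a::topological_space, 'e::euclidean_space) chart set \<Rightarrow> 'a \<Rightarrow> 'a covector set" where
  "cotangent_space A p = {\<alpha>.
     (\<forall>v\<in>tangent_space A p. \<forall>w\<in>tangent_space A p. \<alpha> (\<lambda>f. v f + w f) = \<alpha> v + \<alpha> w) \<and>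
     (\<forall>c. \<forall>v\<in>tangent_space A p. \<alpha> (\<lambda>f. c * v f) = c * \<alpha> v) \<and>
     (\<forall>v. v \<notin> tangent_space A p \<longrightarrow> \<alpha> v = 0)}"

definition differential ::
  "('a::topological_space, 'e::euclidean_space) chart set \<Rightarrow> ('a \<Rightarrow> real) \<Rightarrow> 'a \<Rightarrow> 'a covector" where
  "differential A f p = (\<lambda>v. if v \<in> tangent_space A p then v f else 0)"

definition first_integral ::
  "('a::topological_space, 'e::euclidean_space) chart set \<Rightarrow> 'a vector_field \<Rightarrow> ('a \<Rightarrow> real) \<Rightarrow> bool" where
  "first_integral A X h \<longleftrightarrow> smooth_fun A h \<and> (\<forall>p. differential A h p (X p) = 0)"

definition regular_fun_on ::
  "('a::topological_space, 'e::euclidean_space) chart set \<Rightarrow> 'a set \<Rightarrow> ('a \<Rightarrow> real) \<Rightarrow> bool" where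
  "regular_fun_on A S h \<longleftrightarrow> (\<forall>p\<in>S. differential A h p \<noteq> (\<lambda>v. 0))"


section \<open>Flows and averaging\<close>

text \<open>A global flow is a smooth action of the additive group of the reals on the manifold; the
  last conjunct says that \<open>X\<close> is its infinitesimal generator. A vector field is complete if it
  generates a global flow, which is then unique.\<close>

definition global_flow ::
  "('a::topological_space, 'e::euclidean_space) chart set \<Rightarrow> 'a vector_field \<Rightarrow>
   (real \<Rightarrow> 'a \<Rightarrow> 'a) \<Rightarrow> bool" where
  "global_flow A X \<Phi> \<longleftrightarrow>
     smooth_map (prod_atlas model_atlas A) A (\<lambda>(t, x). \<Phi> t x) \<and>
     (\<forall>x. \<Phi> 0 x = x) \<and>
     (\<forall>s t x. \<Phi> (s + t) x = \<Phi> s (\<Phi> t x)) \<and>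
     (\<forall>x f. smooth_fun A f \<longrightarrow> ((\<lambda>t. f (\<Phi> t x)) has_real_derivative X x f) (at 0))"

definition complete_vf ::
  "('a::topological_space, 'e::euclidean_space) chart set \<Rightarrow> 'a vector_field \<Rightarrow> bool" where
  "complete_vf A X \<longleftrightarrow> (\<exists>\<Phi>. global_flow A X \<Phi>)"

definition Fl ::
  "('a::topological_space, 'e::euclidean_space) chart set \<Rightarrow> 'a vector_field \<Rightarrow> real \<Rightarrow> 'a \<Rightarrow> 'a" where
  "Fl A X = (THE \<Phi>. global_flow A X \<Phi>)"

text \<open>The period function \<open>w\<close> is kept as a parameter, since the induced circle action
  depends on it.\<close>

definition periodic_flow ::
  "('a::topological_space, 'e::euclidean_space) chart set \<Rightarrow> 'a vector_field \<Rightarrow> ('a \<Rightarrow> real) \<Rightarrow> bool" where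
  "periodic_flow A X w \<longleftrightarrow> complete_vf A X \<and>
     smooth_fun A w \<and> (\<forall>x. w x > 0) \<and>
     (\<forall>t x. w (Fl A X t x) = w x) \<and> (\<forall>x. Fl A X (w x) x = x)"

definition circle_generator :: "'a vector_field \<Rightarrow> ('a \<Rightarrow> real) \<Rightarrow> 'a vector_field" where
  "circle_generator X w = scale_vf (\<lambda>x. w x / (2 * pi)) X"

text \<open>Pullback of a vector field along a diffeomorphism \<open>F\<close>: the vector at \<open>F p\<close> is pushed back to
  \<open>p\<close> by the differential of the inverse of \<open>F\<close>.\<close>

definition pullback_vf :: "('a \<Rightarrow> 'a) \<Rightarrow> 'a vector_field \<Rightarrow> 'a vector_field" where
  "pullback_vf F Z = (\<lambda>p f. Z (F p) (f \<circ> inv F))"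

text \<open>The integral of a curve in the tangent space at \<open>p\<close>. It is computed by applying the
  derivations to each function, as evaluation on a function is linear in the tangent vector.\<close>

definition average ::
  "('a::topological_space, 'e::euclidean_space) chart set \<Rightarrow> 'a vector_field \<Rightarrow> ('a \<Rightarrow> real) \<Rightarrow>
   'a vector_field \<Rightarrow> 'a vector_field" where
  "average A X w Z = (\<lambda>p f. 1 / (2 * pi) *
     integral {0..2 * pi} (\<lambda>t. pullback_vf (Fl A (circle_generator X w) t) Z p f))"


section \<open>Multivector fields, the Schouten--Nijenhuis bracket and Poisson structures\<close>

text \<open>A \<open>k\<close>-vector field assigns to each point an alternating multilinear form in \<open>k\<close> covectors;
  the \<open>k\<close> arguments are given as a list. As for vector fields, smoothness is tested on the
  differentials of smooth functions.\<close>

type_synonym 'a multivector_field = "'a \<Rightarrow> 'a covector list \<Rightarrow> real"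

definition mv_eval ::
  "('a::topological_space, 'e::euclidean_space) chart set \<Rightarrow> 'a multivector_field \<Rightarrow>
   ('a \<Rightarrow> real) list \<Rightarrow> 'a \<Rightarrow> real" where
  "mv_eval A P fs = (\<lambda>x. P x (map (\<lambda>f. differential A f x) fs))"

definition smooth_multivector_field ::
  "('a::topological_space, 'e::euclidean_space) chart set \<Rightarrow> nat \<Rightarrow> 'a multivector_field \<Rightarrow> bool" where
  "smooth_multivector_field A k P \<longleftrightarrow>
     (\<forall>p \<alpha>s. length \<alpha>s = k \<longrightarrow> set \<alpha>s \<subseteq> cotangent_space A p \<longrightarrow>
        (\<forall>i<k. \<forall>\<beta>\<in>cotangent_space A p. \<forall>\<gamma>\<in>cotangent_space A p. \<forall>b c.
           P p (\<alpha>s[i := (\<lambda>v. b * \<beta> v + c * \<gamma> v)]) = b * P p (\<alpha>s[i := \<beta>]) + c * P p (\<alpha>s[i := \<gamma>])) \<and>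
        (\<forall>i<k. \<forall>j<k. i \<noteq> j \<longrightarrow> \<alpha>s ! i = \<alpha>s ! j \<longrightarrow> P p \<alpha>s = 0)) \<and>
     (\<forall>fs. length fs = k \<longrightarrow> (\<forall>f\<in>set fs. smooth_fun A f) \<longrightarrow> smooth_fun A (mv_eval A P fs))"

definition wedge :: "'a vector_field \<Rightarrow> 'a vector_field \<Rightarrow> 'a multivector_field" where
  "wedge Y X = (\<lambda>p \<alpha>s. (\<alpha>s ! 0) (Y p) * (\<alpha>s ! 1) (X p) - (\<alpha>s ! 0) (X p) * (\<alpha>s ! 1) (Y p))"

definition shuffle_perms :: "nat \<Rightarrow> nat \<Rightarrow> (nat \<Rightarrow> nat) set" where
  "shuffle_perms q m = {\<sigma>. \<sigma> permutes {..<q + m} \<and>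
     strict_mono_on {..<q} \<sigma> \<and> strict_mono_on {q..<q + m} \<sigma>}"

text \<open>For a \<open>p\<close>-vector field \<open>P\<close> and a \<open>q\<close>-vector field \<open>Q\<close> (with \<open>p, q \<ge> 1\<close>), viewed as skew-symmetric
  multiderivations of the algebra of smooth functions, \<open>schouten\<close> is their
  Schouten--Nijenhuis bracket, evaluated on a list of \<open>p + q - 1\<close> functions:
  \<open>[P, Q] = P \<circ> Q - (-1)\<^bsup>(p - 1)(q - 1)\<^esup> Q \<circ> P\<close>, where \<open>P \<circ> Q\<close> is the signed sum over the
  \<open>(q, p - 1)\<close>-shuffles of inserting \<open>Q\<close> into the first slot of \<open>P\<close>. For \<open>p = q = 1\<close> this is the
  commutator. A \<open>(p + q - 1)\<close>-vector is determined by its values on differentials of smooth functions,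
  since these exhaust each cotangent space.\<close>

definition mv_insert ::
  "('a::topological_space, 'e::euclidean_space) chart set \<Rightarrow> nat \<Rightarrow> nat \<Rightarrow>
   'a multivector_field \<Rightarrow> 'a multivector_field \<Rightarrow> ('a \<Rightarrow> real) list \<Rightarrow> 'a \<Rightarrow> real" where
  "mv_insert A p q P Q fs = (\<lambda>x. \<Sum>\<sigma>\<in>shuffle_perms q (p - 1). of_int (sign \<sigma>) *
     mv_eval A P (mv_eval A Q (map (\<lambda>i. fs ! \<sigma> i) [0..<q]) #
                  map (\<lambda>i. fs ! \<sigma> i) [q..<q + (p - 1)]) x)"

definition schouten ::
  "('a::topological_space, 'e::euclidean_space) chart set \<Rightarrow> nat \<Rightarrow> nat \<Rightarrow>
   'a multivector_field \<Rightarrow> 'a multivector_field \<Rightarrow> ('a \<Rightarrow> real) list \<Rightarrow> 'a \<Rightarrow> real" where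
  "schouten A p q P Q fs =
     (\<lambda>x. mv_insert A p q P Q fs x - (- 1) ^ ((p - 1) * (q - 1)) * mv_insert A q p Q P fs x)"

definition poisson_structure ::
  "('a::topological_space, 'e::euclidean_space) chart set \<Rightarrow> 'a multivector_field \<Rightarrow> bool" where
  "poisson_structure A \<pi> \<longleftrightarrow> smooth_multivector_field A 2 \<pi> \<and>
     (\<forall>fs. length fs = 3 \<longrightarrow> (\<forall>f\<in>set fs. smooth_fun A f) \<longrightarrow> schouten A 2 2 \<pi> \<pi> fs = (\<lambda>x. 0))"

text \<open>The vector \<open>\<pi>(\<alpha>, \<cdot>)\<close> at \<open>p\<close>, as a derivation: its value on \<open>g\<close> is the pairing with the
  differential of \<open>g\<close>.\<close>

definition sharp ::
  "('a::topological_space, 'e::euclidean_space) chart set \<Rightarrow> 'a multivector_field \<Rightarrow>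
   ('a \<Rightarrow> 'a covector) \<Rightarrow> 'a vector_field" where
  "sharp A \<pi> \<alpha> = (\<lambda>p g. if smooth_fun A g then \<pi> p [\<alpha> p, differential A g p] else 0)"

definition hamiltonian_vf ::
  "('a::topological_space, 'e::euclidean_space) chart set \<Rightarrow> 'a multivector_field \<Rightarrow>
   'a vector_field \<Rightarrow> bool" where
  "hamiltonian_vf A \<pi> X \<longleftrightarrow> (\<exists>f. smooth_fun A f \<and> X = sharp A \<pi> (differential A f))"

end

theory Submission
  imports Defs
begin

text \<open>
  Let \<open>\<Upsilon>\<close> be the generator of the circle action. The averaged field \<open>Y\<close> is invariant under the flow of
  \<open>\<Upsilon>\<close>, hence commutes with \<open>\<Upsilon> = (w / 2\<pi>) X\<close>, so that \<open>[X, Y]\<close> is a function multiple of \<open>X\<close>; this makes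
  \<open>[Y \<and> X, Y \<and> X]\<close>, a multiple of \<open>Y \<and> X \<and> [X, Y]\<close>, vanish. As \<open>h\<close> is constant along the flow,
  \<open>dh(Y)\<close> is the average of \<open>dh(Z)\<close> along orbits, which is 1 wherever \<open>X \<noteq> 0\<close>; since \<open>dh(X) = 0\<close>, this says
  that \<open>h\<close> is a Hamiltonian function for \<open>X\<close>. A field \<open>Z\<close> with \<open>dh(Z) = 1\<close> on the support of \<open>X\<close> is
  glued from local ones by a locally finite family of weights.

  Derivatives of compositions with flows and interchanges of limits are reduced throughout to
  Hadamard's lemma \<open>f(\<Phi>\<^sub>s q) = f(q) + s M(s, q)\<close> with \<open>M\<close> smooth.
\<close>

section \<open>Calculus of smooth maps between Euclidean spaces\<close>

text \<open>The averaging serves the Jacobi identity: with \<open>Z\<close> in place of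
  \<open>Y\<close>, the function \<open>h\<close> would already be a Hamiltonian function for
  \<open>X\<close>, but the bracket of \<open>wedge Z X\<close> involves \<open>[X, Z]\<close>, over
  which there is no control. The average is taken along \<Upsilon> because the period of
  \<open>X\<close> varies from orbit to orbit. The price is that \<open>Y\<close> commutes only with
  the rescaled field; dividing by the positive factor \<open>c = w / 2\<pi>\<close> leaves
  \<open>[X, Y] = (Y(c) / c) X\<close>. Regularity of \<open>h\<close> on the closed support lets
  the local fields exist around boundary points of the set where \<open>X\<close> is nonzero; off
  the support the zero field does. The other obstacle is the notion of tangent vector. Derivations
  act on globally defined functions, and smoothness of a field is tested on one function at a time,
  so locality, the coordinate form and joint smoothness in time and space all have to be derived, by
  cutting off with bump functions.\<close>

lemma k_times_diff_on_cong:
  assumes "open S" "k_times_diff_on k S f" "\<And>x. x \<in> S \<Longrightarrow> f x = g x"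
  shows "k_times_diff_on k S g"
  using assms(2,3)
proof (induction k arbitrary: f g)
  case 0
  then show ?case using continuous_on_cong[of S S f g] by simp
next
  case (Suc k)
  have fd: "(g has_derivative frechet_derivative f (at x)) (at x)" if "x \<in> S" for x
    using has_derivative_transform_within_open[OF _ assms(1) that, of f _ UNIV g] Suc.prems that
      frechet_derivative_works by force
  have eq: "frechet_derivative f (at x) = frechet_derivative g (at x)" if "x \<in> S" for x
    using frechet_derivative_at[OF fd[OF that]] .
  have "k_times_diff_on k S (\<lambda>x. frechet_derivative g (at x) v)" for v
  proof (rule Suc.IH)
    show "k_times_diff_on k S (\<lambda>x. frechet_derivative f (at x) v)" using Suc.prems(1) by simp
  qed (simp only: eq)
  then show ?case using fd by (auto simp: differentiable_def)
qed

text \<open>The inductions below know a derivative as an explicit formula; uniqueness of derivatives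
  lets that formula stand in for \<open>frechet_derivative\<close>.\<close>

lemma k_times_diff_on_SucI:
  assumes "open S" "\<And>x. x \<in> S \<Longrightarrow> (f has_derivative f' x) (at x)"
    "\<And>v. k_times_diff_on k S (\<lambda>x. f' x v)"
  shows "k_times_diff_on (Suc k) S f"
proof -
  have "k_times_diff_on k S (\<lambda>x. frechet_derivative f (at x) v)" for v
    using frechet_derivative_at[OF assms(2)]
    by (intro k_times_diff_on_cong[OF assms(1) assms(3)[of v]]) auto
  then show ?thesis using assms(2) by (auto simp: differentiable_def)
qed

lemma k_times_diff_on_SucD:
  assumes "k_times_diff_on (Suc k) S f" "x \<in> S"
  shows "(f has_derivative frechet_derivative f (at x)) (at x)"
  using assms by (simp flip: frechet_derivative_works)

lemma k_times_diff_on_subset: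
  assumes "k_times_diff_on k S f" "T \<subseteq> S"
  shows "k_times_diff_on k T f"
  using assms(1)
proof (induction k arbitrary: f)
  case 0
  then show ?case using assms(2) continuous_on_subset by auto
next
  case (Suc k)
  then show ?case using assms(2) by auto
qed

lemma k_times_diff_on_imp_continuous_on:
  assumes "k_times_diff_on k S f"
  shows "continuous_on S f"
  using assms
  by (cases k) (auto intro!: continuous_at_imp_continuous_on differentiable_imp_continuous_within)

lemma k_times_diff_on_Suc_imp:
  assumes "k_times_diff_on (Suc k) S f"
  shows "k_times_diff_on k S f"
  using assms
proof (induction k arbitrary: f)
  case 0
  then show ?case using k_times_diff_on_imp_continuous_on[of "Suc 0"] by auto
next
  case (Suc k)
  then show ?case by (metis k_times_diff_on.simps(2))
qed

lemma k_times_diff_on_locally: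
  assumes "\<And>x. x \<in> S \<Longrightarrow> \<exists>T. open T \<and> x \<in> T \<and> k_times_diff_on k T f"
  shows "k_times_diff_on k S f"
  using assms
proof (induction k arbitrary: f)
  case 0
  have "isCont f x" if "x \<in> S" for x
    using 0[OF that] continuous_on_eq_continuous_at by auto
  then show ?case by (simp add: continuous_at_imp_continuous_on)
next
  case (Suc k)
  have "f differentiable (at x)" if "x \<in> S" for x
    using Suc.prems[OF that] by auto
  moreover have "k_times_diff_on k S (\<lambda>x. frechet_derivative f (at x) v)" for v
    using Suc.prems by (intro Suc.IH) (metis k_times_diff_on.simps(2))
  ultimately show ?case by auto
qed

lemma k_times_diff_on_const: "open S \<Longrightarrow> k_times_diff_on k S (\<lambda>x. c)"
proof (induction k arbitrary: c)
  case 0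
  then show ?case by simp
next
  case (Suc k)
  then show ?case by (intro k_times_diff_on_SucI[where f' = "\<lambda>x v. 0"]) auto
qed

lemma k_times_diff_on_bounded_linear:
  assumes "open S" "bounded_linear f"
  shows "k_times_diff_on k S f"
proof (cases k)
  case 0
  then show ?thesis using assms linear_continuous_on by auto
next
  case (Suc k)
  show ?thesis
    unfolding Suc
    by (intro k_times_diff_on_SucI[where f' = "\<lambda>x v. f v"] k_times_diff_on_const
        bounded_linear_imp_has_derivative assms)
qed

lemma k_times_diff_on_add:
  assumes "open S" "k_times_diff_on k S f" "k_times_diff_on k S g"
  shows "k_times_diff_on k S (\<lambda>x. f x + g x)"
  using assms(2,3)
proof (induction k arbitrary: f g)
  case 0
  then show ?case by (auto intro: continuous_intros)
next
  case (Suc k)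
  show ?case
  proof (rule k_times_diff_on_SucI[OF assms(1)])
    show "((\<lambda>x. f x + g x) has_derivative
        (\<lambda>v. frechet_derivative f (at x) v + frechet_derivative g (at x) v)) (at x)" if "x \<in> S" for x
      using Suc.prems that by (intro has_derivative_add) (auto intro: k_times_diff_on_SucD)
    show "k_times_diff_on k S (\<lambda>x. frechet_derivative f (at x) v + frechet_derivative g (at x) v)" for v
      using Suc.prems by (intro Suc.IH) auto
  qed
qed

lemma k_times_diff_on_sum:
  assumes "open S" "finite I" "\<And>i. i \<in> I \<Longrightarrow> k_times_diff_on k S (f i)"
  shows "k_times_diff_on k S (\<lambda>x. \<Sum>i\<in>I. f i x)"
  using assms(2,3)
proof (induction I)
  case empty
  then show ?case by (simp add: k_times_diff_on_const assms(1))
next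
  case (insert i I)
  then show ?case by (simp add: k_times_diff_on_add[OF assms(1)])
qed

text \<open>One induction covers multiplication, scaling and inner products. In each Leibniz summand
  one factor stays undifferentiated, so its order must be lowered before the induction hypothesis
  applies.\<close>

lemma k_times_diff_on_bilinear:
  fixes prod :: "'a::euclidean_space \<Rightarrow> 'b::euclidean_space \<Rightarrow> 'c::euclidean_space"
  assumes "open S" "bounded_bilinear prod" "k_times_diff_on k S f" "k_times_diff_on k S g"
  shows "k_times_diff_on k S (\<lambda>x. prod (f x) (g x))"
  using assms(3,4)
proof (induction k arbitrary: f g)
  case 0
  then show ?case by (auto intro: bounded_bilinear.continuous_on[OF assms(2)])
next
  case (Suc k)
  note k = k_times_diff_on_Suc_imp[OF Suc.prems(1)] k_times_diff_on_Suc_imp[OF Suc.prems(2)]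
  show ?case
  proof (rule k_times_diff_on_SucI[OF assms(1)])
    show "((\<lambda>x. prod (f x) (g x)) has_derivative
        (\<lambda>v. prod (f x) (frechet_derivative g (at x) v) + prod (frechet_derivative f (at x) v) (g x)))
        (at x)" if "x \<in> S" for x
      using Suc.prems that
      by (intro bounded_bilinear.FDERIV[OF assms(2)]) (auto intro: k_times_diff_on_SucD)
    show "k_times_diff_on k S (\<lambda>x. prod (f x) (frechet_derivative g (at x) v)
        + prod (frechet_derivative f (at x) v) (g x))" for v
      using Suc.prems k by (intro k_times_diff_on_add assms(1) Suc.IH) auto
  qed
qed

lemma k_times_diff_on_linear_image:
  assumes "open S" "bounded_linear L" "k_times_diff_on k S f"
  shows "k_times_diff_on k S (\<lambda>x. L (f x))"
  using assms(3)
proof (induction k arbitrary: f)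
  case 0
  then show ?case by (auto intro: bounded_linear.continuous_on[OF assms(2)])
next
  case (Suc k)
  show ?case
  proof (rule k_times_diff_on_SucI[OF assms(1)])
    show "((\<lambda>x. L (f x)) has_derivative (\<lambda>v. L (frechet_derivative f (at x) v))) (at x)"
      if "x \<in> S" for x
      using Suc.prems that
      by (intro bounded_linear.has_derivative[OF assms(2)]) (auto intro: k_times_diff_on_SucD)
    show "k_times_diff_on k S (\<lambda>x. L (frechet_derivative f (at x) v))" for v
      using Suc.prems by (intro Suc.IH) auto
  qed
qed

text \<open>The definition only knows derivatives in a fixed direction, whereas the chain rule
  differentiates \<open>g\<close> in the moving direction \<open>Df(x) v\<close>. Expanding that
  direction in \<open>Basis\<close> leaves sums of products to which the induction over
  \<open>g\<close>, with \<open>f\<close> fixed, applies.\<close>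

lemma k_times_diff_on_compose:
  fixes f :: "'d::euclidean_space \<Rightarrow> 'e::euclidean_space" and g :: "'e \<Rightarrow> 'f::euclidean_space"
  assumes "open S" "open T" "f ` S \<subseteq> T" "k_times_diff_on k T g" "k_times_diff_on k S f"
  shows "k_times_diff_on k S (\<lambda>x. g (f x))"
  using assms(4,5)
proof (induction k arbitrary: g)
  case 0
  then show ?case using continuous_on_compose2[of T g S f] assms(3) by auto
next
  case (Suc k)
  let ?g = "\<lambda>y. frechet_derivative g (at y)" and ?f = "\<lambda>x. frechet_derivative f (at x)"
  show ?case
  proof (rule k_times_diff_on_SucI[OF assms(1)])
    show "((\<lambda>x. g (f x)) has_derivative (\<lambda>v. \<Sum>b\<in>Basis. (?f x v \<bullet> b) *\<^sub>R ?g (f x) b)) (at x)"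
      if "x \<in> S" for x
    proof -
      have f: "(f has_derivative ?f x) (at x)" and g: "(g has_derivative ?g (f x)) (at (f x))"
        using k_times_diff_on_SucD[OF Suc.prems(2) that] assms(3) that
        by (auto intro!: k_times_diff_on_SucD[OF Suc.prems(1)])
      have "?g (f x) (?f x v) = (\<Sum>b\<in>Basis. (?f x v \<bullet> b) *\<^sub>R ?g (f x) b)" for v
      proof -
        have "?g (f x) (?f x v) = ?g (f x) (\<Sum>b\<in>Basis. (?f x v \<bullet> b) *\<^sub>R b)"
          by (simp add: euclidean_representation)
        also have "\<dots> = (\<Sum>b\<in>Basis. (?f x v \<bullet> b) *\<^sub>R ?g (f x) b)"
          using has_derivative_linear[OF g] by (simp add: linear_sum linear_scale)
        finally show ?thesis .
      qed
      then show ?thesis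
        using diff_chain_at[OF f g] by (simp add: o_def)
    qed
    show "k_times_diff_on k S (\<lambda>x. \<Sum>b\<in>Basis. (?f x v \<bullet> b) *\<^sub>R ?g (f x) b)" for v
    proof (intro k_times_diff_on_sum k_times_diff_on_bilinear[OF _ bounded_bilinear_scaleR] assms(1))
      show "k_times_diff_on k S (\<lambda>x. ?f x v \<bullet> b)" for b
        using Suc.prems
        by (intro k_times_diff_on_linear_image[where L="\<lambda>y. y \<bullet> b"] assms(1) bounded_linear_inner_left) auto
      show "k_times_diff_on k S (\<lambda>x. ?g (f x) b)" for b
        using Suc.prems k_times_diff_on_Suc_imp[OF Suc.prems(2)] by (intro Suc.IH) auto
    qed auto
  qed
qed

text \<open>Differentiation under the integral sign. \<open>K\<close> is differentiable on all of
  \<open>UNIV \<times> S\<close>, so the ends of the interval need no special care, and its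
  derivative in direction \<open>(0, v)\<close> is an integrand of the same kind, which closes the
  induction.\<close>

lemma k_times_diff_on_integral:
  fixes K :: "real \<times> 'd::euclidean_space \<Rightarrow> real"
  assumes "open S" "k_times_diff_on k (UNIV \<times> S) K"
  shows "k_times_diff_on k S (\<lambda>x. integral {a..b} (\<lambda>t. K (t, x)))"
  using assms(2)
proof (induction k arbitrary: K)
  case 0
  have "continuous_on (S \<times> cbox a b) (\<lambda>(x, t). K (t, x))"
    using 0 by (auto simp: split_beta intro!: continuous_on_compose2[of "UNIV \<times> S" K] continuous_intros)
  from integral_continuous_on_param[OF this] show ?case by (simp add: cbox_interval)
next
  case (Suc k)
  have S': "open (UNIV \<times> S :: (real \<times> 'd) set)" using assms(1) by (intro open_Times) auto
  define D where "D t x v = frechet_derivative K (at (t, x)) (0, v)" for t x v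
  define F where "F x t = Blinfun (D t x)" for x t
  have der: "((\<lambda>x. K (t, x)) has_derivative D t x) (at x)" if "x \<in> S" for t x
  proof -
    have "(K has_derivative frechet_derivative K (at (t, x))) (at (t, x))"
      using that by (intro k_times_diff_on_SucD[OF Suc.prems]) auto
    moreover have "((\<lambda>x. (t, x)) has_derivative (\<lambda>v. (0, v))) (at x)"
      by (auto intro!: derivative_eq_intros)
    ultimately show ?thesis
      using diff_chain_at[of "\<lambda>x. (t, x)" "\<lambda>v. (0, v)" x K] unfolding D_def o_def by blast
  qed
  have F: "blinfun_apply (F x t) = D t x" if "x \<in> S" for x t
    unfolding F_def using has_derivative_bounded_linear[OF der[OF that]] by (rule bounded_linear_Blinfun_apply)
  have Dv: "k_times_diff_on k (UNIV \<times> S) (\<lambda>z. D (fst z) (snd z) v)" for v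
    using Suc.prems unfolding D_def by simp
  have contD: "continuous_on (S \<times> cbox a b) (\<lambda>(x, t). F x t)"
  proof (rule continuous_on_blinfun_componentwise)
    fix v :: 'd
    have "continuous_on (S \<times> cbox a b) (\<lambda>z. D (snd z) (fst z) v)"
      using k_times_diff_on_imp_continuous_on[OF Dv[of v]]
      by (intro continuous_on_compose2[of "UNIV \<times> S" "\<lambda>z. D (fst z) (snd z) v" _ "\<lambda>z. (snd z, fst z)", simplified])
        (auto intro!: continuous_intros)
    then show "continuous_on (S \<times> cbox a b) (\<lambda>x. blinfun_apply (case x of (x, t) \<Rightarrow> F x t) v)"
      by (rule continuous_on_eq) (auto simp: F)
  qed
  have contK: "continuous_on (cbox a b) (\<lambda>t. K (t, x))" if "x \<in> S" for x
    using k_times_diff_on_imp_continuous_on[OF Suc.prems] that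
    by (auto intro!: continuous_on_compose2[of "UNIV \<times> S" K] continuous_intros)
  have contF: "continuous_on (cbox a b) (F x)" if "x \<in> S" for x
    using continuous_on_compose2[OF contD continuous_on_Pair[OF continuous_on_const continuous_on_id],
        of x "cbox a b"] that by auto
  show ?case
  proof (rule k_times_diff_on_SucI[OF assms(1)])
    fix x assume x: "x \<in> S"
    then obtain e where e: "e > 0" "ball x e \<subseteq> S" by (rule openE[OF assms(1)])
    \<comment> \<open>\<open>leibniz_rule\<close> wants a convex domain and a derivative with values
      in bounded linear maps; hence the ball inside \<open>S\<close> and the packaging
      \<open>F\<close> of the partial derivative.\<close>
    have "((\<lambda>x. integral (cbox a b) (\<lambda>t. K (t, x))) has_derivative integral (cbox a b) (F x))
      (at x within ball x e)"
    proof (rule leibniz_rule)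
      show "((\<lambda>x. K (t, x)) has_derivative blinfun_apply (F y t)) (at y within ball x e)"
        if "y \<in> ball x e" for y t
      proof -
        have "y \<in> S" using that e by auto
        then show ?thesis using has_derivative_at_withinI[OF der] F by simp
      qed
      show "(\<lambda>t. K (t, y)) integrable_on cbox a b" if "y \<in> ball x e" for y
        using that e by (intro integrable_continuous contK) auto
      show "continuous_on (ball x e \<times> cbox a b) (\<lambda>(x, t). F x t)"
        by (rule continuous_on_subset[OF contD]) (use e in auto)
    qed (use e in auto)
    then have 1: "((\<lambda>x. integral (cbox a b) (\<lambda>t. K (t, x))) has_derivative integral (cbox a b) (F x)) (at x)"
      using at_within_open[of x "ball x e"] e by auto
    have "integral (cbox a b) (F x) v = integral {a..b} (\<lambda>t. D t x v)" for v
      using blinfun_apply_integral[OF integrable_continuous[OF contF[OF x]], of v] F[OF x]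
      by (simp add: cbox_interval)
    then have "blinfun_apply (integral (cbox a b) (F x)) = (\<lambda>v. integral {a..b} (\<lambda>t. D t x v))"
      by auto
    with 1 show "((\<lambda>x. integral {a..b} (\<lambda>t. K (t, x))) has_derivative
        (\<lambda>v. integral {a..b} (\<lambda>t. D t x v))) (at x)"
      by (simp add: cbox_interval)
  next
    show "k_times_diff_on k S (\<lambda>x. integral {a..b} (\<lambda>t. D t x v))" for v
      using Suc.IH[OF Dv[of v]] by simp
  qed
qed

section \<open>Smooth functions between Euclidean spaces, from the statements of finite
  order\<close>

lemma smooth_on_cong: "open S \<Longrightarrow> smooth_on S f \<Longrightarrow> (\<And>x. x \<in> S \<Longrightarrow> f x = g x) \<Longrightarrow> smooth_on S g"
  unfolding smooth_on_def using k_times_diff_on_cong by metis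

lemma smooth_on_subset: "smooth_on S f \<Longrightarrow> T \<subseteq> S \<Longrightarrow> smooth_on T f"
  unfolding smooth_on_def by (auto intro: k_times_diff_on_subset)

lemma smooth_on_imp_continuous_on: "smooth_on S f \<Longrightarrow> continuous_on S f"
  unfolding smooth_on_def using k_times_diff_on_imp_continuous_on by metis

lemma smooth_on_locally:
  "(\<And>x. x \<in> S \<Longrightarrow> \<exists>T. open T \<and> x \<in> T \<and> smooth_on T f) \<Longrightarrow> smooth_on S f"
  unfolding smooth_on_def by (intro allI k_times_diff_on_locally) metis

lemma smooth_on_has_derivative:
  "smooth_on S f \<Longrightarrow> x \<in> S \<Longrightarrow> (f has_derivative frechet_derivative f (at x)) (at x)"
  unfolding smooth_on_def using k_times_diff_on_SucD by metis

lemma smooth_on_frechet_derivative: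
  "smooth_on S f \<Longrightarrow> smooth_on S (\<lambda>x. frechet_derivative f (at x) v)"
  unfolding smooth_on_def by (metis k_times_diff_on.simps(2))

lemma smooth_on_const: "open S \<Longrightarrow> smooth_on S (\<lambda>x. c)"
  unfolding smooth_on_def by (simp add: k_times_diff_on_const)

lemma smooth_on_bounded_linear: "open S \<Longrightarrow> bounded_linear f \<Longrightarrow> smooth_on S f"
  unfolding smooth_on_def by (simp add: k_times_diff_on_bounded_linear)

lemma smooth_on_id: "open S \<Longrightarrow> smooth_on S (\<lambda>x. x)"
  by (rule smooth_on_bounded_linear[OF _ bounded_linear_ident])

lemma smooth_on_add: "open S \<Longrightarrow> smooth_on S f \<Longrightarrow> smooth_on S g \<Longrightarrow> smooth_on S (\<lambda>x. f x + g x)"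
  unfolding smooth_on_def by (auto intro: k_times_diff_on_add)

lemma smooth_on_bilinear:
  fixes prod :: "'a::euclidean_space \<Rightarrow> 'b::euclidean_space \<Rightarrow> 'c::euclidean_space"
  shows "bounded_bilinear prod \<Longrightarrow> open S \<Longrightarrow> smooth_on S f \<Longrightarrow> smooth_on S g \<Longrightarrow>
    smooth_on S (\<lambda>x. prod (f x) (g x))"
  unfolding smooth_on_def by (simp add: k_times_diff_on_bilinear)

lemmas smooth_on_mult = smooth_on_bilinear[OF bounded_bilinear_mult]

lemma smooth_on_compose:
  "open S \<Longrightarrow> open T \<Longrightarrow> f ` S \<subseteq> T \<Longrightarrow> smooth_on T g \<Longrightarrow> smooth_on S f \<Longrightarrow>
    smooth_on S (\<lambda>x. g (f x))"
  unfolding smooth_on_def by (simp add: k_times_diff_on_compose[of S T])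

lemma smooth_on_Pair:
  fixes f :: "'d::euclidean_space \<Rightarrow> 'e::euclidean_space" and g :: "'d \<Rightarrow> 'f::euclidean_space"
  assumes "open S" "smooth_on S f" "smooth_on S g"
  shows "smooth_on S (\<lambda>x. (f x, g x))"
proof (unfold smooth_on_def, intro allI)
  fix k
  have "k_times_diff_on k S (\<lambda>x. (f x, 0::'f) + (0::'e, g x))"
    using assms unfolding smooth_on_def
    by (intro k_times_diff_on_add k_times_diff_on_linear_image[where L = "\<lambda>y. (y, 0)"]
        k_times_diff_on_linear_image[where L = "\<lambda>y. (0, y)"] bounded_linear_intros) auto
  then show "k_times_diff_on k S (\<lambda>x. (f x, g x))" by simp
qed

lemma smooth_on_integral:
  fixes K :: "real \<times> 'd::euclidean_space \<Rightarrow> real"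
  assumes "open S" "smooth_on (UNIV \<times> S) K"
  shows "smooth_on S (\<lambda>x. integral {a..b} (\<lambda>t. K (t, x)))"
  using assms unfolding smooth_on_def by (auto intro: k_times_diff_on_integral)

text \<open>The derivative of \<open>inverse\<close> is a polynomial in \<open>inverse\<close>, so
  the induction on the order closes.\<close>

lemma smooth_on_inverse: "smooth_on (- {0}) (inverse :: real \<Rightarrow> real)"
proof (unfold smooth_on_def, intro allI)
  fix k
  show "k_times_diff_on k (- {0}) (inverse :: real \<Rightarrow> real)"
  proof (induction k)
    case 0
    then show ?case by (auto intro!: continuous_intros)
  next
    case (Suc k)
    show ?case
    proof (rule k_times_diff_on_SucI)
      show "(inverse has_derivative (\<lambda>v. (inverse x * inverse x) * - v)) (at x)" if "x \<in> - {0}" for x :: real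
        using that has_derivative_inverse'[of x] by (auto simp: algebra_simps)
      show "k_times_diff_on k (- {0}) (\<lambda>x::real. (inverse x * inverse x) * - v)" for v
        using Suc by (intro k_times_diff_on_bilinear[OF _ bounded_bilinear_mult] k_times_diff_on_const) auto
    qed auto
  qed
qed

text \<open>The classical function \<open>exp (- 1 / x)\<close>, flat at 0, with its quotients by
  powers of \<open>x\<close>: derivatives stay within linear combinations of this family, so one
  induction on the order proves all members smooth.\<close>

definition flat :: "nat \<Rightarrow> real \<Rightarrow> real" where
  "flat n x = (if x \<le> 0 then 0 else exp (- 1 / x) / x ^ n)"

lemma flat_pos: "x > 0 \<Longrightarrow> flat n x > 0"
  by (simp add: flat_def)

lemma flat_nonneg: "flat n x \<ge> 0"
  by (simp add: flat_def)

lemma flat_eq_0: "x \<le> 0 \<Longrightarrow> flat n x = 0"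
  by (simp add: flat_def)

lemma tendsto_flat_0: "flat n \<midarrow>0\<rightarrow> 0"
proof (rule filterlim_split_at)
  have "eventually (\<lambda>x. flat n x = 0) (at_left 0)"
    unfolding eventually_at_filter by (auto simp: flat_def)
  then show "(flat n \<longlongrightarrow> 0) (at_left 0)" by (simp add: tendsto_eventually)
  have "((\<lambda>x::real. inverse x ^ n / exp (inverse x)) \<longlongrightarrow> 0) (at_right 0)"
    using filterlim_compose[OF tendsto_power_div_exp_0[of n] filterlim_inverse_at_top_right] .
  then show "(flat n \<longlongrightarrow> 0) (at_right 0)"
  proof (rule Lim_transform_eventually)
    show "eventually (\<lambda>x. inverse x ^ n / exp (inverse x) = flat n x) (at_right 0)"
      unfolding eventually_at_filter
      by (auto simp: flat_def exp_minus divide_simps power_inverse)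
  qed
qed

lemma has_real_derivative_flat:
  "(flat n has_real_derivative (flat (n + 2) x - real n * flat (n + 1) x)) (at x)"
proof -
  consider "x < 0" | "x = 0" | "x > 0" by linarith
  then show ?thesis
  proof cases
    case 1
    have "((\<lambda>x. 0) has_real_derivative 0) (at x)" by simp
    then have "(flat n has_real_derivative 0) (at x)"
      by (rule has_field_derivative_transform_within_open[where S = "{..<0}"])
        (use 1 in \<open>auto simp: flat_def\<close>)
    then show ?thesis using 1 by (simp add: flat_def)
  next
    case 2
    \<comment> \<open>The difference quotient at 0 is again a member of the family, namely
      \<open>flat (Suc n)\<close>.\<close>
    have "(\<lambda>y. (flat n y - flat n 0) / (y - 0)) \<midarrow>0\<rightarrow> 0"
      by (rule Lim_transform_eventually[OF tendsto_flat_0[of "Suc n"]])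
        (auto simp: flat_def eventually_at_filter)
    then show ?thesis using 2 by (simp add: has_field_derivative_iff flat_def)
  next
    case 3
    have "((\<lambda>x. exp (- 1 / x) / x ^ n) has_real_derivative
      (exp (- 1 / x) * (1 / (x * x)) * x ^ n - exp (- 1 / x) * (real n * x ^ (n - 1))) / (x ^ n * x ^ n)) (at x)"
      using 3 by (auto intro!: derivative_eq_intros)
    moreover have "(exp (- 1 / x) * (1 / (x * x)) * x ^ n - exp (- 1 / x) * (real n * x ^ (n - 1))) / (x ^ n * x ^ n)
      = exp (- 1 / x) / x ^ (n + 2) - real n * (exp (- 1 / x) / x ^ (n + 1))"
      using 3 by (cases n) (simp_all add: field_simps)
    ultimately have "((\<lambda>x. exp (- 1 / x) / x ^ n) has_real_derivative
      (exp (- 1 / x) / x ^ (n + 2) - real n * (exp (- 1 / x) / x ^ (n + 1)))) (at x)"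
      by simp
    then show ?thesis
      using 3 by (intro has_field_derivative_transform_within_open[where S = "{0<..}" and g = "flat n"])
        (auto simp: flat_def)
  qed
qed

lemma smooth_on_flat: "smooth_on UNIV (flat n)"
proof (unfold smooth_on_def, intro allI)
  fix k
  show "k_times_diff_on k UNIV (flat n)"
  proof (induction k arbitrary: n)
    case 0
    then show ?case
      using has_real_derivative_flat by (auto intro!: continuous_at_imp_continuous_on DERIV_isCont)
  next
    case (Suc k)
    show ?case
    proof (rule k_times_diff_on_SucI)
      show "(flat n has_derivative (\<lambda>v. (flat (n + 2) x + (- real n) * flat (n + 1) x) * v)) (at x)" for x
        using has_real_derivative_flat[of n x] by (simp add: has_field_derivative_def)
      show "k_times_diff_on k UNIV (\<lambda>x. (flat (n + 2) x + (- real n) * flat (n + 1) x) * v)" for v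
        using Suc by (intro k_times_diff_on_add k_times_diff_on_const
            k_times_diff_on_bilinear[OF _ bounded_bilinear_mult]) auto
    qed auto
  qed
qed

text \<open>A quotient of two flat terms: the one at \<open>t - r / 2\<close> vanishes to the left
  of \<open>r / 2\<close>, the one at \<open>r - t\<close> to the right of \<open>r\<close>. It is
  applied later to a squared distance.\<close>

lemma smooth_step:
  fixes r :: real
  assumes "r > 0"
  obtains b :: "real \<Rightarrow> real" where "smooth_on UNIV b" "\<And>t. b t \<ge> 0"
    "\<And>t. t \<le> r / 2 \<Longrightarrow> b t = 1" "\<And>t. t \<ge> r \<Longrightarrow> b t = 0"
proof
  let ?d = "\<lambda>t. flat 0 (r + - t) + flat 0 (t + - (r / 2))"
  let ?b = "\<lambda>t. flat 0 (r + - t) * inverse (?d t)"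
  \<comment> \<open>At least one of \<open>r - t\<close> and \<open>t - r / 2\<close> is positive,
    because \<open>r / 2 < r\<close>.\<close>
  have pos: "?d t > 0" for t
    using assms flat_pos[of "r + - t" 0] flat_pos[of "t + - (r / 2)" 0]
      flat_nonneg[of 0 "r + - t"] flat_nonneg[of 0 "t + - (r / 2)"]
    by (cases "t < r") linarith+
  have "smooth_on UNIV (\<lambda>t. r + - t)" "smooth_on UNIV (\<lambda>t. t + - (r / 2))"
    by (intro smooth_on_add smooth_on_const smooth_on_id smooth_on_bounded_linear
        bounded_linear_minus bounded_linear_ident open_UNIV)+
  then have 1: "smooth_on UNIV (\<lambda>t. flat 0 (r + - t))" "smooth_on UNIV (\<lambda>t. flat 0 (t + - (r / 2)))"
    by (auto intro: smooth_on_compose[OF _ _ _ smooth_on_flat])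
  then have 2: "smooth_on UNIV ?d" by (intro smooth_on_add) auto
  have "smooth_on UNIV (\<lambda>t. inverse (?d t))"
    by (rule smooth_on_compose[OF _ _ _ smooth_on_inverse 2]) (use pos in \<open>auto simp: less_le\<close>)
  with 1 show "smooth_on UNIV ?b" by (intro smooth_on_mult) auto
  show "?b t \<ge> 0" for t using pos[of t] flat_nonneg by (auto intro!: mult_nonneg_nonneg)
  show "?b t = 1" if "t \<le> r / 2" for t
  proof -
    have "flat 0 (t + - (r / 2)) = 0" using that by (intro flat_eq_0) simp
    then show ?thesis using pos[of t] by simp
  qed
  show "?b t = 0" if "t \<ge> r" for t
    using that by (simp add: flat_eq_0)
qed

section \<open>Smooth maps on open subsets of manifolds\<close>

text \<open>Charts and their inverses are total HOL functions that mean something only on an open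
  set, so smoothness is relativised to a set \<open>S\<close>, meant to be open.\<close>

definition smooth_map_on ::
  "('a::topological_space, 'd::euclidean_space) chart set \<Rightarrow>
   ('b::topological_space, 'e::euclidean_space) chart set \<Rightarrow> 'a set \<Rightarrow> ('a \<Rightarrow> 'b) \<Rightarrow> bool" where
  "smooth_map_on A B S f \<longleftrightarrow> continuous_on S f \<and>
     (\<forall>(U, \<phi>)\<in>A. \<forall>(V, \<psi>)\<in>B. smooth_on (\<phi> ` (U \<inter> (S \<inter> f -` V))) (\<psi> \<circ> f \<circ> inv_into U \<phi>))"

lemma smooth_map_eq_smooth_map_on: "smooth_map A B f \<longleftrightarrow> smooth_map_on A B UNIV f"
  by (simp add: smooth_map_def smooth_map_on_def)

lemma smooth_atlas_open:
  assumes "smooth_atlas A" "(U, \<phi>) \<in> A"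
  shows "open U"
  using assms unfolding smooth_atlas_def by blast

lemma smooth_atlas_homeomorphism:
  assumes "smooth_atlas A" "(U, \<phi>) \<in> A"
  shows "homeomorphism U (\<phi> ` U) \<phi> (inv_into U \<phi>)"
  using assms unfolding smooth_atlas_def by blast

lemma smooth_atlas_inj_on:
  assumes "smooth_atlas A" "(U, \<phi>) \<in> A"
  shows "inj_on \<phi> U"
  using smooth_atlas_homeomorphism[OF assms] unfolding homeomorphism_def by (metis inj_onI)

lemma smooth_atlas_continuous_on:
  assumes "smooth_atlas A" "(U, \<phi>) \<in> A"
  shows "continuous_on U \<phi>" "continuous_on (\<phi> ` U) (inv_into U \<phi>)"
  using smooth_atlas_homeomorphism[OF assms] unfolding homeomorphism_def by auto

lemma smooth_atlas_inv_into:
  assumes "smooth_atlas A" "(U, \<phi>) \<in> A" "x \<in> U"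
  shows "inv_into U \<phi> (\<phi> x) = x"
  using smooth_atlas_inj_on[OF assms(1,2)] assms(3) by simp

lemma smooth_atlas_rep_image:
  assumes "smooth_atlas A" "(U, \<phi>) \<in> A" "T \<subseteq> U"
  shows "(g \<circ> inv_into U \<phi>) ` \<phi> ` T = g ` T"
proof -
  have "inv_into U \<phi> (\<phi> x) = x" if "x \<in> T" for x
    using smooth_atlas_inv_into[OF assms(1,2)] assms(3) that by auto
  then show ?thesis by (simp add: image_image cong: image_cong)
qed

lemma smooth_atlas_open_image:
  assumes "smooth_atlas A" "(U, \<phi>) \<in> A" "open T" "T \<subseteq> U"
  shows "open (\<phi> ` T)"
proof -
  have "open (\<phi> ` U)" using assms(1,2) unfolding smooth_atlas_def by blast
  then have "open (\<phi> ` U \<inter> inv_into U \<phi> -` T)"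
    using smooth_atlas_continuous_on(2)[OF assms(1,2)] assms(3) continuous_on_open_vimage
    by (metis Int_commute)
  also have "\<phi> ` U \<inter> inv_into U \<phi> -` T = \<phi> ` T"
    using smooth_atlas_inv_into[OF assms(1,2)] assms(4) by (auto intro!: rev_image_eqI)
  finally show ?thesis .
qed

lemma smooth_atlas_transition:
  assumes "smooth_atlas A" "(U, \<phi>) \<in> A" "(V, \<psi>) \<in> A"
  shows "smooth_on (\<phi> ` (U \<inter> V)) (\<psi> \<circ> inv_into U \<phi>)"
  using assms unfolding smooth_atlas_def by blast

lemma smooth_atlas_cover:
  assumes "smooth_atlas A"
  obtains U \<phi> where "(U, \<phi>) \<in> A" "p \<in> U"
  using assms unfolding smooth_atlas_def by blast

text \<open>One pair of charts around each point suffices, since any other pair differs from it by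
  transition maps, which the two atlases make smooth.\<close>

lemma smooth_map_onI:
  assumes A: "smooth_atlas A" and B: "smooth_atlas B" and "open S"
    and loc: "\<And>p. p \<in> S \<Longrightarrow> \<exists>U \<phi> V \<psi> N. (U, \<phi>) \<in> A \<and> (V, \<psi>) \<in> B \<and> open N \<and> p \<in> N \<and>
      N \<subseteq> S \<inter> U \<and> f ` N \<subseteq> V \<and> smooth_on (\<phi> ` N) (\<psi> \<circ> f \<circ> inv_into U \<phi>)"
  shows "smooth_map_on A B S f"
proof -
  have "isCont f p" if p: "p \<in> S" for p
  proof -
    obtain U \<phi> V \<psi> N where *: "(U, \<phi>) \<in> A" "(V, \<psi>) \<in> B" "open N" "p \<in> N" "N \<subseteq> S \<inter> U" "f ` N \<subseteq> V"
      "smooth_on (\<phi> ` N) (\<psi> \<circ> f \<circ> inv_into U \<phi>)"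
      using loc[OF p] by blast
    have inv: "inv_into U \<phi> (\<phi> x) = x" if "x \<in> N" for x
      using smooth_atlas_inv_into[OF A *(1)] that * by auto
    \<comment> \<open>Locally \<open>f\<close> is recovered as inverse chart after coordinate
      expression after chart. Its continuity comes first, because shrinking to a second pair of
      charts below uses that preimages under \<open>f\<close> are open.\<close>
    have "continuous_on N (\<lambda>x. inv_into V \<psi> ((\<psi> \<circ> f \<circ> inv_into U \<phi>) (\<phi> x)))"
    proof (rule continuous_on_compose2[OF smooth_atlas_continuous_on(2)[OF B *(2)]])
      show "continuous_on N (\<lambda>x. (\<psi> \<circ> f \<circ> inv_into U \<phi>) (\<phi> x))"
        using *(5) by (intro continuous_on_compose2[OF smooth_on_imp_continuous_on[OF *(7)]]
            continuous_on_subset[OF smooth_atlas_continuous_on(1)[OF A *(1)]]) auto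
    qed (use * inv in auto)
    then have "continuous_on N f"
      by (rule continuous_on_eq) (use smooth_atlas_inv_into[OF B *(2)] *(6) inv in auto)
    then show ?thesis using *(3,4) continuous_on_eq_continuous_at by blast
  qed
  then have cont: "continuous_on S f" by (simp add: continuous_at_imp_continuous_on)
  have "smooth_on (\<phi>' ` (U' \<inter> (S \<inter> f -` V'))) (\<psi>' \<circ> f \<circ> inv_into U' \<phi>')"
    if U': "(U', \<phi>') \<in> A" and V': "(V', \<psi>') \<in> B" for U' \<phi>' V' \<psi>'
  proof (rule smooth_on_locally)
    fix x assume "x \<in> \<phi>' ` (U' \<inter> (S \<inter> f -` V'))"
    then obtain p where p: "p \<in> U'" "p \<in> S" "f p \<in> V'" "x = \<phi>' p" by auto
    obtain U \<phi> V \<psi> N where *: "(U, \<phi>) \<in> A" "(V, \<psi>) \<in> B" "open N" "p \<in> N" "N \<subseteq> S \<inter> U" "f ` N \<subseteq> V"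
      "smooth_on (\<phi> ` N) (\<psi> \<circ> f \<circ> inv_into U \<phi>)"
      using loc[OF p(2)] by blast
    define N' where "N' = N \<inter> U' \<inter> f -` V'"
    have "continuous_on (N \<inter> U') f" by (rule continuous_on_subset[OF cont]) (use * in auto)
    then have N': "open N'" "p \<in> N'" "N' \<subseteq> U \<inter> U'" "f ` N' \<subseteq> V \<inter> V'" "N' \<subseteq> N"
      using * p smooth_atlas_open[OF A U'] continuous_open_preimage[of "N \<inter> U'" f V'] smooth_atlas_open[OF B V']
      by (auto simp: N'_def)
    note inv = smooth_atlas_inv_into[OF A *(1)] smooth_atlas_inv_into[OF B *(2)] smooth_atlas_inv_into[OF A U']
    have 1: "smooth_on (\<phi>' ` N') (\<phi> \<circ> inv_into U' \<phi>')"
      using N' by (intro smooth_on_subset[OF smooth_atlas_transition[OF A U' *(1)]]) auto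
    have 2: "smooth_on (\<psi> ` (V \<inter> V')) (\<psi>' \<circ> inv_into V \<psi>)"
      by (rule smooth_atlas_transition[OF B *(2) V'])
    have o: "open (\<phi>' ` N')" "open (\<phi> ` N)" "open (\<psi> ` (V \<inter> V'))" "open (\<phi> ` N')"
      using smooth_atlas_open_image[OF A U' N'(1)] N' smooth_atlas_open_image[OF A *(1,3)]
        smooth_atlas_open_image[OF B *(2), of "V \<inter> V'"] smooth_atlas_open[OF B V']
        smooth_atlas_open[OF B *(2)] * smooth_atlas_open_image[OF A *(1) N'(1)]
      by auto
    have 3: "smooth_on (\<phi> ` N') (\<lambda>y. (\<psi>' \<circ> inv_into V \<psi>) ((\<psi> \<circ> f \<circ> inv_into U \<phi>) y))"
    proof (rule smooth_on_compose[OF o(4) o(3) _ 2])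
      show "smooth_on (\<phi> ` N') (\<psi> \<circ> f \<circ> inv_into U \<phi>)"
        using N' by (intro smooth_on_subset[OF *(7)]) auto
      show "(\<psi> \<circ> f \<circ> inv_into U \<phi>) ` \<phi> ` N' \<subseteq> \<psi> ` (V \<inter> V')"
        using smooth_atlas_rep_image[OF A *(1), of N' "\<psi> \<circ> f"] N'(3) image_mono[OF N'(4), of \<psi>]
        by (metis image_comp le_inf_iff)
    qed
    have 4: "smooth_on (\<phi>' ` N') (\<lambda>y. (\<psi>' \<circ> inv_into V \<psi>) ((\<psi> \<circ> f \<circ> inv_into U \<phi>) ((\<phi> \<circ> inv_into U' \<phi>') y)))"
    proof (rule smooth_on_compose[OF o(1) o(4) _ 3 1])
      show "(\<phi> \<circ> inv_into U' \<phi>') ` \<phi>' ` N' \<subseteq> \<phi> ` N'"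
        using smooth_atlas_rep_image[OF A U', of N' \<phi>] N'(3) by (metis le_inf_iff order_refl)
    qed
    have "smooth_on (\<phi>' ` N') (\<psi>' \<circ> f \<circ> inv_into U' \<phi>')"
    proof (rule smooth_on_cong[OF o(1) 4])
      fix y assume "y \<in> \<phi>' ` N'"
      then obtain q where q: "q \<in> N'" "y = \<phi>' q" by auto
      with N' have "q \<in> U" "q \<in> U'" "f q \<in> V" by auto
      then show "(\<psi>' \<circ> inv_into V \<psi>) ((\<psi> \<circ> f \<circ> inv_into U \<phi>) ((\<phi> \<circ> inv_into U' \<phi>') y)) =
          (\<psi>' \<circ> f \<circ> inv_into U' \<phi>') y"
        using q inv by simp
    qed
    with o(1) N'(2) p(4) show "\<exists>T. open T \<and> x \<in> T \<and> smooth_on T (\<psi>' \<circ> f \<circ> inv_into U' \<phi>')"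
      by blast
  qed
  with cont show ?thesis unfolding smooth_map_on_def by blast
qed

lemma smooth_map_onE:
  assumes A: "smooth_atlas A" and B: "smooth_atlas B" and "open S" and f: "smooth_map_on A B S f"
    and p: "p \<in> S" "p \<in> U" "f p \<in> V" and U: "(U, \<phi>) \<in> A" and V: "(V, \<psi>) \<in> B"
  obtains N where "open N" "p \<in> N" "N \<subseteq> S \<inter> U" "f ` N \<subseteq> V"
    "smooth_on (\<phi> ` N) (\<psi> \<circ> f \<circ> inv_into U \<phi>)"
proof
  let ?N = "U \<inter> (S \<inter> f -` V)"
  have "continuous_on (U \<inter> S) f" using f unfolding smooth_map_on_def by (auto intro: continuous_on_subset)
  then show "open ?N"
    using continuous_open_preimage[of "U \<inter> S" f V] smooth_atlas_open[OF A U] smooth_atlas_open[OF B V] \<open>open S\<close>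
    by (auto simp: Int_ac)
  show "smooth_on (\<phi> ` ?N) (\<psi> \<circ> f \<circ> inv_into U \<phi>)" using f U V unfolding smooth_map_on_def by blast
qed (use p in auto)

lemma smooth_map_on_imp_continuous_on: "smooth_map_on A B S f \<Longrightarrow> continuous_on S f"
  by (simp add: smooth_map_on_def)

lemma smooth_map_on_locally:
  assumes A: "smooth_atlas A" and B: "smooth_atlas B" and "open S"
    and loc: "\<And>p. p \<in> S \<Longrightarrow> \<exists>T. open T \<and> p \<in> T \<and> smooth_map_on A B T f"
  shows "smooth_map_on A B S f"
proof (rule smooth_map_onI[OF A B \<open>open S\<close>])
  fix p assume p: "p \<in> S"
  obtain T where T: "open T" "p \<in> T" "smooth_map_on A B T f" using loc[OF p] by blast
  obtain U \<phi> where U: "(U, \<phi>) \<in> A" "p \<in> U" using smooth_atlas_cover[OF A] by blast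
  obtain V \<psi> where V: "(V, \<psi>) \<in> B" "f p \<in> V" using smooth_atlas_cover[OF B] by blast
  obtain N where N: "open N" "p \<in> N" "N \<subseteq> T \<inter> U" "f ` N \<subseteq> V" "smooth_on (\<phi> ` N) (\<psi> \<circ> f \<circ> inv_into U \<phi>)"
    using smooth_map_onE[OF A B T(1,3,2) U(2) V(2) U(1) V(1)] .
  have "smooth_on (\<phi> ` (N \<inter> S)) (\<psi> \<circ> f \<circ> inv_into U \<phi>)"
    by (rule smooth_on_subset[OF N(5)]) auto
  then show "\<exists>U \<phi> V \<psi> N. (U, \<phi>) \<in> A \<and> (V, \<psi>) \<in> B \<and> open N \<and> p \<in> N \<and>
      N \<subseteq> S \<inter> U \<and> f ` N \<subseteq> V \<and> smooth_on (\<phi> ` N) (\<psi> \<circ> f \<circ> inv_into U \<phi>)"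
    using U V N p \<open>open S\<close>
    by (intro exI[of _ U] exI[of _ \<phi>] exI[of _ V] exI[of _ \<psi>] exI[of _ "N \<inter> S"]) auto
qed

lemma smooth_map_on_subset:
  assumes A: "smooth_atlas A" and B: "smooth_atlas B"
    and "open S" "smooth_map_on A B S f" "open T" "T \<subseteq> S"
  shows "smooth_map_on A B T f"
  by (rule smooth_map_on_locally[OF A B]) (use assms in auto)

lemma smooth_map_on_cong:
  assumes A: "smooth_atlas A" and B: "smooth_atlas B"
    and "open S" "smooth_map_on A B S f" "\<And>x. x \<in> S \<Longrightarrow> f x = g x"
  shows "smooth_map_on A B S g"
proof (rule smooth_map_onI[OF A B \<open>open S\<close>])
  fix p assume p: "p \<in> S"
  obtain U \<phi> where U: "(U, \<phi>) \<in> A" "p \<in> U" using smooth_atlas_cover[OF A] by blast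
  obtain V \<psi> where V: "(V, \<psi>) \<in> B" "f p \<in> V" using smooth_atlas_cover[OF B] by blast
  obtain N where N: "open N" "p \<in> N" "N \<subseteq> S \<inter> U" "f ` N \<subseteq> V" "smooth_on (\<phi> ` N) (\<psi> \<circ> f \<circ> inv_into U \<phi>)"
    using smooth_map_onE[OF A B assms(3,4) p U(2) V(2) U(1) V(1)] .
  have "smooth_on (\<phi> ` N) (\<psi> \<circ> g \<circ> inv_into U \<phi>)"
  proof (rule smooth_on_cong[OF _ N(5)])
    show "open (\<phi> ` N)" using smooth_atlas_open_image[OF A U(1) N(1)] N by auto
    fix y assume "y \<in> \<phi> ` N"
    then obtain q where "q \<in> N" "y = \<phi> q" by auto
    with N(3) have "q \<in> S" "q \<in> U" "y = \<phi> q" by auto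
    then show "(\<psi> \<circ> f \<circ> inv_into U \<phi>) y = (\<psi> \<circ> g \<circ> inv_into U \<phi>) y"
      using assms(5) smooth_atlas_inv_into[OF A U(1)] by simp
  qed
  moreover have "g ` N \<subseteq> V" using N(3,4) assms(5) by force
  ultimately show "\<exists>U \<phi> V \<psi> N. (U, \<phi>) \<in> A \<and> (V, \<psi>) \<in> B \<and> open N \<and> p \<in> N \<and>
      N \<subseteq> S \<inter> U \<and> g ` N \<subseteq> V \<and> smooth_on (\<phi> ` N) (\<psi> \<circ> g \<circ> inv_into U \<phi>)"
    using U V N by (intro exI[of _ U] exI[of _ \<phi>] exI[of _ V] exI[of _ \<psi>] exI[of _ N]) auto
qed

lemma smooth_map_on_compose:
  assumes A: "smooth_atlas A" and B: "smooth_atlas B" and C: "smooth_atlas C"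
    and "open S" "open T" "f ` S \<subseteq> T" and g: "smooth_map_on B C T g" and f: "smooth_map_on A B S f"
  shows "smooth_map_on A C S (\<lambda>x. g (f x))"
proof (rule smooth_map_onI[OF A C \<open>open S\<close>])
  fix p assume p: "p \<in> S"
  then have fp: "f p \<in> T" using assms(6) by auto
  obtain U \<phi> where U: "(U, \<phi>) \<in> A" "p \<in> U" using smooth_atlas_cover[OF A] by blast
  obtain V \<psi> where V: "(V, \<psi>) \<in> B" "f p \<in> V" using smooth_atlas_cover[OF B] by blast
  obtain W \<xi> where W: "(W, \<xi>) \<in> C" "g (f p) \<in> W" using smooth_atlas_cover[OF C] by blast
  obtain N where N: "open N" "p \<in> N" "N \<subseteq> S \<inter> U" "f ` N \<subseteq> V" "smooth_on (\<phi> ` N) (\<psi> \<circ> f \<circ> inv_into U \<phi>)"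
    using smooth_map_onE[OF A B \<open>open S\<close> f p U(2) V(2) U(1) V(1)] .
  obtain M where M: "open M" "f p \<in> M" "M \<subseteq> T \<inter> V" "g ` M \<subseteq> W" "smooth_on (\<psi> ` M) (\<xi> \<circ> g \<circ> inv_into V \<psi>)"
    using smooth_map_onE[OF B C \<open>open T\<close> g fp V(2) W(2) V(1) W(1)] .
  define N' where "N' = N \<inter> f -` M"
  have "continuous_on N f"
    using smooth_map_on_imp_continuous_on[OF f] N by (auto intro: continuous_on_subset)
  then have N': "open N'" "p \<in> N'" "N' \<subseteq> S \<inter> U" "f ` N' \<subseteq> M" "N' \<subseteq> N"
    using N M continuous_open_preimage[of N f M] by (auto simp: N'_def)
  note inv = smooth_atlas_inv_into[OF A U(1)] smooth_atlas_inv_into[OF B V(1)]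
  have o: "open (\<phi> ` N')" "open (\<psi> ` M)"
    using smooth_atlas_open_image[OF A U(1) N'(1)] N' smooth_atlas_open_image[OF B V(1) M(1)] M by auto
  have "smooth_on (\<phi> ` N') (\<lambda>y. (\<xi> \<circ> g \<circ> inv_into V \<psi>) ((\<psi> \<circ> f \<circ> inv_into U \<phi>) y))"
  proof (rule smooth_on_compose[OF o _ M(5)])
    show "smooth_on (\<phi> ` N') (\<psi> \<circ> f \<circ> inv_into U \<phi>)" using N' by (intro smooth_on_subset[OF N(5)]) auto
    show "(\<psi> \<circ> f \<circ> inv_into U \<phi>) ` \<phi> ` N' \<subseteq> \<psi> ` M"
      using smooth_atlas_rep_image[OF A U(1), of N' "\<psi> \<circ> f"] N'(3) image_mono[OF N'(4), of \<psi>]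
      by (metis image_comp le_inf_iff)
  qed
  then have "smooth_on (\<phi> ` N') (\<xi> \<circ> (\<lambda>x. g (f x)) \<circ> inv_into U \<phi>)"
  proof (rule smooth_on_cong[OF o(1)])
    fix y assume "y \<in> \<phi> ` N'"
    then obtain q where q: "q \<in> N'" "y = \<phi> q" by auto
    with N' M have "q \<in> U" "f q \<in> V" by auto
    then show "(\<xi> \<circ> g \<circ> inv_into V \<psi>) ((\<psi> \<circ> f \<circ> inv_into U \<phi>) y) = (\<xi> \<circ> (\<lambda>x. g (f x)) \<circ> inv_into U \<phi>) y"
      using q inv by simp
  qed
  moreover have "(\<lambda>x. g (f x)) ` N' \<subseteq> W" using N' M by force
  ultimately show "\<exists>U \<phi> V \<psi> N. (U, \<phi>) \<in> A \<and> (V, \<psi>) \<in> C \<and> open N \<and> p \<in> N \<and>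
      N \<subseteq> S \<inter> U \<and> (\<lambda>x. g (f x)) ` N \<subseteq> V \<and> smooth_on (\<phi> ` N) (\<psi> \<circ> (\<lambda>x. g (f x)) \<circ> inv_into U \<phi>)"
    using U W N' by (intro exI[of _ U] exI[of _ \<phi>] exI[of _ W] exI[of _ \<xi>] exI[of _ N']) auto
qed

section \<open>The model space, charts as smooth maps, and products\<close>

lemma smooth_atlas_model: "smooth_atlas model_atlas"
proof -
  have "inv_into UNIV (id :: 'a \<Rightarrow> 'a) = id" by (auto simp: fun_eq_iff inv_f_eq)
  then show ?thesis
    using smooth_on_id[of "UNIV :: 'a set"]
    by (auto simp: smooth_atlas_def model_atlas_def homeomorphism_def id_def o_def)
qed

lemma smooth_map_on_model_iff:
  assumes "open S"
  shows "smooth_map_on model_atlas model_atlas S f \<longleftrightarrow> smooth_on S f"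
proof -
  have "inv_into UNIV (id :: 'a \<Rightarrow> 'a) = id" by (auto simp: fun_eq_iff inv_f_eq)
  then show ?thesis
    using smooth_on_imp_continuous_on by (auto simp: smooth_map_on_def model_atlas_def o_def)
qed

lemma smooth_map_on_chart:
  assumes A: "smooth_atlas A" and U: "(U, \<phi>) \<in> A"
  shows "smooth_map_on A model_atlas U \<phi>"
proof (rule smooth_map_onI[OF A smooth_atlas_model smooth_atlas_open[OF A U]])
  fix p assume p: "p \<in> U"
  have o: "open (\<phi> ` U)" using smooth_atlas_open_image[OF A U smooth_atlas_open[OF A U]] by auto
  have "smooth_on (\<phi> ` U) (id \<circ> \<phi> \<circ> inv_into U \<phi>)"
    by (rule smooth_on_cong[OF o smooth_on_id[OF o]]) (use smooth_atlas_inv_into[OF A U] in auto)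
  then show "\<exists>U' \<phi>' V \<psi> N. (U', \<phi>') \<in> A \<and> (V, \<psi>) \<in> model_atlas \<and> open N \<and> p \<in> N \<and>
      N \<subseteq> U \<inter> U' \<and> \<phi> ` N \<subseteq> V \<and> smooth_on (\<phi>' ` N) (\<psi> \<circ> \<phi> \<circ> inv_into U' \<phi>')"
    using p U smooth_atlas_open[OF A U]
    by (intro exI[of _ U] exI[of _ \<phi>] exI[of _ UNIV] exI[of _ id] exI[of _ U]) (auto simp: model_atlas_def)
qed

lemma smooth_map_on_chart_inverse:
  assumes A: "smooth_atlas A" and U: "(U, \<phi>) \<in> A"
  shows "smooth_map_on model_atlas A (\<phi> ` U) (inv_into U \<phi>)"
proof -
  have o: "open (\<phi> ` U)" using smooth_atlas_open_image[OF A U smooth_atlas_open[OF A U]] by auto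
  show ?thesis
  proof (rule smooth_map_onI[OF smooth_atlas_model A o])
    fix x assume x: "x \<in> \<phi> ` U"
    have "smooth_on (\<phi> ` U) (\<phi> \<circ> inv_into U \<phi> \<circ> inv_into UNIV id)"
      by (rule smooth_on_cong[OF o smooth_on_id[OF o]])
        (use smooth_atlas_inv_into[OF A U] in \<open>auto simp: inv_f_eq\<close>)
    then show "\<exists>U' \<phi>' V \<psi> N. (U', \<phi>') \<in> model_atlas \<and> (V, \<psi>) \<in> A \<and> open N \<and> x \<in> N \<and>
        N \<subseteq> \<phi> ` U \<inter> U' \<and> inv_into U \<phi> ` N \<subseteq> V \<and> smooth_on (\<phi>' ` N) (\<psi> \<circ> inv_into U \<phi> \<circ> inv_into U' \<phi>')"
      using x U o smooth_atlas_inv_into[OF A U]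
      by (intro exI[of _ UNIV] exI[of _ id] exI[of _ U] exI[of _ \<phi>] exI[of _ "\<phi> ` U"])
        (auto simp: model_atlas_def)
  qed
qed

lemma inv_into_map_prod:
  assumes "inj_on \<phi> U" "inj_on \<psi> V" "z \<in> map_prod \<phi> \<psi> ` (U \<times> V)"
  shows "inv_into (U \<times> V) (map_prod \<phi> \<psi>) z = (inv_into U \<phi> (fst z), inv_into V \<psi> (snd z))"
proof -
  obtain x y where "x \<in> U" "y \<in> V" "z = (\<phi> x, \<psi> y)" using assms(3) by auto
  then show ?thesis using assms by (auto intro!: inv_into_f_eq map_prod_inj_on)
qed

lemma smooth_atlas_prod:
  assumes A: "smooth_atlas A" and B: "smooth_atlas B"
  shows "smooth_atlas (prod_atlas A B)"
  unfolding smooth_atlas_def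
proof (intro conjI)
  show "\<forall>(W, \<xi>)\<in>prod_atlas A B. open W \<and> open (\<xi> ` W) \<and> homeomorphism W (\<xi> ` W) \<xi> (inv_into W \<xi>)"
  proof (clarify)
    fix W \<xi> assume "(W, \<xi>) \<in> prod_atlas A B"
    then obtain U \<phi> V \<psi> where W: "W = U \<times> V" "\<xi> = map_prod \<phi> \<psi>" and U: "(U, \<phi>) \<in> A" and V: "(V, \<psi>) \<in> B"
      unfolding prod_atlas_def by blast
    have im: "\<xi> ` W = \<phi> ` U \<times> \<psi> ` V" by (auto simp: W)
    have inj: "inj_on \<phi> U" "inj_on \<psi> V" using smooth_atlas_inj_on A B U V by blast+
    have "homeomorphism W (\<xi> ` W) \<xi> (inv_into W \<xi>)"
      unfolding homeomorphism_def
    proof (intro conjI ballI)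
      have "continuous_on W (\<lambda>z. (\<phi> (fst z), \<psi> (snd z)))"
        by (intro continuous_on_Pair continuous_on_compose2[OF smooth_atlas_continuous_on(1)[OF A U]]
            continuous_on_compose2[OF smooth_atlas_continuous_on(1)[OF B V]]) (auto simp: W intro!: continuous_intros)
      then show "continuous_on W \<xi>" by (simp add: W map_prod_def split_beta')
      have "continuous_on (\<xi> ` W) (\<lambda>z. (inv_into U \<phi> (fst z), inv_into V \<psi> (snd z)))"
        by (intro continuous_on_Pair continuous_on_compose2[OF smooth_atlas_continuous_on(2)[OF A U]]
            continuous_on_compose2[OF smooth_atlas_continuous_on(2)[OF B V]]) (auto simp: W intro!: continuous_intros)
      then show "continuous_on (\<xi> ` W) (inv_into W \<xi>)"
        by (rule continuous_on_eq) (use inv_into_map_prod[OF inj] in \<open>auto simp: W\<close>)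
    qed (use inj map_prod_inj_on[OF inj] in \<open>auto simp: W f_inv_into_f inv_into_into simp del: map_prod_simp
        intro!: rev_image_eqI\<close>)
    then show "open W \<and> open (\<xi> ` W) \<and> homeomorphism W (\<xi> ` W) \<xi> (inv_into W \<xi>)"
      using im W smooth_atlas_open[OF A U] smooth_atlas_open[OF B V]
        smooth_atlas_open_image[OF A U] smooth_atlas_open_image[OF B V] by (simp add: open_Times)
  qed
  have "\<exists>W \<xi>. (W, \<xi>) \<in> prod_atlas A B \<and> z \<in> W" for z
  proof -
    obtain U \<phi> where U: "(U, \<phi>) \<in> A" "fst z \<in> U" using smooth_atlas_cover[OF A] by blast
    obtain V \<psi> where V: "(V, \<psi>) \<in> B" "snd z \<in> V" using smooth_atlas_cover[OF B] by blast
    show ?thesis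
      using U V unfolding prod_atlas_def
      by (intro exI[of _ "U \<times> V"] exI[of _ "map_prod \<phi> \<psi>"]) (auto simp: mem_Times_iff)
  qed
  then show "(\<Union>(W, \<xi>)\<in>prod_atlas A B. W) = UNIV" by blast
  show "\<forall>(W, \<xi>)\<in>prod_atlas A B. \<forall>(W', \<xi>')\<in>prod_atlas A B. smooth_on (\<xi> ` (W \<inter> W')) (\<xi>' \<circ> inv_into W \<xi>)"
  proof (clarify)
    fix W \<xi> W' \<xi>' assume "(W, \<xi>) \<in> prod_atlas A B" "(W', \<xi>') \<in> prod_atlas A B"
    then obtain U \<phi> V \<psi> U' \<phi>' V' \<psi>' where W: "W = U \<times> V" "\<xi> = map_prod \<phi> \<psi>"
      and U: "(U, \<phi>) \<in> A" and V: "(V, \<psi>) \<in> B"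
      and W': "W' = U' \<times> V'" "\<xi>' = map_prod \<phi>' \<psi>'"
      and U': "(U', \<phi>') \<in> A" and V': "(V', \<psi>') \<in> B"
      unfolding prod_atlas_def by blast
    have inj: "inj_on \<phi> U" "inj_on \<psi> V" using smooth_atlas_inj_on A B U V by blast+
    have im: "\<xi> ` (W \<inter> W') = \<phi> ` (U \<inter> U') \<times> \<psi> ` (V \<inter> V')" unfolding W W' by auto
    have o: "open (\<phi> ` (U \<inter> U'))" "open (\<psi> ` (V \<inter> V'))"
      using smooth_atlas_open_image[OF A U, of "U \<inter> U'"] smooth_atlas_open_image[OF B V, of "V \<inter> V'"]
        smooth_atlas_open A B U U' V V' by blast+
    have ow: "open (\<xi> ` (W \<inter> W'))" using o im by (simp add: open_Times)
    have "smooth_on (\<xi> ` (W \<inter> W'))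
        (\<lambda>z. ((\<phi>' \<circ> inv_into U \<phi>) (fst z), (\<psi>' \<circ> inv_into V \<psi>) (snd z)))"
    proof (rule smooth_on_Pair[OF ow])
      show "smooth_on (\<xi> ` (W \<inter> W')) (\<lambda>z. (\<phi>' \<circ> inv_into U \<phi>) (fst z))"
        by (rule smooth_on_compose[OF ow o(1) _ smooth_atlas_transition[OF A U U']])
          (use im ow in \<open>auto intro: smooth_on_bounded_linear bounded_linear_fst\<close>)
      show "smooth_on (\<xi> ` (W \<inter> W')) (\<lambda>z. (\<psi>' \<circ> inv_into V \<psi>) (snd z))"
        by (rule smooth_on_compose[OF ow o(2) _ smooth_atlas_transition[OF B V V']])
          (use im ow in \<open>auto intro: smooth_on_bounded_linear bounded_linear_snd\<close>)
    qed
    then show "smooth_on (\<xi> ` (W \<inter> W')) (\<xi>' \<circ> inv_into W \<xi>)"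
    proof (rule smooth_on_cong[OF ow])
      fix z assume "z \<in> \<xi> ` (W \<inter> W')"
      then have "z \<in> map_prod \<phi> \<psi> ` (U \<times> V)" unfolding W by blast
      from inv_into_map_prod[OF inj this]
      show "((\<phi>' \<circ> inv_into U \<phi>) (fst z), (\<psi>' \<circ> inv_into V \<psi>) (snd z)) = (\<xi>' \<circ> inv_into W \<xi>) z"
        by (simp add: W W')
    qed
  qed
qed

lemma smooth_map_on_Pair:
  assumes A: "smooth_atlas A" and B: "smooth_atlas B" and C: "smooth_atlas C"
    and S: "open S" and f: "smooth_map_on C A S f" and g: "smooth_map_on C B S g"
  shows "smooth_map_on C (prod_atlas A B) S (\<lambda>x. (f x, g x))"
proof (rule smooth_map_onI[OF C smooth_atlas_prod[OF A B] S])
  fix p assume p: "p \<in> S"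
  obtain W \<xi> where W: "(W, \<xi>) \<in> C" "p \<in> W" using smooth_atlas_cover[OF C] by blast
  obtain U \<phi> where U: "(U, \<phi>) \<in> A" "f p \<in> U" using smooth_atlas_cover[OF A] by blast
  obtain V \<psi> where V: "(V, \<psi>) \<in> B" "g p \<in> V" using smooth_atlas_cover[OF B] by blast
  obtain N where N: "open N" "p \<in> N" "N \<subseteq> S \<inter> W" "f ` N \<subseteq> U" "smooth_on (\<xi> ` N) (\<phi> \<circ> f \<circ> inv_into W \<xi>)"
    using smooth_map_onE[OF C A S f p W(2) U(2) W(1) U(1)] .
  obtain M where M: "open M" "p \<in> M" "M \<subseteq> S \<inter> W" "g ` M \<subseteq> V" "smooth_on (\<xi> ` M) (\<psi> \<circ> g \<circ> inv_into W \<xi>)"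
    using smooth_map_onE[OF C B S g p W(2) V(2) W(1) V(1)] .
  have o: "open (\<xi> ` (N \<inter> M))" using smooth_atlas_open_image[OF C W(1), of "N \<inter> M"] N M by auto
  have "smooth_on (\<xi> ` (N \<inter> M)) (\<lambda>y. ((\<phi> \<circ> f \<circ> inv_into W \<xi>) y, (\<psi> \<circ> g \<circ> inv_into W \<xi>) y))"
    by (intro smooth_on_Pair[OF o] smooth_on_subset[OF N(5)] smooth_on_subset[OF M(5)]) auto
  then have "smooth_on (\<xi> ` (N \<inter> M)) (map_prod \<phi> \<psi> \<circ> (\<lambda>x. (f x, g x)) \<circ> inv_into W \<xi>)"
    by (rule smooth_on_cong[OF o]) auto
  moreover have "(U \<times> V, map_prod \<phi> \<psi>) \<in> prod_atlas A B" using U V unfolding prod_atlas_def by auto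
  moreover have "(\<lambda>x. (f x, g x)) ` (N \<inter> M) \<subseteq> U \<times> V" using N M by auto
  ultimately show "\<exists>U \<phi> V \<psi> N. (U, \<phi>) \<in> C \<and> (V, \<psi>) \<in> prod_atlas A B \<and> open N \<and> p \<in> N \<and>
      N \<subseteq> S \<inter> U \<and> (\<lambda>x. (f x, g x)) ` N \<subseteq> V \<and> smooth_on (\<phi> ` N) (\<psi> \<circ> (\<lambda>x. (f x, g x)) \<circ> inv_into U \<phi>)"
    using W N M
    by (intro exI[of _ W] exI[of _ \<xi>] exI[of _ "U \<times> V"] exI[of _ "map_prod \<phi> \<psi>"] exI[of _ "N \<inter> M"]) auto
qed

lemma smooth_map_on_fst:
  assumes A: "smooth_atlas A" and B: "smooth_atlas B"
  shows "smooth_map_on (prod_atlas A B) A UNIV fst"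
proof (rule smooth_map_onI[OF smooth_atlas_prod[OF A B] A open_UNIV])
  fix p :: "'a \<times> 'c"
  obtain U \<phi> where U: "(U, \<phi>) \<in> A" "fst p \<in> U" using smooth_atlas_cover[OF A] by blast
  obtain V \<psi> where V: "(V, \<psi>) \<in> B" "snd p \<in> V" using smooth_atlas_cover[OF B] by blast
  have inj: "inj_on \<phi> U" "inj_on \<psi> V" using smooth_atlas_inj_on A B U V by blast+
  have W: "(U \<times> V, map_prod \<phi> \<psi>) \<in> prod_atlas A B" "open (U \<times> V)"
    using U V smooth_atlas_open[OF A] smooth_atlas_open[OF B] unfolding prod_atlas_def by (auto intro: open_Times)
  have o: "open (map_prod \<phi> \<psi> ` (U \<times> V))"
    using smooth_atlas_open_image[OF smooth_atlas_prod[OF A B] W] by auto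
  have "smooth_on (map_prod \<phi> \<psi> ` (U \<times> V)) (\<phi> \<circ> fst \<circ> inv_into (U \<times> V) (map_prod \<phi> \<psi>))"
    by (rule smooth_on_cong[OF o smooth_on_bounded_linear[OF o bounded_linear_fst]])
      (use inv_into_map_prod[OF inj] inj in \<open>auto simp: f_inv_into_f\<close>)
  then show "\<exists>U \<phi> V \<psi> N. (U, \<phi>) \<in> prod_atlas A B \<and> (V, \<psi>) \<in> A \<and> open N \<and> p \<in> N \<and>
      N \<subseteq> UNIV \<inter> U \<and> fst ` N \<subseteq> V \<and> smooth_on (\<phi> ` N) (\<psi> \<circ> fst \<circ> inv_into U \<phi>)"
    using U V W
    by (intro exI[of _ "U \<times> V"] exI[of _ "map_prod \<phi> \<psi>"] exI[of _ U] exI[of _ \<phi>] exI[of _ "U \<times> V"])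
      (auto simp: mem_Times_iff)
qed

lemma smooth_map_on_snd:
  assumes A: "smooth_atlas A" and B: "smooth_atlas B"
  shows "smooth_map_on (prod_atlas A B) B UNIV snd"
proof (rule smooth_map_onI[OF smooth_atlas_prod[OF A B] B open_UNIV])
  fix p :: "'a \<times> 'c"
  obtain U \<phi> where U: "(U, \<phi>) \<in> A" "fst p \<in> U" using smooth_atlas_cover[OF A] by blast
  obtain V \<psi> where V: "(V, \<psi>) \<in> B" "snd p \<in> V" using smooth_atlas_cover[OF B] by blast
  have inj: "inj_on \<phi> U" "inj_on \<psi> V" using smooth_atlas_inj_on A B U V by blast+
  have W: "(U \<times> V, map_prod \<phi> \<psi>) \<in> prod_atlas A B" "open (U \<times> V)"
    using U V smooth_atlas_open[OF A] smooth_atlas_open[OF B] unfolding prod_atlas_def by (auto intro: open_Times)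
  have o: "open (map_prod \<phi> \<psi> ` (U \<times> V))"
    using smooth_atlas_open_image[OF smooth_atlas_prod[OF A B] W] by auto
  have "smooth_on (map_prod \<phi> \<psi> ` (U \<times> V)) (\<psi> \<circ> snd \<circ> inv_into (U \<times> V) (map_prod \<phi> \<psi>))"
    by (rule smooth_on_cong[OF o smooth_on_bounded_linear[OF o bounded_linear_snd]])
      (use inv_into_map_prod[OF inj] inj in \<open>auto simp: f_inv_into_f\<close>)
  then show "\<exists>U \<phi> V \<psi> N. (U, \<phi>) \<in> prod_atlas A B \<and> (V, \<psi>) \<in> B \<and> open N \<and> p \<in> N \<and>
      N \<subseteq> UNIV \<inter> U \<and> snd ` N \<subseteq> V \<and> smooth_on (\<phi> ` N) (\<psi> \<circ> snd \<circ> inv_into U \<phi>)"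
    using U V W
    by (intro exI[of _ "U \<times> V"] exI[of _ "map_prod \<phi> \<psi>"] exI[of _ V] exI[of _ \<psi>] exI[of _ "U \<times> V"])
      (auto simp: mem_Times_iff)
qed

text \<open>By this equality a pair of smooth functions is a single smooth function into a product
  space, and sums and products on the manifold become compositions with smooth Euclidean
  maps.\<close>

lemma prod_atlas_model: "prod_atlas model_atlas model_atlas = model_atlas"
  by (auto simp: prod_atlas_def model_atlas_def map_prod.id)

section \<open>Smooth functions on manifolds\<close>

abbreviation smooth_fun_on ::
  "('a::topological_space, 'd::euclidean_space) chart set \<Rightarrow> 'a set \<Rightarrow> ('a \<Rightarrow> 'e::euclidean_space) \<Rightarrow> bool" where
  "smooth_fun_on A \<equiv> smooth_map_on A model_atlas"

lemma smooth_map_on_const: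
  assumes A: "smooth_atlas A" and B: "smooth_atlas B" and "open S"
  shows "smooth_map_on A B S (\<lambda>x. c)"
proof (rule smooth_map_onI[OF A B \<open>open S\<close>])
  fix p assume p: "p \<in> S"
  obtain U \<phi> where U: "(U, \<phi>) \<in> A" "p \<in> U" using smooth_atlas_cover[OF A] by blast
  obtain V \<psi> where V: "(V, \<psi>) \<in> B" "c \<in> V" using smooth_atlas_cover[OF B] by blast
  have o: "open (U \<inter> S)" using smooth_atlas_open[OF A U(1)] \<open>open S\<close> by auto
  have "smooth_on (\<phi> ` (U \<inter> S)) (\<psi> \<circ> (\<lambda>x. c) \<circ> inv_into U \<phi>)"
    using smooth_on_const[OF smooth_atlas_open_image[OF A U(1) o]] by (simp add: o_def)
  then show "\<exists>U \<phi> V \<psi> N. (U, \<phi>) \<in> A \<and> (V, \<psi>) \<in> B \<and> open N \<and> p \<in> N \<and>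
      N \<subseteq> S \<inter> U \<and> (\<lambda>x. c) ` N \<subseteq> V \<and> smooth_on (\<phi> ` N) (\<psi> \<circ> (\<lambda>x. c) \<circ> inv_into U \<phi>)"
    using U V o p
    by (intro exI[of _ U] exI[of _ \<phi>] exI[of _ V] exI[of _ \<psi>] exI[of _ "U \<inter> S"]) auto
qed

lemma smooth_map_on_id:
  assumes A: "smooth_atlas A" and "open S"
  shows "smooth_map_on A A S (\<lambda>x. x)"
proof (rule smooth_map_onI[OF A A \<open>open S\<close>])
  fix p assume p: "p \<in> S"
  obtain U \<phi> where U: "(U, \<phi>) \<in> A" "p \<in> U" using smooth_atlas_cover[OF A] by blast
  have o: "open (U \<inter> S)" using smooth_atlas_open[OF A U(1)] \<open>open S\<close> by auto
  have "smooth_on (\<phi> ` (U \<inter> S)) (\<phi> \<circ> (\<lambda>x. x) \<circ> inv_into U \<phi>)"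
    using smooth_on_subset[OF smooth_atlas_transition[OF A U(1) U(1)], of "\<phi> ` (U \<inter> S)"]
    by (auto simp: o_def)
  then show "\<exists>U \<phi> V \<psi> N. (U, \<phi>) \<in> A \<and> (V, \<psi>) \<in> A \<and> open N \<and> p \<in> N \<and>
      N \<subseteq> S \<inter> U \<and> (\<lambda>x. x) ` N \<subseteq> V \<and> smooth_on (\<phi> ` N) (\<psi> \<circ> (\<lambda>x. x) \<circ> inv_into U \<phi>)"
    using U o p
    by (intro exI[of _ U] exI[of _ \<phi>] exI[of _ U] exI[of _ \<phi>] exI[of _ "U \<inter> S"]) auto
qed

lemma smooth_fun_on_compose:
  assumes A: "smooth_atlas A" and "open S" "open T" "f ` S \<subseteq> T" "smooth_on T g" "smooth_fun_on A S f"
  shows "smooth_fun_on A S (\<lambda>x. g (f x))"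
  using smooth_map_on_compose[OF A smooth_atlas_model smooth_atlas_model assms(2-4) _ assms(6)]
    smooth_map_on_model_iff[OF assms(3)] assms(5) by blast

lemma smooth_fun_on_Pair:
  assumes A: "smooth_atlas A" and "open S" "smooth_fun_on A S f" "smooth_fun_on A S g"
  shows "smooth_fun_on A S (\<lambda>x. (f x, g x))"
  using smooth_map_on_Pair[OF smooth_atlas_model smooth_atlas_model assms] by (simp add: prod_atlas_model)

lemma smooth_fun_on_bilinear:
  fixes prod :: "'b::euclidean_space \<Rightarrow> 'c::euclidean_space \<Rightarrow> 'd::euclidean_space"
  assumes prod: "bounded_bilinear prod" and A: "smooth_atlas A" and S: "open S"
    and "smooth_fun_on A S f" "smooth_fun_on A S g"
  shows "smooth_fun_on A S (\<lambda>x. prod (f x) (g x))"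
proof -
  have "smooth_on UNIV (\<lambda>z. prod (fst z) (snd z))"
    by (intro smooth_on_bilinear[OF prod] smooth_on_bounded_linear bounded_linear_fst bounded_linear_snd open_UNIV)
  from smooth_fun_on_compose[OF A S open_UNIV _ this smooth_fun_on_Pair[OF A S assms(4,5)]]
  show ?thesis by simp
qed

lemmas smooth_fun_on_mult = smooth_fun_on_bilinear[OF bounded_bilinear_mult]

lemma smooth_fun_on_linear:
  assumes A: "smooth_atlas A" and S: "open S" and "bounded_linear L" "smooth_fun_on A S f"
  shows "smooth_fun_on A S (\<lambda>x. L (f x))"
  using smooth_fun_on_compose[OF A S open_UNIV _ smooth_on_bounded_linear[OF open_UNIV assms(3)] assms(4)]
  by simp

lemma smooth_fun_on_add:
  fixes f g :: "'a::{t2_space, second_countable_topology} \<Rightarrow> 'b::euclidean_space"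
  assumes A: "smooth_atlas A" and S: "open S" and "smooth_fun_on A S f" "smooth_fun_on A S g"
  shows "smooth_fun_on A S (\<lambda>x. f x + g x)"
proof -
  have "smooth_on UNIV (\<lambda>z. fst z + snd z :: 'b)"
    by (intro smooth_on_add smooth_on_bounded_linear bounded_linear_fst bounded_linear_snd open_UNIV)
  from smooth_fun_on_compose[OF A S open_UNIV _ this smooth_fun_on_Pair[OF A S assms(3,4)]]
  show ?thesis by simp
qed

lemma smooth_fun_on_sum:
  assumes A: "smooth_atlas A" and S: "open S" and "finite I" "\<And>i. i \<in> I \<Longrightarrow> smooth_fun_on A S (f i)"
  shows "smooth_fun_on A S (\<lambda>x. \<Sum>i\<in>I. f i x)"
  using assms(3,4)
proof (induction I)
  case empty
  then show ?case by (simp add: smooth_map_on_const[OF A smooth_atlas_model S])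
next
  case (insert i I)
  then show ?case by (simp add: smooth_fun_on_add[OF A S])
qed

lemma smooth_fun_on_diff:
  assumes A: "smooth_atlas A" and S: "open S" and "smooth_fun_on A S f" "smooth_fun_on A S g"
  shows "smooth_fun_on A S (\<lambda>x. f x - g x)"
  using smooth_fun_on_add[OF A S assms(3)
      smooth_fun_on_linear[OF A S bounded_linear_minus[OF bounded_linear_ident] assms(4)]] by simp

lemma smooth_fun_on_divide:
  fixes f g :: "'a::{t2_space, second_countable_topology} \<Rightarrow> real"
  assumes A: "smooth_atlas A" and S: "open S" and "smooth_fun_on A S f" "smooth_fun_on A S g"
    and "\<And>x. x \<in> S \<Longrightarrow> g x \<noteq> 0"
  shows "smooth_fun_on A S (\<lambda>x. f x / g x)"
proof -
  have "smooth_fun_on A S (\<lambda>x. inverse (g x))"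
    using assms(5) by (intro smooth_fun_on_compose[OF A S _ _ smooth_on_inverse assms(4)]) auto
  then show ?thesis using smooth_fun_on_mult[OF A S assms(3)] by (simp add: divide_inverse)
qed

lemma smooth_fun_on_chart_rep:
  assumes U: "(U, \<phi>) \<in> A" and f: "smooth_fun_on A S f" and "U \<subseteq> S"
  shows "smooth_on (\<phi> ` U) (\<lambda>x. f (inv_into U \<phi> x))"
proof -
  have "U \<inter> (S \<inter> f -` UNIV) = U" using assms(3) by auto
  then show ?thesis
    using f U unfolding smooth_map_on_def model_atlas_def by (force simp: o_def)
qed

lemma smooth_map_on_times_chart:
  assumes A: "smooth_atlas A" and U: "(U, \<phi>) \<in> A"
  shows "smooth_fun_on (prod_atlas model_atlas A) (UNIV \<times> U) (\<lambda>z. (fst z, \<phi> (snd z)))"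
proof -
  note P = smooth_atlas_prod[OF smooth_atlas_model A]
  have o: "open (UNIV \<times> U)" using smooth_atlas_open[OF A U] by (auto intro: open_Times)
  have "smooth_map_on (prod_atlas model_atlas A) A (UNIV \<times> U) snd"
    by (rule smooth_map_on_subset[OF P A open_UNIV smooth_map_on_snd[OF smooth_atlas_model A] o]) auto
  then have "smooth_fun_on (prod_atlas model_atlas A) (UNIV \<times> U) (\<lambda>z. \<phi> (snd z))"
    by (intro smooth_map_on_compose[OF P A smooth_atlas_model o smooth_atlas_open[OF A U] _
          smooth_map_on_chart[OF A U]]) auto
  moreover have "smooth_fun_on (prod_atlas model_atlas A) (UNIV \<times> U) fst"
    by (rule smooth_map_on_subset[OF P smooth_atlas_model open_UNIV smooth_map_on_fst[OF smooth_atlas_model A] o]) auto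
  ultimately show ?thesis using smooth_fun_on_Pair[OF P o] by blast
qed

lemma smooth_map_on_times_chart_inverse:
  assumes A: "smooth_atlas A" and U: "(U, \<phi>) \<in> A"
  shows "smooth_map_on model_atlas (prod_atlas model_atlas A) (UNIV \<times> \<phi> ` U)
    (\<lambda>z. (fst z, inv_into U \<phi> (snd z)))"
proof -
  have o: "open (\<phi> ` U)" "open (UNIV \<times> \<phi> ` U)"
    using smooth_atlas_open_image[OF A U smooth_atlas_open[OF A U]] by (auto intro: open_Times)
  have "smooth_map_on model_atlas A (UNIV \<times> \<phi> ` U) (\<lambda>z. inv_into U \<phi> (snd z))"
  proof (rule smooth_map_on_compose[OF smooth_atlas_model smooth_atlas_model A o(2,1) _
          smooth_map_on_chart_inverse[OF A U]])
    show "smooth_fun_on model_atlas (UNIV \<times> \<phi> ` U) snd"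
      using smooth_on_bounded_linear[OF o(2) bounded_linear_snd] smooth_map_on_model_iff[OF o(2)] by blast
  qed auto
  moreover have "smooth_fun_on model_atlas (UNIV \<times> \<phi> ` U) fst"
    using smooth_on_bounded_linear[OF o(2) bounded_linear_fst] smooth_map_on_model_iff[OF o(2)] by blast
  ultimately show ?thesis by (intro smooth_map_on_Pair[OF smooth_atlas_model A smooth_atlas_model o(2)])
qed

lemma smooth_fun_on_times_chart_rep:
  assumes A: "smooth_atlas A" and U: "(U, \<phi>) \<in> A"
    and F: "smooth_fun_on (prod_atlas model_atlas A) UNIV F"
  shows "smooth_on (UNIV \<times> \<phi> ` U) (\<lambda>z. F (fst z, inv_into U \<phi> (snd z)))"
proof -
  have o: "open (UNIV \<times> \<phi> ` U)"
    using smooth_atlas_open_image[OF A U smooth_atlas_open[OF A U]] by (auto intro: open_Times)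
  have "smooth_map_on model_atlas model_atlas (UNIV \<times> \<phi> ` U) (\<lambda>z. F (fst z, inv_into U \<phi> (snd z)))"
    by (rule smooth_map_on_compose[OF smooth_atlas_model smooth_atlas_prod[OF smooth_atlas_model A]
          smooth_atlas_model o open_UNIV _ F smooth_map_on_times_chart_inverse[OF A U]]) auto
  then show ?thesis using smooth_map_on_model_iff[OF o] by blast
qed

text \<open>The source of smoothness for Hadamard's factor along a flow and for the average, both of
  which are integrals over a time parameter.\<close>

lemma smooth_fun_integral:
  fixes F :: "real \<times> 'a::{t2_space, second_countable_topology} \<Rightarrow> real"
  assumes A: "smooth_atlas A" and F: "smooth_fun_on (prod_atlas model_atlas A) UNIV F"
  shows "smooth_fun_on A UNIV (\<lambda>q. integral {a..b} (\<lambda>t. F (t, q)))"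
proof (rule smooth_map_on_locally[OF A smooth_atlas_model open_UNIV])
  fix p
  obtain U \<phi> where U: "(U, \<phi>) \<in> A" "p \<in> U" using smooth_atlas_cover[OF A] by blast
  have o: "open (\<phi> ` U)" "open U"
    using smooth_atlas_open_image[OF A U(1)] smooth_atlas_open[OF A U(1)] by auto
  have "smooth_on (\<phi> ` U) (\<lambda>x. integral {a..b} (\<lambda>t. F (t, inv_into U \<phi> x)))"
    using smooth_on_integral[OF o(1) smooth_fun_on_times_chart_rep[OF A U(1) F]] by simp
  from smooth_fun_on_compose[OF A o(2,1) _ this smooth_map_on_chart[OF A U(1)]]
  have "smooth_fun_on A U (\<lambda>q. integral {a..b} (\<lambda>t. F (t, inv_into U \<phi> (\<phi> q))))" by auto
  then have "smooth_fun_on A U (\<lambda>q. integral {a..b} (\<lambda>t. F (t, q)))"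
    by (rule smooth_map_on_cong[OF A smooth_atlas_model o(2)]) (simp add: smooth_atlas_inv_into[OF A U(1)])
  with o U show "\<exists>T. open T \<and> p \<in> T \<and> smooth_fun_on A T (\<lambda>q. integral {a..b} (\<lambda>t. F (t, q)))" by blast
qed

text \<open>The open sets \<open>U\<close> and \<open>- K\<close> cover the manifold, and on the
  second one the function is 0. It matters that \<open>K\<close> is closed in the whole manifold and
  not just in \<open>U\<close>.\<close>

lemma smooth_fun_extend_0:
  assumes A: "smooth_atlas A" and "open U" "closed K" "K \<subseteq> U" "smooth_fun_on A U g"
    "\<And>x. x \<in> U - K \<Longrightarrow> g x = 0"
  shows "smooth_fun_on A UNIV (\<lambda>x. if x \<in> U then g x else 0)"
proof (rule smooth_map_on_locally[OF A smooth_atlas_model open_UNIV])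
  fix p
  have 1: "smooth_fun_on A U (\<lambda>x. if x \<in> U then g x else 0)"
    by (rule smooth_map_on_cong[OF A smooth_atlas_model assms(2,5)]) auto
  have 2: "smooth_fun_on A (- K) (\<lambda>x. if x \<in> U then g x else 0)"
    by (rule smooth_map_on_cong[OF A smooth_atlas_model _ smooth_map_on_const[OF A smooth_atlas_model, of _ 0]])
      (use assms in auto)
  show "\<exists>T. open T \<and> p \<in> T \<and> smooth_fun_on A T (\<lambda>x. if x \<in> U then g x else 0)"
  proof (cases "p \<in> U")
    case True
    then show ?thesis using 1 assms by blast
  next
    case False
    then show ?thesis using 2 assms by (intro exI[of _ "- K"]) auto
  qed
qed

lemma smooth_bump:
  fixes A :: "('a::{t2_space, second_countable_topology}, 'e::euclidean_space) chart set"
  assumes A: "smooth_atlas A" and "open N" "p \<in> N"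
  obtains \<beta> :: "'a \<Rightarrow> real" and K W where "smooth_fun_on A UNIV \<beta>" "\<And>x. \<beta> x \<ge> 0"
    "compact K" "K \<subseteq> N" "\<And>x. x \<notin> K \<Longrightarrow> \<beta> x = 0" "open W" "p \<in> W" "W \<subseteq> N" "\<And>x. x \<in> W \<Longrightarrow> \<beta> x = 1"
proof -
  obtain U \<phi> where U: "(U, \<phi>) \<in> A" "p \<in> U" using smooth_atlas_cover[OF A] by blast
  note inv = smooth_atlas_inv_into[OF A U(1)]
  note oU = smooth_atlas_open[OF A U(1)]
  have "open (\<phi> ` (U \<inter> N))" using smooth_atlas_open_image[OF A U(1), of "U \<inter> N"] oU assms(2) by auto
  then obtain r where r: "r > 0" "cball (\<phi> p) r \<subseteq> \<phi> ` (U \<inter> N)"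
    using U assms(3) by (metis IntI image_eqI open_contains_cball)
  have "r\<^sup>2 > 0" using r by simp
  then obtain b :: "real \<Rightarrow> real" where b: "smooth_on UNIV b" "\<And>t. b t \<ge> 0"
    "\<And>t. t \<le> r\<^sup>2 / 2 \<Longrightarrow> b t = 1" "\<And>t. t \<ge> r\<^sup>2 \<Longrightarrow> b t = 0" using smooth_step by blast
  \<comment> \<open>Squared, as the norm itself is not smooth at the centre; the thresholds of
    \<open>b\<close> are therefore \<open>r\<^sup>2\<close> and
    \<open>r\<^sup>2 / 2\<close>.\<close>
  define d where "d x = (\<phi> x - \<phi> p) \<bullet> (\<phi> x - \<phi> p)" for x
  have d: "d x = (norm (\<phi> x - \<phi> p))\<^sup>2" for x by (simp add: d_def power2_norm_eq_inner)
  define \<beta> where "\<beta> x = (if x \<in> U then b (d x) else 0)" for x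
  define K where "K = inv_into U \<phi> ` cball (\<phi> p) r"
  have "continuous_on (cball (\<phi> p) r) (inv_into U \<phi>)"
    by (rule continuous_on_subset[OF smooth_atlas_continuous_on(2)[OF A U(1)]]) (use r in auto)
  \<comment> \<open>In a Hausdorff space the compact set \<open>K\<close> is closed, as the
    extension by 0 outside the chart domain requires.\<close>
  then have K: "compact K" unfolding K_def by (intro compact_continuous_image) auto
  have "K \<subseteq> inv_into U \<phi> ` \<phi> ` (U \<inter> N)" unfolding K_def using r(2) by (rule image_mono)
  then have KN: "K \<subseteq> U \<inter> N" using inv by auto
  have outK: "b (d x) = 0" if "x \<in> U" "x \<notin> K" for x
  proof -
    have "\<phi> x \<notin> cball (\<phi> p) r" using that inv[of x] unfolding K_def by (metis image_eqI)
    then have "r \<le> norm (\<phi> x - \<phi> p)" by (simp add: dist_norm norm_minus_commute)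
    then show ?thesis using r unfolding d by (intro b(4) power_mono) auto
  qed
  have sd: "smooth_fun_on A U d"
    unfolding d_def using smooth_map_on_chart[OF A U(1)]
    by (intro smooth_fun_on_bilinear[OF bounded_bilinear_inner A oU] smooth_fun_on_diff[OF A oU]
        smooth_map_on_const[OF A smooth_atlas_model oU])
  have "smooth_fun_on A U (\<lambda>x. b (d x))"
    by (rule smooth_fun_on_compose[OF A oU open_UNIV _ b(1) sd]) auto
  then have "smooth_fun_on A UNIV \<beta>"
    unfolding \<beta>_def using oU K KN outK
    by (intro smooth_fun_extend_0[OF A oU compact_imp_closed[OF K]]) auto
  moreover have "\<beta> x \<ge> 0" for x by (simp add: \<beta>_def b)
  moreover have "\<beta> x = 0" if "x \<notin> K" for x using outK that by (simp add: \<beta>_def)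
  moreover have "open (U \<inter> d -` {..<r\<^sup>2 / 2})"
    using smooth_map_on_imp_continuous_on[OF sd] oU by (intro continuous_open_preimage) auto
  then have "open (U \<inter> d -` {..<r\<^sup>2 / 2} \<inter> N)" using assms(2) by auto
  moreover have "p \<in> U \<inter> d -` {..<r\<^sup>2 / 2} \<inter> N" using U r assms by (auto simp: d_def)
  moreover have "\<beta> x = 1" if "x \<in> U \<inter> d -` {..<r\<^sup>2 / 2} \<inter> N" for x
    using that by (auto simp: \<beta>_def intro!: b(3))
  ultimately show ?thesis
    using K KN by (intro that[of \<beta> K "U \<inter> d -` {..<r\<^sup>2 / 2} \<inter> N"]) auto
qed

section \<open>Tangent vectors in charts\<close>

text \<open>The fundamental theorem along the segment from \<open>a\<close> to \<open>x\<close>: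
  \<open>g b x\<close> is the mean over it of the partial derivative in direction \<open>b\<close>.
  Since \<open>G\<close> is smooth on the whole space, the segment never leaves its domain.\<close>

lemma smooth_on_hadamard:
  fixes G :: "'e::euclidean_space \<Rightarrow> real"
  assumes G: "smooth_on UNIV G"
  obtains g :: "'e \<Rightarrow> 'e \<Rightarrow> real" where "\<And>b. smooth_on UNIV (g b)"
    "\<And>x. G x = G a + (\<Sum>b\<in>Basis. ((x - a) \<bullet> b) * g b x)" "\<And>b. g b a = frechet_derivative G (at a) b"
proof
  let ?D = "\<lambda>y. frechet_derivative G (at y)"
  define g where "g b x = integral {0..1} (\<lambda>t. ?D (a + t *\<^sub>R (x - a)) b)" for b x
  have D: "(G has_derivative ?D y) (at y)" for y using smooth_on_has_derivative[OF G] by auto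
  have Ds: "smooth_on UNIV (\<lambda>y. ?D y b)" for b by (rule smooth_on_frechet_derivative[OF G])
  have l: "smooth_on UNIV (\<lambda>z. a + fst z *\<^sub>R (snd z + - a))"
    by (intro smooth_on_add smooth_on_const smooth_on_bilinear[OF bounded_bilinear_scaleR]
        smooth_on_bounded_linear bounded_linear_fst bounded_linear_snd open_UNIV)
  have "smooth_on UNIV (\<lambda>z. ?D (a + fst z *\<^sub>R (snd z + - a)) b)" for b
    by (rule smooth_on_compose[OF _ _ _ Ds l]) auto
  then show "smooth_on UNIV (g b)" for b
    using smooth_on_integral[OF open_UNIV, of "\<lambda>z. ?D (a + fst z *\<^sub>R (snd z + - a)) b" 0 1]
    unfolding g_def by simp
  show "g b a = ?D a b" for b by (simp add: g_def)
  fix x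
  have cont: "continuous_on {0..1} (\<lambda>t. ?D (a + t *\<^sub>R (x - a)) b)" for b
    by (rule continuous_on_compose2[OF smooth_on_imp_continuous_on[OF Ds]]) (auto intro!: continuous_intros)
  have "((\<lambda>t. G (a + t *\<^sub>R (x - a))) has_vector_derivative ?D (a + t *\<^sub>R (x - a)) (x - a)) (at t within {0..1})" for t
  proof -
    have "((\<lambda>t. a + t *\<^sub>R (x - a)) has_vector_derivative (x - a)) (at t within {0..1})"
      by (auto intro!: derivative_eq_intros)
    from vector_derivative_diff_chain_within[OF this has_derivative_at_withinI[OF D]]
    show ?thesis by (simp add: o_def)
  qed
  then have "((\<lambda>t. ?D (a + t *\<^sub>R (x - a)) (x - a)) has_integral G (a + 1 *\<^sub>R (x - a)) - G (a + 0 *\<^sub>R (x - a))) {0..1}"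
    by (intro fundamental_theorem_of_calculus) auto
  moreover have "?D y (x - a) = (\<Sum>b\<in>Basis. ((x - a) \<bullet> b) * ?D y b)" for y
  proof -
    have "?D y (x - a) = ?D y (\<Sum>b\<in>Basis. ((x - a) \<bullet> b) *\<^sub>R b)" by (simp add: euclidean_representation)
    also have "\<dots> = (\<Sum>b\<in>Basis. ((x - a) \<bullet> b) * ?D y b)"
      using has_derivative_linear[OF D[of y]] by (simp add: linear_sum linear_scale)
    finally show ?thesis .
  qed
  ultimately have 1: "((\<lambda>t. \<Sum>b\<in>Basis. ((x - a) \<bullet> b) * ?D (a + t *\<^sub>R (x - a)) b) has_integral G x - G a) {0..1}"
    by simp
  have "((\<lambda>t. \<Sum>b\<in>Basis. ((x - a) \<bullet> b) * ?D (a + t *\<^sub>R (x - a)) b) has_integral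
    (\<Sum>b\<in>Basis. ((x - a) \<bullet> b) * g b x)) {0..1}"
    unfolding g_def
    by (intro has_integral_sum has_integral_mult_right integrable_integral integrable_continuous_real cont) auto
  from has_integral_unique[OF 1 this] show "G x = G a + (\<Sum>b\<in>Basis. ((x - a) \<bullet> b) * g b x)" by simp
qed

text \<open>The differential of \<open>f\<close> in coordinates; for fixed \<open>e\<close> and
  smooth \<open>f\<close>, sending \<open>f\<close> to \<open>chart_deriv U \<phi> f p e\<close> is
  the tangent vector at \<open>p\<close> with coordinates \<open>e\<close>.\<close>

definition chart_deriv :: "'a set \<Rightarrow> ('a \<Rightarrow> 'e::euclidean_space) \<Rightarrow> ('a \<Rightarrow> real) \<Rightarrow> 'a \<Rightarrow> 'e \<Rightarrow> real" where
  "chart_deriv U \<phi> f p = frechet_derivative (\<lambda>x. f (inv_into U \<phi> x)) (at (\<phi> p))"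

context
  fixes A :: "('a::{t2_space, second_countable_topology}, 'e::euclidean_space) chart set"
  assumes A: "smooth_atlas A"
begin

lemma smooth_fun_iff: "smooth_fun A f \<longleftrightarrow> smooth_fun_on A UNIV f"
  by (rule smooth_map_eq_smooth_map_on)

lemma chart_deriv:
  assumes "(U, \<phi>) \<in> A" "p \<in> U" "smooth_fun_on A UNIV f"
  shows "((\<lambda>x. f (inv_into U \<phi> x)) has_derivative chart_deriv U \<phi> f p) (at (\<phi> p))"
  unfolding chart_deriv_def
  using smooth_on_has_derivative[OF smooth_fun_on_chart_rep[OF assms(1,3)]] assms(2) by auto

lemma chart_deriv_eq:
  assumes "(U, \<phi>) \<in> A" "p \<in> U" "smooth_fun_on A UNIV f" "open W" "p \<in> W" "W \<subseteq> U"
    "\<And>q. q \<in> W \<Longrightarrow> f q = G (\<phi> q)" "(G has_derivative G') (at (\<phi> p))"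
  shows "chart_deriv U \<phi> f p = G'"
proof -
  have "((\<lambda>x. f (inv_into U \<phi> x)) has_derivative G') (at (\<phi> p))"
  proof (rule has_derivative_transform_within_open[OF assms(8)])
    show "open (\<phi> ` W)" using smooth_atlas_open_image[OF A] assms by blast
    fix x assume "x \<in> \<phi> ` W"
    then obtain q where q: "q \<in> W" "x = \<phi> q" by auto
    then have "inv_into U \<phi> x = q" using smooth_atlas_inv_into[OF A assms(1)] assms(6) by auto
    then show "G x = f (inv_into U \<phi> x)" using q assms(7) by simp
  qed (use assms in auto)
  then show ?thesis unfolding chart_deriv_def by (rule frechet_derivative_at[symmetric])
qed

lemma tangent_add:
  "v \<in> tangent_space A p \<Longrightarrow> smooth_fun_on A UNIV f \<Longrightarrow> smooth_fun_on A UNIV g \<Longrightarrow>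
    v (\<lambda>x. f x + g x) = v f + v g"
  by (simp add: tangent_space_def smooth_fun_iff)

lemma tangent_scale:
  "v \<in> tangent_space A p \<Longrightarrow> smooth_fun_on A UNIV f \<Longrightarrow> v (\<lambda>x. c * f x) = c * v f"
  by (simp add: tangent_space_def smooth_fun_iff)

lemma tangent_mult:
  "v \<in> tangent_space A p \<Longrightarrow> smooth_fun_on A UNIV f \<Longrightarrow> smooth_fun_on A UNIV g \<Longrightarrow>
    v (\<lambda>x. f x * g x) = f p * v g + g p * v f"
  by (simp add: tangent_space_def smooth_fun_iff)

lemma tangent_not_smooth: "v \<in> tangent_space A p \<Longrightarrow> \<not> smooth_fun_on A UNIV f \<Longrightarrow> v f = 0"
  by (simp add: tangent_space_def smooth_fun_iff)

lemma tangent_const: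
  assumes "v \<in> tangent_space A p"
  shows "v (\<lambda>x. c) = 0"
proof -
  have 1: "smooth_fun_on A UNIV (\<lambda>x. 1 :: real)" by (rule smooth_map_on_const[OF A smooth_atlas_model open_UNIV])
  have "v (\<lambda>x. 1) = 0" using tangent_mult[OF assms 1 1] by simp
  then show ?thesis using tangent_scale[OF assms 1, of c] by simp
qed

lemma tangent_diff:
  assumes v: "v \<in> tangent_space A p" and f: "smooth_fun_on A UNIV f" and g: "smooth_fun_on A UNIV g"
  shows "v (\<lambda>x. f x - g x) = v f - v g"
proof -
  have "smooth_fun_on A UNIV (\<lambda>x. - 1 * g x)"
    by (rule smooth_fun_on_mult[OF A open_UNIV smooth_map_on_const[OF A smooth_atlas_model open_UNIV] g])
  then have "v (\<lambda>x. f x + - 1 * g x) = v f - v g"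
    using tangent_add[OF v f, of "\<lambda>x. - 1 * g x"] tangent_scale[OF v g, of "- 1"] by simp
  then show ?thesis by simp
qed

lemma tangent_sum:
  assumes v: "v \<in> tangent_space A p" and "finite I" "\<And>i. i \<in> I \<Longrightarrow> smooth_fun_on A UNIV (f i)"
  shows "v (\<lambda>x. \<Sum>i\<in>I. f i x) = (\<Sum>i\<in>I. v (f i))"
  using assms(2,3)
proof (induction I)
  case empty
  then show ?case by (simp add: tangent_const[OF v])
next
  case (insert i I)
  then show ?case by (simp add: tangent_add[OF v] smooth_fun_on_sum[OF A open_UNIV])
qed

text \<open>A bump function times \<open>f - g\<close> is identically 0, so \<open>v\<close> kills
  it; the Leibniz rule at \<open>p\<close>, where the bump is 1 and \<open>f - g\<close> vanishes,
  turns this into \<open>v (f - g) = 0\<close>.\<close>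

lemma tangent_cong:
  assumes v: "v \<in> tangent_space A p" and f: "smooth_fun_on A UNIV f" and g: "smooth_fun_on A UNIV g"
    and "open N" "p \<in> N" "\<And>x. x \<in> N \<Longrightarrow> f x = g x"
  shows "v f = v g"
proof -
  obtain \<beta> :: "'a \<Rightarrow> real" and K W where \<beta>: "smooth_fun_on A UNIV \<beta>" "\<And>x. \<beta> x \<ge> 0"
    "compact K" "K \<subseteq> N" "\<And>x. x \<notin> K \<Longrightarrow> \<beta> x = 0" "open W" "p \<in> W" "W \<subseteq> N" "\<And>x. x \<in> W \<Longrightarrow> \<beta> x = 1"
    using smooth_bump[OF A assms(4,5)] by blast
  have "\<beta> x * (f x - g x) = 0" for x
    using \<beta>(4) \<beta>(5)[of x] assms(6)[of x] by (cases "x \<in> K") auto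
  then have "(\<lambda>x. \<beta> x * (f x - g x)) = (\<lambda>x. 0)" by (rule ext)
  then have "v (\<lambda>x. \<beta> x * (f x - g x)) = 0" by (simp only: tangent_const[OF v])
  moreover have "v (\<lambda>x. \<beta> x * (f x - g x)) = \<beta> p * v (\<lambda>x. f x - g x) + (f p - g p) * v \<beta>"
    using tangent_mult[OF v \<beta>(1) smooth_fun_on_diff[OF A open_UNIV f g]] .
  ultimately show ?thesis using assms(5,6) \<beta>(7,9) tangent_diff[OF v f g] by simp
qed

text \<open>Hadamard's lemma writes \<open>f\<close> near \<open>p\<close> as \<open>f p\<close>
  plus a sum of products \<open>x b * h b\<close>, with coordinates \<open>x b\<close> vanishing at
  \<open>p\<close>; by the Leibniz rule \<open>v\<close> sees only \<open>v (x b)\<close> and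
  \<open>h b p\<close>. The vector \<open>c\<close> is assembled from the \<open>v (x b)\<close>
  before \<open>f\<close> is chosen.\<close>

lemma tangent_eq_chart_deriv:
  assumes v: "v \<in> tangent_space A p" and U: "(U, \<phi>) \<in> A" and p: "p \<in> U"
  obtains c where "\<And>f. smooth_fun_on A UNIV f \<Longrightarrow> v f = chart_deriv U \<phi> f p c"
proof -
  note oU = smooth_atlas_open[OF A U] and inv = smooth_atlas_inv_into[OF A U]
    and sc = smooth_map_on_chart[OF A U]
  have o\<phi>: "open (\<phi> ` U)" by (rule smooth_atlas_open_image[OF A U oU order_refl])
  obtain \<beta> :: "'a \<Rightarrow> real" and K W where \<beta>: "smooth_fun_on A UNIV \<beta>" "\<And>x. \<beta> x \<ge> 0"
    "compact K" "K \<subseteq> U" "\<And>x. x \<notin> K \<Longrightarrow> \<beta> x = 0" "open W" "p \<in> W" "W \<subseteq> U" "\<And>x. x \<in> W \<Longrightarrow> \<beta> x = 1"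
    using smooth_bump[OF A oU p] by blast
  have \<beta>U: "smooth_fun_on A U \<beta>"
    by (rule smooth_map_on_subset[OF A smooth_atlas_model open_UNIV \<beta>(1) oU]) auto
  have ext: "smooth_fun_on A UNIV (\<lambda>q. if q \<in> U then \<beta> q * g q else 0)" if "smooth_fun_on A U g" for g
    using \<beta>(4,5) by (intro smooth_fun_extend_0[OF A oU compact_imp_closed[OF \<beta>(3)]]
        smooth_fun_on_mult[OF A oU \<beta>U that]) auto
  \<comment> \<open>Coordinates centred at \<open>p\<close>, cut off because \<open>v\<close> has to
    be applied to globally smooth functions.\<close>
  define x where "x b q = (if q \<in> U then \<beta> q * ((\<phi> q - \<phi> p) \<bullet> b) else 0)" for b q
  have x: "smooth_fun_on A UNIV (x b)" for b
    unfolding x_def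
    by (intro ext smooth_fun_on_bilinear[OF bounded_bilinear_inner A oU] smooth_fun_on_diff[OF A oU] sc
        smooth_map_on_const[OF A smooth_atlas_model oU])
  have "v f = chart_deriv U \<phi> f p (\<Sum>b\<in>Basis. v (x b) *\<^sub>R b)" if f: "smooth_fun_on A UNIV f" for f
  proof -
  \<comment> \<open>The coordinate expression of \<open>f\<close> is cut off too, since Hadamard's
    lemma asks for a function on the entire model space.\<close>
  define G where "G y = (if y \<in> \<phi> ` U then \<beta> (inv_into U \<phi> y) * f (inv_into U \<phi> y) else 0)" for y
  have "smooth_fun_on model_atlas UNIV G"
    unfolding G_def
  proof (rule smooth_fun_extend_0[OF smooth_atlas_model o\<phi>])
    have "compact (\<phi> ` K)"
      by (rule compact_continuous_image[OF continuous_on_subset[OF smooth_atlas_continuous_on(1)[OF A U] \<beta>(4)] \<beta>(3)])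
    then show "closed (\<phi> ` K)" by (rule compact_imp_closed)
    show "\<phi> ` K \<subseteq> \<phi> ` U" using \<beta>(4) by auto
    have "smooth_on (\<phi> ` U) (\<lambda>y. \<beta> (inv_into U \<phi> y) * f (inv_into U \<phi> y))"
      by (intro smooth_on_mult o\<phi> smooth_fun_on_chart_rep[OF U \<beta>(1)] smooth_fun_on_chart_rep[OF U f]) auto
    then show "smooth_fun_on model_atlas (\<phi> ` U) (\<lambda>y. \<beta> (inv_into U \<phi> y) * f (inv_into U \<phi> y))"
      using smooth_map_on_model_iff[OF o\<phi>] by blast
    fix y assume "y \<in> \<phi> ` U - \<phi> ` K"
    then obtain q where "q \<in> U" "q \<notin> K" "y = \<phi> q" by auto
    then show "\<beta> (inv_into U \<phi> y) * f (inv_into U \<phi> y) = 0" using inv \<beta>(5) by simp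
  qed
  then have G: "smooth_on UNIV G" using smooth_map_on_model_iff[OF open_UNIV] by blast
  have GO: "f q = G (\<phi> q)" if "q \<in> W" for q
  proof -
    have "q \<in> U" using that \<beta>(8) by auto
    then show ?thesis using inv \<beta>(9)[OF that] by (simp add: G_def)
  qed
  obtain g where g: "\<And>b. smooth_on UNIV (g b)"
    "\<And>y. G y = G (\<phi> p) + (\<Sum>b\<in>Basis. ((y - \<phi> p) \<bullet> b) * g b y)" "\<And>b. g b (\<phi> p) = frechet_derivative G (at (\<phi> p)) b"
    using smooth_on_hadamard[OF G, of "\<phi> p"] by blast
  define h where "h b q = (if q \<in> U then \<beta> q * g b (\<phi> q) else 0)" for b q
  have h: "smooth_fun_on A UNIV (h b)" for b
    unfolding h_def by (intro ext smooth_fun_on_compose[OF A oU open_UNIV _ g(1) sc]) auto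
  have "smooth_fun_on A UNIV (\<lambda>q. \<Sum>b\<in>Basis. x b q * h b q)"
    by (intro smooth_fun_on_sum[OF A open_UNIV] smooth_fun_on_mult[OF A open_UNIV x h]) auto
  then have s: "smooth_fun_on A UNIV (\<lambda>q. f p + (\<Sum>b\<in>Basis. x b q * h b q))"
    by (intro smooth_fun_on_add[OF A open_UNIV] smooth_map_on_const[OF A smooth_atlas_model]) auto
  have "v f = v (\<lambda>q. f p + (\<Sum>b\<in>Basis. x b q * h b q))"
  proof (rule tangent_cong[OF v f s \<beta>(6,7)])
    fix q assume q: "q \<in> W"
    then have "q \<in> U" "\<beta> q = 1" using \<beta>(8,9) by auto
    then show "f q = f p + (\<Sum>b\<in>Basis. x b q * h b q)"
      using GO[OF q] GO[OF \<beta>(7)] g(2)[of "\<phi> q"] by (simp add: x_def h_def)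
  qed
  also have "\<dots> = (\<Sum>b\<in>Basis. v (\<lambda>q. x b q * h b q))"
    using smooth_fun_on_mult[OF A open_UNIV x h]
    by (subst tangent_add[OF v smooth_map_on_const[OF A smooth_atlas_model open_UNIV]])
      (auto simp: tangent_const[OF v] tangent_sum[OF v] intro!: smooth_fun_on_sum[OF A open_UNIV])
  also have "\<dots> = (\<Sum>b\<in>Basis. h b p * v (x b))"
    by (intro sum.cong) (simp_all add: tangent_mult[OF v x h], simp add: x_def)
  also have "\<dots> = (\<Sum>b\<in>Basis. v (x b) * frechet_derivative G (at (\<phi> p)) b)"
    using p \<beta>(9)[OF \<beta>(7)] by (simp add: h_def g(3) mult.commute)
  also have "\<dots> = frechet_derivative G (at (\<phi> p)) (\<Sum>b\<in>Basis. v (x b) *\<^sub>R b)"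
    using has_derivative_linear[OF smooth_on_has_derivative[OF G UNIV_I, of "\<phi> p"]]
    by (simp add: linear_sum linear_scale)
  also have "frechet_derivative G (at (\<phi> p)) = chart_deriv U \<phi> f p"
    using chart_deriv_eq[OF U p f \<beta>(6,7,8) GO smooth_on_has_derivative[OF G UNIV_I]] by simp
  finally show ?thesis .
  qed
  then show ?thesis by (rule that)
qed

section \<open>Smooth vector fields in coordinates\<close>

lemma smooth_vector_field_tangent: "smooth_vector_field A Z \<Longrightarrow> Z p \<in> tangent_space A p"
  by (simp add: smooth_vector_field_def)

lemma smooth_vector_field_smooth:
  "smooth_vector_field A Z \<Longrightarrow> smooth_fun_on A UNIV f \<Longrightarrow> smooth_fun_on A UNIV (\<lambda>p. Z p f)"
  by (simp add: smooth_vector_field_def smooth_fun_iff)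

text \<open>The components of \<open>Z\<close> are its values on cut-off coordinate functions, hence
  smooth. They are defined everywhere but describe \<open>Z\<close> only near
  \<open>p\<close>.\<close>

lemma smooth_vector_field_chart:
  assumes Z: "smooth_vector_field A Z" and U: "(U, \<phi>) \<in> A" and p: "p \<in> U"
  obtains N \<zeta> where "open N" "p \<in> N" "N \<subseteq> U" "smooth_fun_on A UNIV \<zeta>"
    "\<And>q f. q \<in> N \<Longrightarrow> smooth_fun_on A UNIV f \<Longrightarrow> Z q f = chart_deriv U \<phi> f q (\<zeta> q)"
proof -
  note oU = smooth_atlas_open[OF A U] and sc = smooth_map_on_chart[OF A U]
  obtain \<beta> :: "'a \<Rightarrow> real" and K W where \<beta>: "smooth_fun_on A UNIV \<beta>" "\<And>x. \<beta> x \<ge> 0"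
    "compact K" "K \<subseteq> U" "\<And>x. x \<notin> K \<Longrightarrow> \<beta> x = 0" "open W" "p \<in> W" "W \<subseteq> U" "\<And>x. x \<in> W \<Longrightarrow> \<beta> x = 1"
    using smooth_bump[OF A oU p] by blast
  have \<beta>U: "smooth_fun_on A U \<beta>"
    by (rule smooth_map_on_subset[OF A smooth_atlas_model open_UNIV \<beta>(1) oU]) auto
  \<comment> \<open>Not centred, unlike the coordinates used for a single tangent vector: the same
    functions must serve at every \<open>q\<close> in \<open>W\<close>.\<close>
  define y where "y b q = (if q \<in> U then \<beta> q * (\<phi> q \<bullet> b) else 0)" for b q
  have y: "smooth_fun_on A UNIV (y b)" for b
    unfolding y_def using \<beta>(4,5)
    by (intro smooth_fun_extend_0[OF A oU compact_imp_closed[OF \<beta>(3)]] smooth_fun_on_mult[OF A oU \<beta>U]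
        smooth_fun_on_linear[OF A oU bounded_linear_inner_left sc]) auto
  define \<zeta> where "\<zeta> q = (\<Sum>b\<in>Basis. Z q (y b) *\<^sub>R b)" for q
  have "smooth_fun_on A UNIV \<zeta>"
    unfolding \<zeta>_def
    by (intro smooth_fun_on_sum[OF A open_UNIV] smooth_fun_on_bilinear[OF bounded_bilinear_scaleR A open_UNIV]
        smooth_map_on_const[OF A smooth_atlas_model open_UNIV] smooth_vector_field_smooth[OF Z] y) auto
  moreover have "Z q f = chart_deriv U \<phi> f q (\<zeta> q)" if q: "q \<in> W" and f: "smooth_fun_on A UNIV f" for q f
  proof -
    have qU: "q \<in> U" using q \<beta>(8) by auto
    obtain c where c: "\<And>f. smooth_fun_on A UNIV f \<Longrightarrow> Z q f = chart_deriv U \<phi> f q c"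
      using tangent_eq_chart_deriv[OF smooth_vector_field_tangent[OF Z] U qU] by blast
    have "Z q (y b) = c \<bullet> b" for b
    proof -
      have "chart_deriv U \<phi> (y b) q = (\<lambda>x. x \<bullet> b)"
      proof (rule chart_deriv_eq[OF U qU y \<beta>(6) q \<beta>(8)])
        show "y b q = \<phi> q \<bullet> b" if "q \<in> W" for q
          using that \<beta>(8) \<beta>(9)[OF that] by (auto simp: y_def)
        show "((\<lambda>x. x \<bullet> b) has_derivative (\<lambda>x. x \<bullet> b)) (at (\<phi> q))"
          by (rule bounded_linear_imp_has_derivative[OF bounded_linear_inner_left])
      qed
      then show ?thesis using c[OF y] by simp
    qed
    then have "\<zeta> q = c" by (simp add: \<zeta>_def euclidean_representation)
    then show ?thesis using c[OF f] by simp
  qed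
  ultimately show ?thesis using \<beta>(6-8) that by blast
qed

lemma smooth_fun_slice:
  assumes G: "smooth_fun_on (prod_atlas model_atlas A) UNIV G"
  shows "smooth_fun_on A UNIV (\<lambda>x. G (s, x))"
proof -
  have "smooth_map_on A (prod_atlas model_atlas A) UNIV (\<lambda>x. (s, x))"
    by (intro smooth_map_on_Pair[OF smooth_atlas_model A A] smooth_map_on_const[OF A smooth_atlas_model]
        smooth_map_on_id[OF A] open_UNIV)
  then show ?thesis
    by (intro smooth_map_on_compose[OF A smooth_atlas_prod[OF smooth_atlas_model A] smooth_atlas_model
          open_UNIV open_UNIV _ G]) auto
qed

text \<open>The definition gives smoothness of \<open>Z\<close> applied to a fixed function; for a
  family depending on a parameter, joint smoothness comes from the coordinate form, in which
  \<open>Z\<close> is a combination with smooth coefficients of the partial derivatives of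
  \<open>K\<close> in the directions \<open>(0, b)\<close>.\<close>

lemma smooth_vector_field_param:
  fixes G :: "real \<times> 'a \<Rightarrow> real"
  assumes Z: "smooth_vector_field A Z" and G: "smooth_fun_on (prod_atlas model_atlas A) UNIV G"
  shows "smooth_fun_on (prod_atlas model_atlas A) UNIV (\<lambda>z. Z (snd z) (\<lambda>x. G (fst z, x)))"
proof (rule smooth_map_on_locally[OF smooth_atlas_prod[OF smooth_atlas_model A] smooth_atlas_model open_UNIV])
  note P = smooth_atlas_prod[OF smooth_atlas_model A]
  fix z0 :: "real \<times> 'a"
  obtain U \<phi> where U: "(U, \<phi>) \<in> A" "snd z0 \<in> U" using smooth_atlas_cover[OF A] by blast
  note oU = smooth_atlas_open[OF A U(1)] and inv = smooth_atlas_inv_into[OF A U(1)]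
  obtain N \<zeta> where N: "open N" "snd z0 \<in> N" "N \<subseteq> U" "smooth_fun_on A UNIV \<zeta>"
    "\<And>q f. q \<in> N \<Longrightarrow> smooth_fun_on A UNIV f \<Longrightarrow> Z q f = chart_deriv U \<phi> f q (\<zeta> q)"
    using smooth_vector_field_chart[OF Z U] by blast
  define K where "K z = G (fst z, inv_into U \<phi> (snd z))" for z
  have K: "smooth_on (UNIV \<times> \<phi> ` U) K"
    unfolding K_def by (rule smooth_fun_on_times_chart_rep[OF A U(1) G])
  have oN: "open (UNIV \<times> N :: (real \<times> 'a) set)" and oUU: "open (UNIV \<times> \<phi> ` U :: (real \<times> 'e) set)"
    using N(1) smooth_atlas_open_image[OF A U(1) oU] by (auto intro: open_Times)
  have oUN: "open (UNIV \<times> U :: (real \<times> 'a) set)" using oU by (auto intro: open_Times)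
  let ?D = "\<lambda>z. frechet_derivative K (at (fst z, \<phi> (snd z)))"
  have D: "smooth_fun_on (prod_atlas model_atlas A) (UNIV \<times> N) (\<lambda>z. ?D z (0, b))" for b
  proof (rule smooth_fun_on_compose[OF P oN oUU _ smooth_on_frechet_derivative[OF K]])
    show "smooth_fun_on (prod_atlas model_atlas A) (UNIV \<times> N) (\<lambda>z :: real \<times> 'a. (fst z, \<phi> (snd z)))"
    proof (rule smooth_map_on_subset[OF P smooth_atlas_model])
      show "open (UNIV \<times> U :: (real \<times> 'a) set)" by (rule oUN)
      show "smooth_fun_on (prod_atlas model_atlas A) (UNIV \<times> U) (\<lambda>z :: real \<times> 'a. (fst z, \<phi> (snd z)))"
        by (rule smooth_map_on_times_chart[OF A U(1)])
      show "open (UNIV \<times> N :: (real \<times> 'a) set)" by (rule oN)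
    qed (use N(3) in auto)
  qed (use N(3) in auto)
  have "smooth_fun_on (prod_atlas model_atlas A) UNIV (\<lambda>z :: real \<times> 'a. \<zeta> (snd z))"
    by (rule smooth_map_on_compose[OF P A smooth_atlas_model open_UNIV open_UNIV _ N(4)
          smooth_map_on_snd[OF smooth_atlas_model A]]) auto
  then have \<zeta>: "smooth_fun_on (prod_atlas model_atlas A) (UNIV \<times> N) (\<lambda>z :: real \<times> 'a. \<zeta> (snd z))"
    by (rule smooth_map_on_subset[OF P smooth_atlas_model open_UNIV _ oN]) auto
  have "smooth_fun_on (prod_atlas model_atlas A) (UNIV \<times> N) (\<lambda>z :: real \<times> 'a. \<Sum>b\<in>Basis. (\<zeta> (snd z) \<bullet> b) * ?D z (0, b))"
    by (intro smooth_fun_on_sum[OF P oN] smooth_fun_on_mult[OF P oN] D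
        smooth_fun_on_linear[OF P oN bounded_linear_inner_left \<zeta>]) auto
  then have "smooth_fun_on (prod_atlas model_atlas A) (UNIV \<times> N) (\<lambda>z :: real \<times> 'a. Z (snd z) (\<lambda>x. G (fst z, x)))"
  proof (rule smooth_map_on_cong[OF P smooth_atlas_model oN])
    fix z :: "real \<times> 'a" assume "z \<in> UNIV \<times> N"
    then have z: "snd z \<in> N" "snd z \<in> U" using N(3) by auto
    have DK: "(K has_derivative ?D z) (at (fst z, \<phi> (snd z)))"
      by (rule smooth_on_has_derivative[OF K]) (use z in auto)
    have "((\<lambda>x. (fst z, x)) has_derivative (\<lambda>v. (0, v))) (at (\<phi> (snd z)))"
      by (auto intro!: derivative_eq_intros)
    from diff_chain_at[OF this DK]
    have "((\<lambda>x. K (fst z, x)) has_derivative (\<lambda>v. ?D z (0, v))) (at (\<phi> (snd z)))" by (simp add: o_def)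
    then have cd: "chart_deriv U \<phi> (\<lambda>x. G (fst z, x)) (snd z) = (\<lambda>v. ?D z (0, v))"
      by (intro chart_deriv_eq[OF U(1) z(2) smooth_fun_slice[OF G] oU z(2) order_refl]) (auto simp: K_def inv)
    have "(\<Sum>b\<in>Basis. (\<zeta> (snd z) \<bullet> b) * ?D z (0, b)) = (\<Sum>b\<in>Basis. ?D z ((\<zeta> (snd z) \<bullet> b) *\<^sub>R (0, b)))"
      using has_derivative_linear[OF DK] by (simp only: linear_scale real_scaleR_def)
    also have "\<dots> = ?D z (\<Sum>b\<in>Basis. (\<zeta> (snd z) \<bullet> b) *\<^sub>R (0, b))"
      using has_derivative_linear[OF DK] by (simp only: linear_sum)
    also have "(\<Sum>b\<in>Basis. (\<zeta> (snd z) \<bullet> b) *\<^sub>R (0 :: real, b)) = (0, \<zeta> (snd z))"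
      by (simp add: prod_eq_iff fst_sum snd_sum euclidean_representation)
    finally show "(\<Sum>b\<in>Basis. (\<zeta> (snd z) \<bullet> b) * ?D z (0, b)) = Z (snd z) (\<lambda>x. G (fst z, x))"
      using N(5)[OF z(1) smooth_fun_slice[OF G]] cd by simp
  qed
  with oN N(2) show "\<exists>T. open T \<and> z0 \<in> T \<and>
      smooth_fun_on (prod_atlas model_atlas A) T (\<lambda>z. Z (snd z) (\<lambda>x. G (fst z, x)))"
    by (intro exI[of _ "UNIV \<times> N"]) (auto simp: mem_Times_iff)
qed

end

section \<open>Vector fields transversal to a function\<close>

lemma chart_deriv_unique:
  assumes "((\<lambda>x. f (inv_into U \<phi> x)) has_derivative D) (at (\<phi> p))"
  shows "chart_deriv U \<phi> f p = D"
  unfolding chart_deriv_def using frechet_derivative_at[OF assms] by simp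

text \<open>The \<open>n\<close>-th weight vanishes wherever an earlier \<open>F i\<close> exceeds \<open>1 / (n + 1)\<close>; this makes the
  family of weights locally finite without any appeal to paracompactness.\<close>

definition weight :: "(nat \<Rightarrow> 'a \<Rightarrow> real) \<Rightarrow> nat \<Rightarrow> 'a \<Rightarrow> real" where
  "weight F n x = (\<Prod>i<n. flat 0 (1 / real (Suc n) - F i x))"

lemma weight_nonneg: "weight F n x \<ge> 0"
  unfolding weight_def by (intro prod_nonneg) (auto simp: flat_nonneg)

text \<open>The companion of Hadamard's lemma: to differentiate \<open>s * M (s, q)\<close> at 0 it
  is enough that the factor be continuous, even when \<open>q\<close> or a derivation applied to
  \<open>M\<close> moves along with \<open>s\<close>.\<close>

lemma DERIV_times_id_at_0:
  assumes "isCont m 0"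
  shows "((\<lambda>r::real. r * m r) has_real_derivative m 0) (at 0)"
proof -
  have "(\<lambda>r. (r * m r - 0 * m 0) / (r - 0)) \<midarrow>0\<rightarrow> m 0"
    by (rule Lim_transform_eventually[OF assms[unfolded isCont_def]]) (auto simp: eventually_at_filter)
  then show ?thesis by (simp add: has_field_derivative_iff)
qed

context
  fixes A :: "('a::{t2_space, second_countable_topology}, 'e::euclidean_space) chart set"
  assumes A: "smooth_atlas A"
begin

section \<open>Linear algebra of derivations and vector fields\<close>

lemma smooth_fun_const: "smooth_fun_on A UNIV (\<lambda>x. c)"
  by (rule smooth_map_on_const[OF A smooth_atlas_model open_UNIV])

lemma chart_deriv_add:
  assumes "(U, \<phi>) \<in> A" "p \<in> U" "smooth_fun_on A UNIV f" "smooth_fun_on A UNIV g"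
  shows "chart_deriv U \<phi> (\<lambda>x. f x + g x) p e = chart_deriv U \<phi> f p e + chart_deriv U \<phi> g p e"
  using chart_deriv_unique[OF has_derivative_add[OF chart_deriv[OF A assms(1-3)] chart_deriv[OF A assms(1,2,4)]]]
  by simp

lemma chart_deriv_scale:
  assumes "(U, \<phi>) \<in> A" "p \<in> U" "smooth_fun_on A UNIV f"
  shows "chart_deriv U \<phi> (\<lambda>x. c * f x) p e = c * chart_deriv U \<phi> f p e"
  using chart_deriv_unique[OF has_derivative_mult_right[OF chart_deriv[OF A assms]]] by simp

lemma chart_deriv_mult:
  assumes "(U, \<phi>) \<in> A" "p \<in> U" "smooth_fun_on A UNIV f" "smooth_fun_on A UNIV g"
  shows "chart_deriv U \<phi> (\<lambda>x. f x * g x) p e = f p * chart_deriv U \<phi> g p e + g p * chart_deriv U \<phi> f p e"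
  using chart_deriv_unique[OF has_derivative_mult[OF chart_deriv[OF A assms(1-3)] chart_deriv[OF A assms(1,2,4)]]]
    smooth_atlas_inv_into[OF A assms(1,2)] by (simp add: algebra_simps)

lemma tangent_spaceI:
  assumes "\<And>f g. smooth_fun_on A UNIV f \<Longrightarrow> smooth_fun_on A UNIV g \<Longrightarrow> v (\<lambda>x. f x + g x) = v f + v g"
    "\<And>c f. smooth_fun_on A UNIV f \<Longrightarrow> v (\<lambda>x. c * f x) = c * v f"
    "\<And>f g. smooth_fun_on A UNIV f \<Longrightarrow> smooth_fun_on A UNIV g \<Longrightarrow> v (\<lambda>x. f x * g x) = f p * v g + g p * v f"
    "\<And>f. \<not> smooth_fun_on A UNIV f \<Longrightarrow> v f = 0"
  shows "v \<in> tangent_space A p"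
  using assms unfolding tangent_space_def smooth_fun_iff[OF A] by blast

lemma smooth_vector_fieldI:
  assumes "\<And>p. Z p \<in> tangent_space A p"
    "\<And>f. smooth_fun_on A UNIV f \<Longrightarrow> smooth_fun_on A UNIV (\<lambda>p. Z p f)"
  shows "smooth_vector_field A Z"
  using assms unfolding smooth_vector_field_def smooth_fun_iff[OF A] by blast

lemma tangent_space_lincomb:
  assumes "finite I" "\<And>i. i \<in> I \<Longrightarrow> v i \<in> tangent_space A p"
  shows "(\<lambda>f. \<Sum>i\<in>I. c i * v i f) \<in> tangent_space A p"
proof (rule tangent_spaceI)
  show "(\<Sum>i\<in>I. c i * v i (\<lambda>x. f x + g x)) = (\<Sum>i\<in>I. c i * v i f) + (\<Sum>i\<in>I. c i * v i g)"
    if "smooth_fun_on A UNIV f" "smooth_fun_on A UNIV g" for f g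
    using that by (simp add: tangent_add[OF A assms(2)] distrib_left sum.distrib)
  show "(\<Sum>i\<in>I. c i * v i (\<lambda>x. k * f x)) = k * (\<Sum>i\<in>I. c i * v i f)"
    if "smooth_fun_on A UNIV f" for k f
    using that by (simp add: tangent_scale[OF A assms(2)] sum_distrib_left mult.left_commute)
  show "(\<Sum>i\<in>I. c i * v i (\<lambda>x. f x * g x)) = f p * (\<Sum>i\<in>I. c i * v i g) + g p * (\<Sum>i\<in>I. c i * v i f)"
    if "smooth_fun_on A UNIV f" "smooth_fun_on A UNIV g" for f g
    using that by (simp add: tangent_mult[OF A assms(2)] distrib_left sum.distrib sum_distrib_left mult.left_commute)
  show "(\<Sum>i\<in>I. c i * v i f) = 0" if "\<not> smooth_fun_on A UNIV f" for f
    using that by (simp add: tangent_not_smooth[OF A assms(2)])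
qed

lemma tangent_space_scale:
  assumes "v \<in> tangent_space A p"
  shows "(\<lambda>f. c * v f) \<in> tangent_space A p"
  using tangent_space_lincomb[of "{()}" "\<lambda>_. v" p "\<lambda>_. c"] assms by simp

lemma smooth_vector_field_scale:
  assumes "smooth_vector_field A Z" "smooth_fun_on A UNIV c"
  shows "smooth_vector_field A (scale_vf c Z)"
  unfolding scale_vf_def
  by (intro smooth_vector_fieldI tangent_space_scale smooth_vector_field_tangent[OF A assms(1)]
      smooth_fun_on_mult[OF A open_UNIV assms(2)] smooth_vector_field_smooth[OF A assms(1)])

lemma smooth_vector_field_0: "smooth_vector_field A (\<lambda>p f. 0)"
  by (intro smooth_vector_fieldI tangent_spaceI smooth_fun_const) auto

text \<open>The field with constant coordinates \<open>e\<close> in the chart, cut off by a bump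
  function.\<close>

lemma smooth_vector_field_extending:
  assumes U: "(U, \<phi>) \<in> A" and p: "p \<in> U"
  obtains V where "smooth_vector_field A V" "\<And>f. smooth_fun_on A UNIV f \<Longrightarrow> V p f = chart_deriv U \<phi> f p e"
proof -
  note oU = smooth_atlas_open[OF A U]
  have o\<phi>: "open (\<phi> ` U)" by (rule smooth_atlas_open_image[OF A U oU order_refl])
  obtain \<beta> :: "'a \<Rightarrow> real" and K W where \<beta>: "smooth_fun_on A UNIV \<beta>" "\<And>x. \<beta> x \<ge> 0"
    "compact K" "K \<subseteq> U" "\<And>x. x \<notin> K \<Longrightarrow> \<beta> x = 0" "open W" "p \<in> W" "W \<subseteq> U" "\<And>x. x \<in> W \<Longrightarrow> \<beta> x = 1"
    using smooth_bump[OF A oU p] by blast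
  have \<beta>U: "smooth_fun_on A U \<beta>"
    by (rule smooth_map_on_subset[OF A smooth_atlas_model open_UNIV \<beta>(1) oU]) auto
  \<comment> \<open>The outer case distinction supplies the value 0 on non-smooth functions that
    normalises tangent vectors.\<close>
  define V where "V q f = (if smooth_fun_on A UNIV f then
      if q \<in> U then \<beta> q * chart_deriv U \<phi> f q e else 0 else 0)" for q f
  have "smooth_vector_field A V"
  proof (rule smooth_vector_fieldI)
    show "V q \<in> tangent_space A q" for q
    proof (rule tangent_spaceI)
      show "V q (\<lambda>x. f x + g x) = V q f + V q g" if "smooth_fun_on A UNIV f" "smooth_fun_on A UNIV g" for f g
        using that smooth_fun_on_add[OF A open_UNIV that]
        by (simp add: V_def chart_deriv_add[OF U] distrib_left)
      show "V q (\<lambda>x. c * f x) = c * V q f" if "smooth_fun_on A UNIV f" for c f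
        using that smooth_fun_on_mult[OF A open_UNIV smooth_fun_const that]
        by (simp add: V_def chart_deriv_scale[OF U] mult.left_commute)
      show "V q (\<lambda>x. f x * g x) = f q * V q g + g q * V q f"
        if "smooth_fun_on A UNIV f" "smooth_fun_on A UNIV g" for f g
        using that smooth_fun_on_mult[OF A open_UNIV that]
        by (simp add: V_def chart_deriv_mult[OF U] distrib_left mult.left_commute)
      show "V q f = 0" if "\<not> smooth_fun_on A UNIV f" for f using that by (simp add: V_def)
    qed
    fix f :: "'a \<Rightarrow> real" assume f: "smooth_fun_on A UNIV f"
    have "smooth_fun_on A U (\<lambda>q. chart_deriv U \<phi> f q e)"
      unfolding chart_deriv_def
      by (rule smooth_fun_on_compose[OF A oU o\<phi> order_refl
            smooth_on_frechet_derivative[OF smooth_fun_on_chart_rep[OF U f subset_UNIV]] smooth_map_on_chart[OF A U]])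
    then have "smooth_fun_on A UNIV (\<lambda>q. if q \<in> U then \<beta> q * chart_deriv U \<phi> f q e else 0)"
      using \<beta>(4,5) by (intro smooth_fun_extend_0[OF A oU compact_imp_closed[OF \<beta>(3)]]
          smooth_fun_on_mult[OF A oU \<beta>U]) auto
    then show "smooth_fun_on A UNIV (\<lambda>q. V q f)" using f by (simp add: V_def)
  qed
  moreover have "V p f = chart_deriv U \<phi> f p e" if "smooth_fun_on A UNIV f" for f
    using that p \<beta>(9)[OF \<beta>(7)] by (simp add: V_def)
  ultimately show ?thesis by (rule that)
qed

text \<open>The local data for the gluing. The functions \<open>f\<close> must be nonnegative and
  positive at prescribed points, also off \<open>S\<close>, so that the normalising sum of the
  gluing is positive on the whole manifold.\<close>

lemma locally_transversal:
  assumes h: "smooth_fun_on A UNIV h" and reg: "regular_fun_on A S h" and S: "closed S"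
  obtains f V where "smooth_fun_on A UNIV f" "\<And>q. f q \<ge> 0" "f p > 0" "smooth_vector_field A V"
    "\<And>q. q \<in> S \<Longrightarrow> V q h = (f q :: real)"
proof (cases "p \<in> S")
  case True
  obtain U \<phi> where U: "(U, \<phi>) \<in> A" "p \<in> U" using smooth_atlas_cover[OF A] by blast
  have "differential A h p \<noteq> (\<lambda>v. 0)" using reg True by (simp add: regular_fun_on_def)
  then obtain v where v: "v \<in> tangent_space A p" "v h \<noteq> 0"
    unfolding differential_def by (auto simp: fun_eq_iff split: if_splits)
  obtain c where c: "\<And>f. smooth_fun_on A UNIV f \<Longrightarrow> v f = chart_deriv U \<phi> f p c"
    using tangent_eq_chart_deriv[OF A v(1) U] by blast
  obtain V where V: "smooth_vector_field A V" "\<And>f. smooth_fun_on A UNIV f \<Longrightarrow> V p f = chart_deriv U \<phi> f p c"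
    using smooth_vector_field_extending[OF U] by blast
  have u: "smooth_fun_on A UNIV (\<lambda>q. V q h)" by (rule smooth_vector_field_smooth[OF A V(1) h])
  \<comment> \<open>With \<open>u = V h\<close>, the field \<open>u V\<close> sends \<open>h\<close>
    to the square of \<open>u\<close>, which is nonnegative everywhere and positive at
    \<open>p\<close>; the sign of \<open>V h\<close> need not be controlled.\<close>
  show ?thesis
  proof (rule that[of "\<lambda>q. V q h * V q h" "scale_vf (\<lambda>q. V q h) V"])
    show "smooth_fun_on A UNIV (\<lambda>q. V q h * V q h)" by (rule smooth_fun_on_mult[OF A open_UNIV u u])
    show "smooth_vector_field A (scale_vf (\<lambda>q. V q h) V)" by (rule smooth_vector_field_scale[OF V(1) u])
    have "V p h \<noteq> 0" using V(2)[OF h] c[OF h] v(2) by simp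
    then show "V p h * V p h > 0" by (simp add: zero_less_mult_iff) linarith
  qed (auto simp: scale_vf_def)
next
  case False
  obtain \<beta> :: "'a \<Rightarrow> real" and K W where \<beta>: "smooth_fun_on A UNIV \<beta>" "\<And>x. \<beta> x \<ge> 0"
    "compact K" "K \<subseteq> - S" "\<And>x. x \<notin> K \<Longrightarrow> \<beta> x = 0" "open W" "p \<in> W" "W \<subseteq> - S" "\<And>x. x \<in> W \<Longrightarrow> \<beta> x = 1"
    using smooth_bump[OF A, of "- S" p] S False by (metis ComplI open_Compl)
  \<comment> \<open>A bump function supported off \<open>S\<close> vanishes on \<open>S\<close>, so
    there the zero field meets the equation.\<close>
  show ?thesis
  proof (rule that[OF \<beta>(1,2) _ smooth_vector_field_0])
    show "\<beta> p > 0" using \<beta>(7,9) by simp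
    show "0 = \<beta> q" if "q \<in> S" for q using \<beta>(4,5) that by force
  qed
qed

section \<open>Gluing by locally finite weights\<close>

lemma smooth_weight:
  assumes "\<And>i. smooth_fun_on A UNIV (F i)"
  shows "smooth_fun_on A UNIV (weight F n)"
proof -
  have 1: "smooth_fun_on A UNIV (\<lambda>x. flat 0 (1 / real (Suc n) - F i x))" for i
    by (rule smooth_fun_on_compose[OF A open_UNIV open_UNIV subset_UNIV smooth_on_flat
          smooth_fun_on_diff[OF A open_UNIV smooth_fun_const assms]])
  have "smooth_fun_on A UNIV (\<lambda>x. \<Prod>i<m. flat 0 (1 / real (Suc n) - F i x))" for m
  proof (induction m)
    case (Suc m)
    show ?case unfolding prod.lessThan_Suc by (rule smooth_fun_on_mult[OF A open_UNIV Suc 1])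
  qed (simp add: smooth_fun_const)
  then show ?thesis unfolding weight_def[abs_def] .
qed

lemma weight_locally_finite:
  assumes F: "\<And>i. smooth_fun_on A UNIV (F i)" and pos: "F i p > 0"
  obtains N m where "open N" "p \<in> N" "\<And>n x. n \<ge> m \<Longrightarrow> x \<in> N \<Longrightarrow> weight F n x = 0"
proof -
  obtain k where k: "1 / real (Suc k) < F i p" using reals_Archimedean[OF pos] by (auto simp: inverse_eq_divide)
  define N where "N = F i -` {1 / real (Suc k)<..}"
  \<comment> \<open>The bound \<open>Suc i\<close> makes the \<open>i\<close>-th factor occur in the
    product, and the bound \<open>k\<close> makes it vanish on \<open>N\<close>.\<close>
  have "weight F n x = 0" if "n \<ge> max k (Suc i)" "x \<in> N" for n x
  proof -
    have "1 / real (Suc n) \<le> 1 / real (Suc k)" using that(1) by (intro divide_left_mono) auto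
    then have "flat 0 (1 / real (Suc n) - F i x) = 0" using that(2) by (intro flat_eq_0) (auto simp: N_def)
    then show ?thesis using that(1) unfolding weight_def by (intro prod_zero) (auto intro!: bexI[of _ i])
  qed
  moreover have "open N"
    unfolding N_def using smooth_map_on_imp_continuous_on[OF F] by (intro open_vimage) auto
  moreover have "p \<in> N" using k by (simp add: N_def)
  ultimately show ?thesis using that by blast
qed

text \<open>The glued field is the weighted sum of the local fields divided by \<open>D\<close>, the
  equally weighted sum of the functions \<open>F n\<close>. On \<open>S\<close> each local field
  sends \<open>h\<close> to its \<open>F n\<close>, so the quotient is 1.\<close>

lemma transversal_vector_field:
  assumes h: "smooth_fun_on A UNIV h" and reg: "regular_fun_on A S h" and S: "closed S"
  obtains Z where "smooth_vector_field A Z" "\<And>q. q \<in> S \<Longrightarrow> Z q h = 1"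
proof -
  have "\<forall>p. \<exists>f V. smooth_fun_on A UNIV f \<and> (\<forall>q. f q \<ge> 0) \<and> f p > 0 \<and> smooth_vector_field A V \<and>
      (\<forall>q\<in>S. V q h = (f q :: real))"
    using locally_transversal[OF h reg S] by metis
  then obtain f V where fV: "\<And>p. smooth_fun_on A UNIV (f p)" "\<And>p q. f p q \<ge> (0::real)" "\<And>p. f p p > 0"
    "\<And>p. smooth_vector_field A (V p)" "\<And>p q. q \<in> S \<Longrightarrow> V p q h = f p q" by metis
  define Q where "Q p = f p -` {0<..}" for p
  have Q: "open (Q p)" for p
    unfolding Q_def using smooth_map_on_imp_continuous_on[OF fV(1)] by (intro open_vimage) auto
  \<comment> \<open>Second countability enters here: countably many of the sets where some
    \<open>f p\<close> is positive cover the manifold, so the local data can be numbered, possibly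
    with repetitions.\<close>
  obtain \<F> where \<F>: "\<F> \<subseteq> range Q" "countable \<F>" "\<Union>\<F> = (\<Union>p. Q p)"
    by (rule Lindelof[of "range Q"]) (use Q in auto)
  obtain P where P: "countable P" "\<F> = Q ` P"
    using iffD1[OF countable_subset_image conjI[OF \<F>(2,1)]] by blast
  have cov: "\<exists>p\<in>P. f p q > 0" for q
  proof -
    have "q \<in> Q q" using fV(3) by (simp add: Q_def)
    then have "q \<in> \<Union>\<F>" unfolding \<F>(3) by blast
    then show ?thesis unfolding P(2) by (auto simp: Q_def)
  qed
  define F where "F n = f (from_nat_into P n)" for n
  define G where "G n = V (from_nat_into P n)" for n
  have F: "smooth_fun_on A UNIV (F n)" "F n q \<ge> 0" for n q using fV by (auto simp: F_def)
  have G: "smooth_vector_field A (G n)" for n using fV by (simp add: G_def)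
  have GF: "G n q h = F n q" if "q \<in> S" for n q using fV that by (simp add: F_def G_def)
  have Fpos: "\<exists>n. F n q > 0" for q
  proof -
    obtain p where p: "p \<in> P" "f p q > 0" using cov by blast
    then obtain n where "from_nat_into P n = p" using from_nat_into_surj[OF P(1)] by blast
    then show ?thesis using p(2) by (auto simp: F_def)
  qed
  let ?w = "weight F"
  let ?I = "\<lambda>q. {n. ?w n q \<noteq> 0}"
  have lf: "\<exists>N m. open N \<and> q \<in> N \<and> (\<forall>x\<in>N. ?I x \<subseteq> {..<m})" for q
  proof -
    obtain i where i: "F i q > 0" using Fpos by blast
    obtain N m where N: "open N" "q \<in> N" "\<And>n x. n \<ge> m \<Longrightarrow> x \<in> N \<Longrightarrow> ?w n x = 0"
      by (rule weight_locally_finite[where F = F, OF F(1) i]) (rule that)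
    have "?I x \<subseteq> {..<m}" if "x \<in> N" for x
    proof
      show "n \<in> {..<m}" if "n \<in> ?I x" for n using that N(3)[of n x] \<open>x \<in> N\<close> by (cases "n < m") auto
    qed
    with N(1,2) show ?thesis by blast
  qed
  have fin: "finite (?I q)" for q 
  proof -
    obtain N m where "q \<in> N" "\<forall>x\<in>N. ?I x \<subseteq> {..<m}" using lf by blast
    then show ?thesis using finite_subset[OF _ finite_lessThan] by blast
  qed
  \<comment> \<open>The index set of these sums varies with the point; near each point it lies in a
    fixed \<open>{..<m}\<close>, and the omitted terms are 0.\<close>
  have smooth: "smooth_fun_on A UNIV (\<lambda>q. \<Sum>n\<in>?I q. ?w n q * a n q)" if a: "\<And>n. smooth_fun_on A UNIV (a n)" for a
  proof (rule smooth_map_on_locally[OF A smooth_atlas_model open_UNIV])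
    fix q
    obtain N m where N: "open N" "q \<in> N" "\<forall>x\<in>N. ?I x \<subseteq> {..<m}" using lf by blast
    have "smooth_fun_on A UNIV (\<lambda>q. \<Sum>n<m. ?w n q * a n q)"
      by (intro smooth_fun_on_sum[OF A open_UNIV] smooth_fun_on_mult[OF A open_UNIV] smooth_weight F a) auto
    then have "smooth_fun_on A N (\<lambda>q. \<Sum>n<m. ?w n q * a n q)"
      by (rule smooth_map_on_subset[OF A smooth_atlas_model open_UNIV _ N(1)]) auto
    then have "smooth_fun_on A N (\<lambda>q. \<Sum>n\<in>?I q. ?w n q * a n q)"
    proof (rule smooth_map_on_cong[OF A smooth_atlas_model N(1)])
      fix x assume "x \<in> N"
      then show "(\<Sum>n<m. ?w n x * a n x) = (\<Sum>n\<in>?I x. ?w n x * a n x)"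
        using N(3) by (intro sum.mono_neutral_right) auto
    qed
    with N(1,2) show "\<exists>T. open T \<and> q \<in> T \<and> smooth_fun_on A T (\<lambda>q. \<Sum>n\<in>?I q. ?w n q * a n q)" by blast
  qed
  define D where "D q = (\<Sum>n\<in>?I q. ?w n q * F n q)" for q
  have D: "D q > 0" for q
  proof -
    \<comment> \<open>At the first index with \<open>F n q > 0\<close> all earlier
      \<open>F i q\<close> are 0, so every factor of the \<open>n\<close>-th weight is
      \<open>flat 0 (1 / real (Suc n))\<close>, which is positive.\<close>
    define n where "n = (LEAST n. F n q > 0)"
    have n: "F n q > 0" unfolding n_def using Fpos LeastI_ex by fast
    have "F i q = 0" if "i < n" for i
      using not_less_Least[of i "\<lambda>n. F n q > 0"] that F(2)[of i q] by (simp add: n_def)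
    then have w: "?w n q > 0" unfolding weight_def by (intro prod_pos) (auto intro!: flat_pos)
    show ?thesis
      unfolding D_def using n w fin
      by (intro sum_pos2[of _ n]) (auto intro!: mult_nonneg_nonneg F(2) weight_nonneg)
  qed
  define Z where "Z q g = (1 / D q) * (\<Sum>n\<in>?I q. ?w n q * G n q g)" for q g
  have "smooth_vector_field A Z"
  proof (rule smooth_vector_fieldI)
    show "Z q \<in> tangent_space A q" for q
      unfolding Z_def[abs_def]
      by (intro tangent_space_scale tangent_space_lincomb fin smooth_vector_field_tangent[OF A G])
    fix g :: "'a \<Rightarrow> real" assume g: "smooth_fun_on A UNIV g"
    have "smooth_fun_on A UNIV (\<lambda>q. 1 / D q)"
      using smooth[OF F(1)] D by (intro smooth_fun_on_divide[OF A open_UNIV smooth_fun_const])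
        (auto simp: D_def less_le)
    then show "smooth_fun_on A UNIV (\<lambda>q. Z q g)"
      unfolding Z_def
      by (intro smooth_fun_on_mult[OF A open_UNIV] smooth smooth_vector_field_smooth[OF A G g])
  qed
  moreover have "Z q h = 1" if "q \<in> S" for q
    using D[of q] GF[OF that] by (simp add: Z_def D_def)
  ultimately show ?thesis by (rule that)
qed

section \<open>Flows\<close>

text \<open>Reduces an identity between points to calculus with real functions; this is how
  uniqueness of flows is proved without coordinates.\<close>

lemma smooth_fun_separates:
  assumes "\<And>f. smooth_fun_on A UNIV f \<Longrightarrow> f x = (f y :: real)"
  shows "x = y"
proof (rule ccontr)
  assume "x \<noteq> y"
  then obtain \<beta> :: "'a \<Rightarrow> real" and K W where \<beta>: "smooth_fun_on A UNIV \<beta>" "\<And>x. \<beta> x \<ge> 0"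
    "compact K" "K \<subseteq> - {y}" "\<And>x. x \<notin> K \<Longrightarrow> \<beta> x = 0" "open W" "x \<in> W" "W \<subseteq> - {y}" "\<And>x. x \<in> W \<Longrightarrow> \<beta> x = 1"
    using smooth_bump[OF A, of "- {y}" x] by blast
  have "y \<notin> K" using \<beta>(4) by blast
  then have "\<beta> y = 0" "\<beta> x = 1" using \<beta>(5,7,9) by auto
  with assms[OF \<beta>(1)] show False by simp
qed

section \<open>The flow as a one-parameter group\<close>

lemma global_flow_smooth:
  assumes "global_flow A X \<Phi>"
  shows "smooth_map_on (prod_atlas model_atlas A) A UNIV (\<lambda>z. \<Phi> (fst z) (snd z))"
  using assms by (simp add: global_flow_def smooth_map_eq_smooth_map_on split_beta')

lemma global_flow_0: "global_flow A X \<Phi> \<Longrightarrow> \<Phi> 0 x = x"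
  by (simp add: global_flow_def)

lemma global_flow_add: "global_flow A X \<Phi> \<Longrightarrow> \<Phi> (s + t) x = \<Phi> s (\<Phi> t x)"
  by (simp add: global_flow_def)

lemma global_flow_minus: "global_flow A X \<Phi> \<Longrightarrow> \<Phi> (- t) (\<Phi> t x) = x"
  using global_flow_add[of X \<Phi> "- t" t x] global_flow_0[of X \<Phi> x] by simp

lemma global_flow_minus': "global_flow A X \<Phi> \<Longrightarrow> \<Phi> t (\<Phi> (- t) x) = x"
  using global_flow_minus[of X \<Phi> "- t" x] by simp

lemma global_flow_smooth_map:
  assumes "global_flow A X \<Phi>"
  shows "smooth_map_on A A UNIV (\<Phi> t)"
proof -
  have "smooth_map_on A (prod_atlas model_atlas A) UNIV (\<lambda>x. (t, x))"
    by (intro smooth_map_on_Pair[OF smooth_atlas_model A A] smooth_map_on_const[OF A smooth_atlas_model]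
        smooth_map_on_id[OF A] open_UNIV)
  from smooth_map_on_compose[OF A smooth_atlas_prod[OF smooth_atlas_model A] A open_UNIV open_UNIV _
      global_flow_smooth[OF assms] this]
  show ?thesis by simp
qed

lemma global_flow_smooth_fun:
  assumes "global_flow A X \<Phi>" "smooth_fun_on A UNIV f"
  shows "smooth_fun_on A UNIV (\<lambda>x. f (\<Phi> t x))"
  by (rule smooth_map_on_compose[OF A A smooth_atlas_model open_UNIV open_UNIV _ assms(2)
        global_flow_smooth_map[OF assms(1)]]) auto

lemma global_flow_deriv:
  assumes "global_flow A X \<Phi>" "smooth_fun_on A UNIV f"
  shows "((\<lambda>t. f (\<Phi> t x)) has_real_derivative X (\<Phi> t x) f) (at t)"
proof -
  have "((\<lambda>s. f (\<Phi> s (\<Phi> t x))) has_real_derivative X (\<Phi> t x) f) (at 0)"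
    using assms by (simp add: global_flow_def smooth_fun_iff[OF A])
  then have "((\<lambda>s. f (\<Phi> (s + t) x)) has_real_derivative X (\<Phi> t x) f) (at 0)"
    by (simp add: global_flow_add[OF assms(1)])
  then show ?thesis using DERIV_shift[of "\<lambda>t. f (\<Phi> t x)" _ 0 t] by simp
qed

text \<open>A field is preserved by its own flow: the flow maps commute, so both sides are the
  derivative at \<open>t = 0\<close> of \<open>f (\<Phi> t (\<Phi> s x))\<close>. It will show that
  an orbit through a point with \<open>X \<noteq> 0\<close> meets no zero of
  \<open>X\<close>.\<close>

lemma global_flow_push:
  assumes "global_flow A X \<Phi>" "smooth_fun_on A UNIV f"
  shows "X x (\<lambda>y. f (\<Phi> s y)) = X (\<Phi> s x) f"
proof -
  have "\<Phi> s (\<Phi> t x) = \<Phi> t (\<Phi> s x)" for t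
    using global_flow_add[OF assms(1)] by (metis add.commute)
  then have "((\<lambda>t. f (\<Phi> t (\<Phi> s x))) has_real_derivative X x (\<lambda>y. f (\<Phi> s y))) (at 0)"
    using global_flow_deriv[OF assms(1) global_flow_smooth_fun[OF assms], of s x 0]
      global_flow_0[OF assms(1)] by simp
  then show ?thesis
    using global_flow_deriv[OF assms, of "\<Phi> s x" 0] global_flow_0[OF assms(1)] DERIV_unique by fastforce
qed

lemma global_flow_invariant:
  assumes "global_flow A X \<Phi>" "smooth_fun_on A UNIV f" "\<And>x. X x f = 0"
  shows "f (\<Phi> t x) = f x"
proof -
  have "f (\<Phi> t x) = f (\<Phi> 0 x)"
    by (rule DERIV_isconst_all[of "\<lambda>t. f (\<Phi> t x)"]) (use global_flow_deriv[OF assms(1,2)] assms(3) in auto)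
  then show ?thesis by (simp add: global_flow_0[OF assms(1)])
qed

text \<open>The fundamental theorem for \<open>g (\<Phi> (u * s) q)\<close> as a function of
  \<open>u\<close> in the unit interval: rescaling time brings the factor \<open>s\<close> out of
  the integral and keeps the integrand smooth at \<open>s = 0\<close>.\<close>

lemma global_flow_hadamard:
  assumes \<Phi>: "global_flow A X \<Phi>" and X: "smooth_vector_field A X" and g: "smooth_fun_on A UNIV g"
  obtains M :: "real \<times> 'a \<Rightarrow> real" where "smooth_fun_on (prod_atlas model_atlas A) UNIV M"
    "\<And>s q. g (\<Phi> s q) = g q + s * M (s, q)" "\<And>q. M (0, q) = X q g"
proof
  note P = smooth_atlas_prod[OF smooth_atlas_model A]
  note PP = smooth_atlas_prod[OF smooth_atlas_model P]
  note Xg = smooth_vector_field_smooth[OF A X g]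
  let ?F = "\<lambda>z :: real \<times> real \<times> 'a. X (\<Phi> (fst z * fst (snd z)) (snd (snd z))) g"
  define M where "M z = integral {0..1} (\<lambda>u. ?F (u, z))" for z :: "real \<times> 'a"
  have "smooth_fun_on (prod_atlas model_atlas (prod_atlas model_atlas A)) UNIV ?F"
  proof -
    have s: "smooth_map_on (prod_atlas model_atlas (prod_atlas model_atlas A)) (prod_atlas model_atlas A) UNIV
        (snd :: real \<times> real \<times> 'a \<Rightarrow> _)"
      by (rule smooth_map_on_snd[OF smooth_atlas_model P])
    have "smooth_fun_on (prod_atlas model_atlas (prod_atlas model_atlas A)) UNIV
        (\<lambda>z :: real \<times> real \<times> 'a. fst z * fst (snd z))"
      by (intro smooth_fun_on_mult[OF PP open_UNIV] smooth_map_on_fst[OF smooth_atlas_model P]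
          smooth_map_on_compose[OF PP P smooth_atlas_model open_UNIV open_UNIV _
            smooth_map_on_fst[OF smooth_atlas_model A] s]) auto
    moreover have "smooth_map_on (prod_atlas model_atlas (prod_atlas model_atlas A)) A UNIV
        (\<lambda>z :: real \<times> real \<times> 'a. snd (snd z))"
      by (intro smooth_map_on_compose[OF PP P A open_UNIV open_UNIV _
            smooth_map_on_snd[OF smooth_atlas_model A] s]) auto
    ultimately have "smooth_map_on (prod_atlas model_atlas (prod_atlas model_atlas A)) (prod_atlas model_atlas A) UNIV
        (\<lambda>z :: real \<times> real \<times> 'a. (fst z * fst (snd z), snd (snd z)))"
      by (rule smooth_map_on_Pair[OF smooth_atlas_model A PP open_UNIV])
    from smooth_map_on_compose[OF PP P A open_UNIV open_UNIV _ global_flow_smooth[OF \<Phi>] this]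
    have "smooth_map_on (prod_atlas model_atlas (prod_atlas model_atlas A)) A UNIV
        (\<lambda>z :: real \<times> real \<times> 'a. \<Phi> (fst z * fst (snd z)) (snd (snd z)))" by simp
    from smooth_map_on_compose[OF PP A smooth_atlas_model open_UNIV open_UNIV _ Xg this] show ?thesis by simp
  qed
  from smooth_fun_integral[OF P this]
  show "smooth_fun_on (prod_atlas model_atlas A) UNIV M" by (simp add: M_def[abs_def])
  show "M (0, q) = X q g" for q by (simp add: M_def global_flow_0[OF \<Phi>])
  show "g (\<Phi> s q) = g q + s * M (s, q)" for s q
  proof -
    have "((\<lambda>u. g (\<Phi> (u * s) q)) has_real_derivative X (\<Phi> (u * s) q) g * s) (at u)" for u
    proof -
      have "((\<lambda>u. u * s) has_real_derivative s) (at u)" by (auto intro!: derivative_eq_intros)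
      from DERIV_chain2[OF global_flow_deriv[OF \<Phi> g] this] show ?thesis .
    qed
    then have "((\<lambda>u. X (\<Phi> (u * s) q) g * s) has_integral (g (\<Phi> (1 * s) q) - g (\<Phi> (0 * s) q))) {0..1}"
      by (intro fundamental_theorem_of_calculus)
        (auto simp flip: has_real_derivative_iff_has_vector_derivative intro: has_field_derivative_at_within)
    from integral_unique[OF this]
    have "integral {0..1} (\<lambda>u. X (\<Phi> (u * s) q) g * s) = g (\<Phi> s q) - g q"
      by (simp only: mult_1 mult_zero_left global_flow_0[OF \<Phi>])
    then show ?thesis by (simp add: M_def mult.commute)
  qed
qed

lemma global_flow_curve_continuous:
  assumes "global_flow A X \<Phi>"
  shows "continuous_on UNIV (\<lambda>t. \<Phi> t x)"
  using continuous_on_compose2[OF smooth_map_on_imp_continuous_on[OF global_flow_smooth[OF assms]]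
      continuous_on_Pair[OF continuous_on_id continuous_on_const], of x UNIV] by simp

text \<open>Running one flow forwards and the other backwards gives a curve along which every smooth
  function has derivative 0, so it stays at its starting point.\<close>

lemma global_flow_unique:
  assumes X: "smooth_vector_field A X" and \<Phi>: "global_flow A X \<Phi>" and \<Psi>: "global_flow A X \<Psi>"
  shows "\<Phi> = \<Psi>"
proof (intro ext)
  fix t x
  have "\<Phi> (- t) (\<Psi> t x) = x"
  proof (rule smooth_fun_separates)
    fix f :: "'a \<Rightarrow> real" assume f: "smooth_fun_on A UNIV f"
    have "((\<lambda>t. f (\<Phi> (- t) (\<Psi> t x))) has_real_derivative 0) (at t)" for t
    proof -
      \<comment> \<open>The derivative at \<open>t\<close> is moved to time 0 by the group law.
        There \<open>g (\<Phi> (- r) (\<Psi> r y))\<close> equals \<open>g (\<Psi> r y)\<close>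
        minus \<open>r\<close> times Hadamard's factor, and both terms have derivative
        \<open>X y g\<close>.\<close>
      define y g where "y = \<Psi> t x" and "g = (\<lambda>z. f (\<Phi> (- t) z))"
      have g: "smooth_fun_on A UNIV g" unfolding g_def by (rule global_flow_smooth_fun[OF \<Phi> f])
      obtain M where M: "smooth_fun_on (prod_atlas model_atlas A) UNIV M"
        "\<And>s q. g (\<Phi> s q) = g q + s * M (s, q)" "\<And>q. M (0, q) = X q g"
        using global_flow_hadamard[OF \<Phi> X g] by blast
      have "continuous_on UNIV (\<lambda>r. M (- r, \<Psi> r y))"
        by (rule continuous_on_compose2[OF smooth_map_on_imp_continuous_on[OF M(1)]])
          (auto intro!: continuous_intros global_flow_curve_continuous[OF \<Psi>])
      then have "isCont (\<lambda>r. M (- r, \<Psi> r y)) 0" by (simp add: continuous_on_eq_continuous_at)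
      from DERIV_times_id_at_0[OF this]
      have "((\<lambda>r. r * M (- r, \<Psi> r y)) has_real_derivative X y g) (at 0)"
        by (simp add: M(3) global_flow_0[OF \<Psi>])
      moreover have "((\<lambda>r. g (\<Psi> r y)) has_real_derivative X y g) (at 0)"
        using global_flow_deriv[OF \<Psi> g, of y 0] by (simp add: global_flow_0[OF \<Psi>])
      ultimately have "((\<lambda>r. g (\<Psi> r y) - r * M (- r, \<Psi> r y)) has_real_derivative 0) (at 0)"
        using DERIV_diff by fastforce
      moreover have "g (\<Psi> r y) - r * M (- r, \<Psi> r y) = f (\<Phi> (- (r + t)) (\<Psi> (r + t) x))" for r
      proof -
        have "f (\<Phi> (- (r + t)) (\<Psi> (r + t) x)) = g (\<Phi> (- r) (\<Psi> r y))"
          using global_flow_add[OF \<Phi>, of "- t" "- r"] global_flow_add[OF \<Psi>, of r t]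
          by (simp add: g_def y_def add.commute)
        then show ?thesis using M(2)[of "- r" "\<Psi> r y"] by simp
      qed
      ultimately show ?thesis using DERIV_shift[of "\<lambda>t. f (\<Phi> (- t) (\<Psi> t x))" 0 0 t] by simp
    qed
    then have "f (\<Phi> (- t) (\<Psi> t x)) = f (\<Phi> (- 0) (\<Psi> 0 x))"
      using DERIV_isconst_all[of "\<lambda>t. f (\<Phi> (- t) (\<Psi> t x))"] by blast
    then show "f (\<Phi> (- t) (\<Psi> t x)) = f x" by (simp add: global_flow_0[OF \<Phi>] global_flow_0[OF \<Psi>])
  qed
  then show "\<Phi> t x = \<Psi> t x" using global_flow_minus'[OF \<Phi>, of t "\<Psi> t x"] by simp
qed

lemma Fl_eq:
  assumes "smooth_vector_field A X" "global_flow A X \<Phi>"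
  shows "Fl A X = \<Phi>"
  unfolding Fl_def using assms global_flow_unique by (intro the_equality) auto

lemma complete_vf_Fl:
  assumes "smooth_vector_field A X" "complete_vf A X"
  shows "global_flow A X (Fl A X)"
  using assms Fl_eq unfolding complete_vf_def by metis

end

section \<open>Averaging along a periodic flow\<close>

lemma has_real_derivative_imp_has_vector_derivative_within:
  "(f has_real_derivative d) (at x) \<Longrightarrow> (f has_vector_derivative d) (at x within S)"
  by (simp add: has_real_derivative_iff_has_vector_derivative has_vector_derivative_at_within)

text \<open>Over one period an antiderivative changes by an amount independent of the starting
  point, because the derivative of that change is 0; the starting points 0 and \<open>s\<close> are
  compared.\<close>

lemma integral_periodic_shift:
  fixes j :: "real \<Rightarrow> real"
  assumes cont: "continuous_on UNIV j" and per: "\<And>x. j (x + c) = j x" and c: "c \<ge> 0"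
  shows "integral {0..c} (\<lambda>t. j (t + s)) = integral {0..c} j"
proof -
  \<comment> \<open>Large enough that all arguments below, namely \<open>t\<close> and
    \<open>t + s\<close> for \<open>t\<close> in \<open>{0..c}\<close>, and \<open>x\<close> and
    \<open>x + c\<close> for \<open>\<bar>x\<bar> \<le> \<bar>s\<bar>\<close>, lie in the interior
    of \<open>{- R..R}\<close>.\<close>
  define R where "R = \<bar>s\<bar> + c + 1"
  obtain P where P: "\<And>x. x \<in> {- R..R} \<Longrightarrow> (P has_vector_derivative j x) (at x within {- R..R})"
    by (rule antiderivative_continuous[OF continuous_on_subset[OF cont subset_UNIV], of "- R" R]) (rule that)
  have D: "(P has_real_derivative j x) (at x)" if "\<bar>x\<bar> < R" for x
  proof -
    have "x \<in> interior {- R..R}" "x \<in> {- R..R}" using that by auto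
    then show ?thesis
      using P[of x] at_within_interior[of x "{- R..R}"] by (simp add: has_real_derivative_iff_has_vector_derivative)
  qed
  have 1: "(j has_integral (P c - P 0)) {0..c}"
    by (rule fundamental_theorem_of_calculus[OF c])
      (rule has_real_derivative_imp_has_vector_derivative_within[OF D], auto simp: R_def)
  have "((\<lambda>t. P (t + s)) has_real_derivative j (t + s)) (at t)" if "t \<in> {0..c}" for t
  proof -
    have "\<bar>t + s\<bar> < R" using that by (auto simp: R_def)
    from iffD1[OF DERIV_shift D[OF this]] show ?thesis .
  qed
  then have 2: "((\<lambda>t. j (t + s)) has_integral (P (c + s) - P (0 + s))) {0..c}"
    by (intro fundamental_theorem_of_calculus[OF c] has_real_derivative_imp_has_vector_derivative_within)
  have "((\<lambda>x. P (x + c) - P x) has_real_derivative 0) (at x)" if "\<bar>x\<bar> \<le> \<bar>s\<bar>" for x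
  proof -
    have "\<bar>x + c\<bar> < R" "\<bar>x\<bar> < R" using that c by (auto simp: R_def)
    from DERIV_diff[OF iffD1[OF DERIV_shift D[OF this(1)]] D[OF this(2)]] show ?thesis by (simp add: per)
  qed
  then have "((\<lambda>x. P (x + c) - P x) has_vector_derivative 0) (at x within {- \<bar>s\<bar>..\<bar>s\<bar>})"
    if "x \<in> {- \<bar>s\<bar>..\<bar>s\<bar>}" for x
    using that by (intro has_real_derivative_imp_has_vector_derivative_within) auto
  from has_vector_derivative_zero_constant[OF convex_real_interval(5) this]
  obtain k where k: "\<And>x. x \<in> {- \<bar>s\<bar>..\<bar>s\<bar>} \<Longrightarrow> P (x + c) - P x = k" by blast
  have "s \<in> {- \<bar>s\<bar>..\<bar>s\<bar>}" "0 \<in> {- \<bar>s\<bar>..\<bar>s\<bar>}" unfolding atLeastAtMost_iff by linarith+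
  from k[OF this(1)] k[OF this(2)] have "P (s + c) - P s = P c - P 0" by simp
  with integral_unique[OF 1] integral_unique[OF 2] show ?thesis by (simp add: add.commute)
qed

text \<open>The averaging with the flow as a parameter, and with the inverse of a flow map written
  as the flow at time \<open>- t\<close>, a form in which joint smoothness in time and space is
  accessible.\<close>

definition flow_average :: "(real \<Rightarrow> 'a \<Rightarrow> 'a) \<Rightarrow> 'a vector_field \<Rightarrow> 'a vector_field" where
  "flow_average \<Psi> Z p f = 1 / (2 * pi) * integral {0..2 * pi} (\<lambda>t. Z (\<Psi> t p) (\<lambda>x. f (\<Psi> (- t) x)))"

context
  fixes A :: "('a::{t2_space, second_countable_topology}, 'e::euclidean_space) chart set"
    and T :: "'a vector_field" and \<Psi> :: "real \<Rightarrow> 'a \<Rightarrow> 'a" and Z :: "'a vector_field"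
  assumes A: "smooth_atlas A" and T: "smooth_vector_field A T" and \<Psi>: "global_flow A T \<Psi>"
    and Z: "smooth_vector_field A Z"
begin

text \<open>Time enters twice, in the base point and in the function. The function is treated first,
  as a smooth family at a fixed base point; then the flow is substituted for the base point.\<close>

lemma smooth_flow_average_integrand:
  assumes f: "smooth_fun_on A UNIV f"
  shows "smooth_fun_on (prod_atlas model_atlas A) UNIV (\<lambda>z. Z (\<Psi> (fst z) (snd z)) (\<lambda>x. f (\<Psi> (- fst z) x)))"
proof -
  note P = smooth_atlas_prod[OF smooth_atlas_model A]
  have fst: "smooth_fun_on (prod_atlas model_atlas A) UNIV (fst :: real \<times> 'a \<Rightarrow> real)"
    and snd: "smooth_map_on (prod_atlas model_atlas A) A UNIV (snd :: real \<times> 'a \<Rightarrow> 'a)"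
    by (rule smooth_map_on_fst[OF smooth_atlas_model A], rule smooth_map_on_snd[OF smooth_atlas_model A])
  have "smooth_map_on (prod_atlas model_atlas A) (prod_atlas model_atlas A) UNIV
      (\<lambda>z :: real \<times> 'a. (- fst z, snd z))"
    by (rule smooth_map_on_Pair[OF smooth_atlas_model A P open_UNIV
          smooth_fun_on_linear[OF P open_UNIV bounded_linear_minus[OF bounded_linear_ident] fst] snd])
  from smooth_map_on_compose[OF P P A open_UNIV open_UNIV _ global_flow_smooth[OF A \<Psi>] this]
  have "smooth_map_on (prod_atlas model_atlas A) A UNIV (\<lambda>z. \<Psi> (- fst z) (snd z))" by simp
  from smooth_map_on_compose[OF P A smooth_atlas_model open_UNIV open_UNIV _ f this]
  have "smooth_fun_on (prod_atlas model_atlas A) UNIV (\<lambda>z. f (\<Psi> (- fst z) (snd z)))" by simp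
  from smooth_vector_field_param[OF A Z this]
  have 1: "smooth_fun_on (prod_atlas model_atlas A) UNIV (\<lambda>z. Z (snd z) (\<lambda>x. f (\<Psi> (- fst z) x)))" by simp
  have "smooth_map_on (prod_atlas model_atlas A) (prod_atlas model_atlas A) UNIV
      (\<lambda>z. (fst z, \<Psi> (fst z) (snd z)))"
    by (rule smooth_map_on_Pair[OF smooth_atlas_model A P open_UNIV fst global_flow_smooth[OF A \<Psi>]])
  from smooth_map_on_compose[OF P P smooth_atlas_model open_UNIV open_UNIV _ 1 this] show ?thesis by simp
qed

lemma continuous_flow_average_integrand:
  assumes "smooth_fun_on A UNIV f"
  shows "continuous_on S (\<lambda>t. Z (\<Psi> t p) (\<lambda>x. f (\<Psi> (- t) x)))"
proof -
  have "continuous_on S (\<lambda>t. (t, p))" by (auto intro!: continuous_intros)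
  from continuous_on_compose2[OF smooth_map_on_imp_continuous_on[OF smooth_flow_average_integrand[OF assms]] this]
  show ?thesis by simp
qed

lemma smooth_flow_average: "smooth_vector_field A (flow_average \<Psi> Z)"
proof (rule smooth_vector_fieldI[OF A])
  show "flow_average \<Psi> Z p \<in> tangent_space A p" for p
  proof (rule tangent_spaceI[OF A])
    note fl = global_flow_smooth_fun[OF A \<Psi>] and tg = smooth_vector_field_tangent[OF A Z]
    note int = integrable_continuous_real[OF continuous_flow_average_integrand]
    show "flow_average \<Psi> Z p (\<lambda>x. f x + g x) = flow_average \<Psi> Z p f + flow_average \<Psi> Z p g"
      if "smooth_fun_on A UNIV f" "smooth_fun_on A UNIV g" for f g
      using that
      by (simp add: flow_average_def tangent_add[OF A tg] fl integral_add int add_divide_distrib)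
    show "flow_average \<Psi> Z p (\<lambda>x. c * f x) = c * flow_average \<Psi> Z p f"
      if "smooth_fun_on A UNIV f" for c f
      using that by (simp add: flow_average_def tangent_scale[OF A tg] fl)
    show "flow_average \<Psi> Z p (\<lambda>x. f x * g x) = f p * flow_average \<Psi> Z p g + g p * flow_average \<Psi> Z p f"
      if f: "smooth_fun_on A UNIV f" and g: "smooth_fun_on A UNIV g" for f g
    proof -
      have "Z (\<Psi> t p) (\<lambda>x. f (\<Psi> (- t) x) * g (\<Psi> (- t) x)) =
          f p * Z (\<Psi> t p) (\<lambda>x. g (\<Psi> (- t) x)) + g p * Z (\<Psi> t p) (\<lambda>x. f (\<Psi> (- t) x))" for t
        using tangent_mult[OF A tg fl[OF f] fl[OF g]] by (simp add: global_flow_minus[OF A \<Psi>])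
      moreover have "(\<lambda>t. k * Z (\<Psi> t p) (\<lambda>x. u (\<Psi> (- t) x))) integrable_on {0..2 * pi}"
        if "smooth_fun_on A UNIV u" for k u
        by (intro integrable_continuous_real continuous_on_mult continuous_on_const
            continuous_flow_average_integrand that)
      ultimately show ?thesis
        by (simp add: flow_average_def integral_add f g add_divide_distrib)
    qed
    \<comment> \<open>Composition with a flow map is invertible, so \<open>f\<close> moved along the
      flow is still not smooth and the integrand is 0 by normalisation.\<close>
    show "flow_average \<Psi> Z p f = 0" if f: "\<not> smooth_fun_on A UNIV f" for f
    proof -
      have "\<not> smooth_fun_on A UNIV (\<lambda>x. f (\<Psi> (- t) x))" for t
        using f fl[of "\<lambda>x. f (\<Psi> (- t) x)" t] by (auto simp: global_flow_minus[OF A \<Psi>])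
      then have "Z (\<Psi> t p) (\<lambda>x. f (\<Psi> (- t) x)) = 0" for t using tangent_not_smooth[OF A tg] by blast
      then show ?thesis by (simp add: flow_average_def)
    qed
  qed
  show "smooth_fun_on A UNIV (\<lambda>p. flow_average \<Psi> Z p f)" if f: "smooth_fun_on A UNIV f" for f
    unfolding flow_average_def
    using smooth_fun_integral[OF A smooth_flow_average_integrand[OF f]]
    by (intro smooth_fun_on_mult[OF A open_UNIV smooth_fun_const[OF A]]) simp
qed

text \<open>Moving the base point by \<open>s\<close> amounts to shifting the time variable in the
  integral, and the integrand has period \<open>2 * pi\<close>.\<close>

lemma flow_average_invariant:
  assumes per: "\<And>x. \<Psi> (2 * pi) x = x" and g: "smooth_fun_on A UNIV g"
  shows "flow_average \<Psi> Z (\<Psi> s p) g = flow_average \<Psi> Z p (\<lambda>x. g (\<Psi> s x))"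
proof -
  note add = global_flow_add[OF A \<Psi>]
  let ?j = "\<lambda>t. Z (\<Psi> t p) (\<lambda>x. g (\<Psi> s (\<Psi> (- t) x)))"
  have "?j (t + 2 * pi) = ?j t" for t
  proof -
    have "\<Psi> (- t) x = \<Psi> (- (t + 2 * pi)) x" for x
      using add[of "- (t + 2 * pi)" "2 * pi" x] per by simp
    then show ?thesis using add[of t "2 * pi" p] per by simp
  qed
  then have "integral {0..2 * pi} (\<lambda>t. ?j (t + s)) = integral {0..2 * pi} ?j"
    using continuous_flow_average_integrand[OF global_flow_smooth_fun[OF A \<Psi> g]]
    by (intro integral_periodic_shift) auto
  moreover have "?j (t + s) = Z (\<Psi> t (\<Psi> s p)) (\<lambda>x. g (\<Psi> (- t) x))" for t
    using add[of t s p] add[of s "- (t + s)"] by simp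
  ultimately show ?thesis by (simp add: flow_average_def)
qed

text \<open>Invariance of the average, differentiated at \<open>s = 0\<close>. On the right the
  derivative has to pass through the derivation at \<open>p\<close>; expanding \<open>g\<close>
  along the flow by Hadamard's lemma brings the factor \<open>s\<close> outside, and continuity of
  what remains is enough.\<close>

lemma flow_average_commutes:
  assumes per: "\<And>x. \<Psi> (2 * pi) x = x" and g: "smooth_fun_on A UNIV g"
  shows "T p (\<lambda>q. flow_average \<Psi> Z q g) = flow_average \<Psi> Z p (\<lambda>q. T q g)"
proof -
  let ?Y = "flow_average \<Psi> Z"
  obtain M where M: "smooth_fun_on (prod_atlas model_atlas A) UNIV M"
    "\<And>s q. g (\<Psi> s q) = g q + s * M (s, q)" "\<And>q. M (0, q) = T q g"
    using global_flow_hadamard[OF A \<Psi> T g] by blast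
  have tg: "?Y p \<in> tangent_space A p" by (rule smooth_vector_field_tangent[OF A smooth_flow_average])
  have eq: "?Y (\<Psi> s p) g = ?Y p g + s * ?Y p (\<lambda>q. M (s, q))" for s
  proof -
    note Ms = smooth_fun_slice[OF A M(1), of s]
    have "?Y (\<Psi> s p) g = ?Y p (\<lambda>x. g x + s * M (s, x))"
      unfolding flow_average_invariant[OF per g] M(2) ..
    then show ?thesis
      by (simp only: tangent_add[OF A tg g smooth_fun_on_mult[OF A open_UNIV smooth_fun_const[OF A] Ms]]
          tangent_scale[OF A tg Ms])
  qed
  have "continuous_on UNIV (\<lambda>s::real. (s, p))" by (auto intro!: continuous_intros)
  from continuous_on_compose2[OF smooth_map_on_imp_continuous_on[OF
        smooth_vector_field_param[OF A smooth_flow_average M(1)]] this]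
  have "isCont (\<lambda>s. ?Y p (\<lambda>q. M (s, q))) 0" by (simp add: continuous_on_eq_continuous_at)
  from DERIV_times_id_at_0[OF this]
  have "((\<lambda>s. s * ?Y p (\<lambda>q. M (s, q))) has_real_derivative ?Y p (\<lambda>q. T q g)) (at 0)"
    by (simp add: M(3))
  from DERIV_add[OF DERIV_const this]
  have "((\<lambda>s. ?Y p g + s * ?Y p (\<lambda>q. M (s, q))) has_real_derivative ?Y p (\<lambda>q. T q g)) (at 0)"
    by simp
  moreover have "((\<lambda>s. ?Y (\<Psi> s p) g) has_real_derivative T p (\<lambda>q. ?Y q g)) (at 0)"
    using global_flow_deriv[OF A \<Psi> smooth_vector_field_smooth[OF A smooth_flow_average g], of p 0]
    by (simp add: global_flow_0[OF A \<Psi>])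
  ultimately show ?thesis unfolding eq by (metis DERIV_unique)
qed

end

section \<open>The bivector field\<close>

text \<open>A shuffle is determined by the argument left for the outer slot, the value at 2: it is
  2, 1 or 0 in the order listed, the last being a 3-cycle.\<close>

lemma shuffle_perms_2_1:
  "shuffle_perms 2 1 = {id, Transposition.transpose 1 2, Transposition.transpose 0 1 \<circ> Transposition.transpose 1 2}"
proof -
  have set3: "{..<3} = {0, 1, 2 :: nat}" by auto
  have "\<sigma> \<in> shuffle_perms 2 1 \<longleftrightarrow> \<sigma> \<in> {id, Transposition.transpose 1 2, Transposition.transpose 0 1 \<circ> Transposition.transpose 1 2}" for \<sigma>
  proof
    assume "\<sigma> \<in> shuffle_perms 2 1"
    then have p: "\<sigma> permutes {..<3}" and "strict_mono_on {..<2} \<sigma>" by (auto simp: shuffle_perms_def)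
    then have lt: "\<sigma> 0 < \<sigma> 1" by (auto simp: monotone_on_def)
    have r: "\<sigma> 0 \<in> {0, 1, 2}" "\<sigma> 1 \<in> {0, 1, 2}" "\<sigma> 2 \<in> {0, 1, 2}"
      using permutes_in_image[OF p, of 0] permutes_in_image[OF p, of 1] permutes_in_image[OF p, of 2]
      by (simp_all add: set3)
    have ne: "\<sigma> 0 \<noteq> \<sigma> 2" "\<sigma> 1 \<noteq> \<sigma> 2" by (simp_all add: inj_eq[OF permutes_inj[OF p]])
    have out: "\<sigma> i = i" if "i \<notin> {0, 1, 2}" for i
      using permutes_not_in[OF p, of i] that by (simp add: set3)
    consider "\<sigma> 0 = 0" "\<sigma> 1 = 1" "\<sigma> 2 = 2" | "\<sigma> 0 = 0" "\<sigma> 1 = 2" "\<sigma> 2 = 1" | "\<sigma> 0 = 1" "\<sigma> 1 = 2" "\<sigma> 2 = 0"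
      using r lt ne by auto
    then show "\<sigma> \<in> {id, Transposition.transpose 1 2, Transposition.transpose 0 1 \<circ> Transposition.transpose 1 2}"
    proof cases
      case 1
      then have "\<sigma> i = id i" for i using out[of i] by (cases "i \<in> {0, 1, 2}") auto
      then have "\<sigma> = id" by (rule ext)
      then show ?thesis by simp
    next
      case 2
      then have "\<sigma> i = Transposition.transpose 1 2 i" for i
        using out[of i] by (cases "i \<in> {0, 1, 2}") (auto simp: Transposition.transpose_def)
      then show ?thesis by auto
    next
      case 3
      then have "\<sigma> i = (Transposition.transpose 0 1 \<circ> Transposition.transpose 1 2) i" for i
        using out[of i] by (cases "i \<in> {0, 1, 2}") (auto simp: Transposition.transpose_def)
      then have "\<sigma> = Transposition.transpose 0 1 \<circ> Transposition.transpose 1 2" by (rule ext)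
      then show ?thesis by simp
    qed
  next
    assume "\<sigma> \<in> {id, Transposition.transpose 1 2, Transposition.transpose 0 1 \<circ> Transposition.transpose 1 2}"
    then show "\<sigma> \<in> shuffle_perms 2 1"
      by (auto simp: shuffle_perms_def monotone_on_def Transposition.transpose_def less_Suc_eq numeral_eq_Suc
          intro!: permutes_id permutes_swap_id permutes_compose)
  qed
  then show ?thesis by blast
qed

text \<open>Applied to a bivector inserted into itself, this is the Jacobiator
  \<open>{{a, b}, c} - {{a, c}, b} + {{b, c}, a}\<close>.\<close>

lemma sum_shuffle_perms_2_1:
  fixes F :: "(nat \<Rightarrow> nat) \<Rightarrow> real"
  shows "(\<Sum>\<sigma>\<in>shuffle_perms 2 1. of_int (sign \<sigma>) * F \<sigma>) =
    F id - F (Transposition.transpose 1 2) + F (Transposition.transpose 0 1 \<circ> Transposition.transpose 1 2)"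
proof -
  have "Transposition.transpose 1 2 \<noteq> (id :: nat \<Rightarrow> nat)" by (auto simp: fun_eq_iff Transposition.transpose_def intro: exI[of _ 1])
  moreover have "Transposition.transpose 0 1 \<circ> Transposition.transpose 1 2 \<noteq> (id :: nat \<Rightarrow> nat)"
    by (auto simp: fun_eq_iff Transposition.transpose_def intro: exI[of _ 1])
  moreover have "Transposition.transpose 0 1 \<circ> Transposition.transpose 1 2 \<noteq> (Transposition.transpose 1 2 :: nat \<Rightarrow> nat)"
    by (auto simp: fun_eq_iff Transposition.transpose_def intro: exI[of _ 0])
  moreover have "sign (Transposition.transpose 0 1 \<circ> Transposition.transpose 1 2 :: nat \<Rightarrow> nat) = 1"
    by (simp add: sign_compose permutation_swap_id sign_swap_id)
  ultimately show ?thesis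
    unfolding shuffle_perms_2_1 by (auto simp: sign_swap_id)
qed

context
  fixes A :: "('a::{t2_space, second_countable_topology}, 'e::euclidean_space) chart set"
    and X Y :: "'a vector_field"
  assumes A: "smooth_atlas A" and X: "smooth_vector_field A X" and Y: "smooth_vector_field A Y"
begin

lemma mv_eval_wedge:
  "mv_eval A (wedge Y X) [f, g] = (\<lambda>x. Y x f * X x g - X x f * Y x g)"
  by (simp add: mv_eval_def wedge_def differential_def smooth_vector_field_tangent[OF A X]
      smooth_vector_field_tangent[OF A Y])

lemma smooth_mv_eval_wedge:
  assumes "smooth_fun_on A UNIV f" "smooth_fun_on A UNIV g"
  shows "smooth_fun_on A UNIV (mv_eval A (wedge Y X) [f, g])"
  unfolding mv_eval_wedge
  by (intro smooth_fun_on_diff[OF A open_UNIV] smooth_fun_on_mult[OF A open_UNIV]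
      smooth_vector_field_smooth[OF A X] smooth_vector_field_smooth[OF A Y] assms)

lemma smooth_multivector_field_wedge: "smooth_multivector_field A 2 (wedge Y X)"
  unfolding smooth_multivector_field_def
proof (intro conjI allI impI ballI)
  fix fs :: "('a \<Rightarrow> real) list" assume "length fs = 2" and s: "\<forall>f\<in>set fs. smooth_fun A f"
  then obtain f g where fs: "fs = [f, g]" by (auto simp: numeral_2_eq_2 length_Suc_conv)
  show "smooth_fun A (mv_eval A (wedge Y X) fs)"
    using smooth_mv_eval_wedge s by (simp add: fs smooth_fun_iff[OF A])
next
  fix p and as :: "'a covector list" and i \<beta> \<gamma> b c
  assume "length as = 2" "i < (2::nat)"
  then obtain a1 a2 where "as = [a1, a2]" by (auto simp: numeral_2_eq_2 length_Suc_conv)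
  moreover have "i = 0 \<or> i = 1" using \<open>i < 2\<close> by auto
  ultimately show "wedge Y X p (as[i := (\<lambda>v. b * \<beta> v + c * \<gamma> v)]) =
      b * wedge Y X p (as[i := \<beta>]) + c * wedge Y X p (as[i := \<gamma>])"
    by (auto simp: wedge_def algebra_simps)
next
  fix p and as :: "'a covector list" and i j :: nat
  assume "length as = 2" "i < 2" "j < 2" "i \<noteq> j" "as ! i = as ! j"
  then have "as ! 0 = as ! 1" by (auto simp: less_2_cases_iff)
  then show "wedge Y X p as = 0" by (simp add: wedge_def)
qed

lemma poisson_structure_wedge:
  assumes comm: "\<And>p g. smooth_fun_on A UNIV g \<Longrightarrow> X p (\<lambda>q. Y q g) - Y p (\<lambda>q. X q g) = l p * X p g"
  shows "poisson_structure A (wedge Y X)"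
proof -
  have "schouten A 2 2 (wedge Y X) (wedge Y X) fs x = 0"
    if len: "length fs = 3" and s: "\<forall>f\<in>set fs. smooth_fun A f" for fs x
  proof -
    obtain a b c where fs: "fs = [a, b, c]" using len by (auto simp: numeral_3_eq_3 length_Suc_conv)
    have abc: "smooth_fun_on A UNIV a" "smooth_fun_on A UNIV b" "smooth_fun_on A UNIV c"
      using s by (auto simp: fs smooth_fun_iff[OF A])
    let ?b = "\<lambda>f g. mv_eval A (wedge Y X) [f, g]"
    note XS = smooth_vector_field_smooth[OF A X] and YS = smooth_vector_field_smooth[OF A Y]
    note mult = smooth_fun_on_mult[OF A open_UNIV]
    have expand: "V x (?b f g) = Y x f * V x (\<lambda>q. X q g) + X x g * V x (\<lambda>q. Y q f)
        - (X x f * V x (\<lambda>q. Y q g) + Y x g * V x (\<lambda>q. X q f))"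
      if V: "smooth_vector_field A V" and f: "smooth_fun_on A UNIV f" and g: "smooth_fun_on A UNIV g" for V f g
    proof -
      note t = smooth_vector_field_tangent[OF A V]
      show ?thesis
        unfolding mv_eval_wedge
        by (simp add: tangent_diff[OF A t mult[OF YS[OF f] XS[OF g]] mult[OF XS[OF f] YS[OF g]]]
            tangent_mult[OF A t YS[OF f] XS[OF g]] tangent_mult[OF A t XS[OF f] YS[OF g]])
    qed
    \<comment> \<open>All mixed second derivatives are brought to one order. The correction cancels
      already inside \<open>X x (?b f g)\<close>, where it contributes
      \<open>l x * X x f * X x g\<close> once with each sign; what is left is the Jacobiator as for
      commuting fields.\<close>
    have c': "X x (\<lambda>q. Y q g) = Y x (\<lambda>q. X q g) + l x * X x g" if "smooth_fun_on A UNIV g" for g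
      using comm[OF that, of x] by simp
    have "?b (?b a b) c x - ?b (?b a c) b x + ?b (?b b c) a x = 0"
      unfolding mv_eval_wedge[of "?b _ _"]
      by (simp add: expand[OF X] expand[OF Y] abc c' algebra_simps)
    moreover have "mv_insert A 2 2 (wedge Y X) (wedge Y X) fs x =
        ?b (?b a b) c x - ?b (?b a c) b x + ?b (?b b c) a x"
      unfolding mv_insert_def
      by (simp add: sum_shuffle_perms_2_1[simplified] fs upt_rec Transposition.transpose_def)
    \<comment> \<open>The sign in \<open>schouten\<close> is \<open>(- 1) ^ 1\<close>, so the
      bracket is twice the Jacobiator.\<close>
    ultimately show ?thesis by (simp add: schouten_def)
  qed
  then show ?thesis
    unfolding poisson_structure_def using smooth_multivector_field_wedge by blast
qed

text \<open>The pairing of \<open>dh\<close> and \<open>dg\<close> is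
  \<open>Y h * X g - X h * Y g\<close>, with vanishing second term. The product form of the
  condition on \<open>Y h\<close> asks nothing at the zeros of \<open>X\<close>; on non-smooth
  \<open>g\<close> both fields are 0 by normalisation.\<close>

lemma hamiltonian_vf_wedge:
  assumes h: "smooth_fun_on A UNIV h" and Xh: "\<And>p. X p h = 0" and Yh: "\<And>p g. Y p h * X p g = X p g"
  shows "hamiltonian_vf A (wedge Y X) X"
proof -
  have "X = sharp A (wedge Y X) (differential A h)"
  proof (intro ext)
    fix p g
    show "X p g = sharp A (wedge Y X) (differential A h) p g"
      using tangent_not_smooth[OF A smooth_vector_field_tangent[OF A X]] Yh Xh
      by (simp add: sharp_def wedge_def differential_def smooth_vector_field_tangent[OF A X]
          smooth_vector_field_tangent[OF A Y] smooth_fun_iff[OF A])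
  qed
  then show ?thesis unfolding hamiltonian_vf_def using h smooth_fun_iff[OF A] by blast
qed

end

section \<open>Vector fields with periodic flow\<close>

text \<open>The rescaling of time differs from orbit to orbit but is constant along each, by
  invariance of \<open>w\<close>; this is why the rescaled maps still satisfy the group law.\<close>

lemma global_flow_circle_generator:
  fixes A :: "('a::{t2_space, second_countable_topology}, 'e::euclidean_space) chart set"
  assumes A: "smooth_atlas A" and \<Phi>: "global_flow A X \<Phi>" and w: "smooth_fun_on A UNIV w"
    and inv: "\<And>t x. w (\<Phi> t x) = w x"
  shows "global_flow A (circle_generator X w) (\<lambda>t x. \<Phi> (t * (w x / (2 * pi))) x)"
proof -
  note P = smooth_atlas_prod[OF smooth_atlas_model A]
  have fst: "smooth_fun_on (prod_atlas model_atlas A) UNIV (fst :: real \<times> 'a \<Rightarrow> real)"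
    and snd: "smooth_map_on (prod_atlas model_atlas A) A UNIV (snd :: real \<times> 'a \<Rightarrow> 'a)"
    by (rule smooth_map_on_fst[OF smooth_atlas_model A], rule smooth_map_on_snd[OF smooth_atlas_model A])
  have "smooth_fun_on A UNIV (\<lambda>x. w x / (2 * pi))"
    by (intro smooth_fun_on_divide[OF A open_UNIV w smooth_fun_const[OF A]]) simp
  from smooth_map_on_compose[OF P A smooth_atlas_model open_UNIV open_UNIV _ this snd]
  have "smooth_fun_on (prod_atlas model_atlas A) UNIV (\<lambda>z :: real \<times> 'a. w (snd z) / (2 * pi))" by simp
  from smooth_map_on_Pair[OF smooth_atlas_model A P open_UNIV smooth_fun_on_mult[OF P open_UNIV fst this] snd]
  have "smooth_map_on (prod_atlas model_atlas A) (prod_atlas model_atlas A) UNIV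
      (\<lambda>z :: real \<times> 'a. (fst z * (w (snd z) / (2 * pi)), snd z))" .
  from smooth_map_on_compose[OF P P A open_UNIV open_UNIV _ global_flow_smooth[OF A \<Phi>] this]
  have "smooth_map (prod_atlas model_atlas A) A (\<lambda>(t, x). \<Phi> (t * (w x / (2 * pi))) x)"
    by (simp add: smooth_map_eq_smooth_map_on split_beta')
  moreover have "((\<lambda>t. f (\<Phi> (t * (w x / (2 * pi))) x)) has_real_derivative circle_generator X w x f) (at 0)"
    if f: "smooth_fun A f" for f x
  proof -
    have f': "smooth_fun_on A UNIV f" using f smooth_fun_iff[OF A] by blast
    have "((\<lambda>t. t * (w x / (2 * pi))) has_real_derivative w x / (2 * pi)) (at 0)"
      by (auto intro!: derivative_eq_intros)
    from DERIV_chain2[OF global_flow_deriv[OF A \<Phi> f'] this]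
    show ?thesis by (simp add: circle_generator_def scale_vf_def global_flow_0[OF A \<Phi>] mult.commute)
  qed
  moreover have "\<Phi> ((s + t) * (w x / (2 * pi))) x =
      \<Phi> (s * (w (\<Phi> (t * (w x / (2 * pi))) x) / (2 * pi))) (\<Phi> (t * (w x / (2 * pi))) x)" for s t x
    by (simp add: inv global_flow_add[OF A \<Phi>, symmetric] distrib_right add_divide_distrib)
  ultimately show ?thesis
    unfolding global_flow_def by (simp add: global_flow_0[OF A \<Phi>])
qed

lemma average_eq_flow_average:
  assumes A: "smooth_atlas A" and "global_flow A T \<Psi>" and "Fl A (circle_generator X w) = \<Psi>"
  shows "average A X w Z = flow_average \<Psi> Z"
proof -
  have "inv (\<Psi> t) = \<Psi> (- t)" for t
    by (rule inv_unique_comp)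
      (auto simp: fun_eq_iff global_flow_minus[OF A assms(2)] global_flow_minus'[OF A assms(2)])
  then show ?thesis
    unfolding average_def flow_average_def pullback_vf_def assms(3) by (simp add: o_def fun_eq_iff)
qed

text \<open>The first conjunct keeps the second from being vacuous; the second is proved for every
  admissible \<open>Z\<close>, not only for the glued one.\<close>

theorem theorem4p25:
  fixes A :: "('a::{t2_space, second_countable_topology}, 'e::euclidean_space) chart set"
    and X :: "'a vector_field"
    and w h :: "'a \<Rightarrow> real"
  assumes "smooth_atlas A"
    and "smooth_vector_field A X"
    and "periodic_flow A X w"
    and "first_integral A X h"
    and "regular_fun_on A (supp_vf X) h"
  shows "(\<exists>Z. smooth_vector_field A Z \<and> scale_vf (\<lambda>p. differential A h p (Z p)) X = X) \<and>
    (\<forall>Z. smooth_vector_field A Z \<and> scale_vf (\<lambda>p. differential A h p (Z p)) X = X \<longrightarrow>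
      (let Y = average A X w Z; \<pi> = wedge Y X in
         smooth_vector_field A Y \<and> poisson_structure A \<pi> \<and> hamiltonian_vf A \<pi> X))"
proof -
  note A = assms(1) and X = assms(2)
  note tgX = smooth_vector_field_tangent[OF A X]
  have h: "smooth_fun_on A UNIV h" using assms(4) by (simp add: first_integral_def smooth_fun_iff[OF A])
  have Xh: "X p h = 0" for p using assms(4) tgX by (simp add: first_integral_def differential_def)
  have "\<exists>Z. smooth_vector_field A Z \<and> scale_vf (\<lambda>p. differential A h p (Z p)) X = X"
  proof -
    have "closed (supp_vf X)" by (simp add: supp_vf_def)
    from transversal_vector_field[OF A h assms(5) this]
    obtain Z where Z: "smooth_vector_field A Z" "\<And>q. q \<in> supp_vf X \<Longrightarrow> Z q h = 1" by blast
    have "differential A h p (Z p) * X p f = X p f" for p f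
    proof (cases "X p = (\<lambda>f. 0)")
      case False
      then have "p \<in> {p. X p \<noteq> (\<lambda>f. 0)}" by simp
      then have "p \<in> supp_vf X" unfolding supp_vf_def by (rule subsetD[OF closure_subset])
      then show ?thesis using Z(2) smooth_vector_field_tangent[OF A Z(1)] by (simp add: differential_def)
    qed simp
    then have "scale_vf (\<lambda>p. differential A h p (Z p)) X = X" unfolding scale_vf_def by (intro ext)
    with Z(1) show ?thesis by blast
  qed
  moreover have "smooth_vector_field A (average A X w Z) \<and> poisson_structure A (wedge (average A X w Z) X) \<and>
      hamiltonian_vf A (wedge (average A X w Z) X) X"
    if Z: "smooth_vector_field A Z" and ZX: "scale_vf (\<lambda>p. differential A h p (Z p)) X = X" for Z
  proof -
    define \<Phi> where "\<Phi> = Fl A X"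
    have \<Phi>: "global_flow A X \<Phi>" and w: "smooth_fun_on A UNIV w" "\<And>x. w x > 0"
      "\<And>t x. w (\<Phi> t x) = w x" "\<And>x. \<Phi> (w x) x = x"
      using assms(3) complete_vf_Fl[OF A X] by (auto simp: periodic_flow_def \<Phi>_def smooth_fun_iff[OF A])
    define c where "c x = w x / (2 * pi)" for x
    have c: "smooth_fun_on A UNIV c"
      unfolding c_def by (intro smooth_fun_on_divide[OF A open_UNIV w(1) smooth_fun_const[OF A]]) simp
    define T where "T = circle_generator X w"
    have T_eq: "T x f = c x * X x f" for x f by (simp add: T_def circle_generator_def scale_vf_def c_def)
    have T: "smooth_vector_field A T"
      using smooth_vector_field_scale[OF A X c] by (simp add: T_def circle_generator_def c_def[abs_def])
    define \<Psi> where "\<Psi> t x = \<Phi> (t * c x) x" for t x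
    have \<Psi>: "global_flow A T \<Psi>"
      unfolding T_def \<Psi>_def[abs_def] c_def by (rule global_flow_circle_generator[OF A \<Phi> w(1)]) (simp only: w(3))
    have per: "\<Psi> (2 * pi) x = x" for x using w(4) by (simp add: \<Psi>_def c_def)
    define Y where "Y = flow_average \<Psi> Z"
    have avg: "average A X w Z = Y"
      unfolding Y_def by (rule average_eq_flow_average[OF A \<Psi> Fl_eq[OF A T \<Psi>, unfolded T_def]])
    have Y: "smooth_vector_field A Y" unfolding Y_def by (rule smooth_flow_average[OF A T \<Psi> Z])
    note tgY = smooth_vector_field_tangent[OF A Y]
    \<comment> \<open>Since \<open>T = c X\<close> commutes with \<open>Y\<close>, the Leibniz rule
      gives \<open>c [X, Y] = Y(c) X\<close>, and \<open>c\<close> is positive because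
      \<open>w\<close> is.\<close>
    have "X p (\<lambda>q. Y q g) - Y p (\<lambda>q. X q g) = Y p c / c p * X p g" if g: "smooth_fun_on A UNIV g" for p g
    proof -
      have "c p * X p (\<lambda>q. Y q g) = Y p (\<lambda>q. c q * X q g)"
        using flow_average_commutes[OF A T \<Psi> Z per g, of p] by (simp add: Y_def T_eq)
      also have "\<dots> = c p * Y p (\<lambda>q. X q g) + X p g * Y p c"
        by (rule tangent_mult[OF A tgY c smooth_vector_field_smooth[OF A X g]])
      finally show ?thesis using w(2)[of p] by (simp add: c_def field_simps)
    qed
    then have "poisson_structure A (wedge Y X)" by (rule poisson_structure_wedge[OF A X Y])
    moreover have "Y p h * X p g = X p g" for p g
    proof (cases "X p g = 0")
      case False
      have hinv: "h (\<Psi> t x) = h x" for t x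
        by (rule global_flow_invariant[OF A \<Psi> h]) (simp add: T_eq Xh)
      \<comment> \<open>\<open>X\<close> is carried along by its own flow, so it is nonzero on the
        whole orbit of \<open>p\<close>, as \<open>g\<close> composed with the backward flow
        detects; where \<open>X\<close> is nonzero, \<open>dh(Z) X = X\<close> forces the value
        1.\<close>
      have "Z (\<Psi> t p) h = 1" for t
      proof -
        have g: "smooth_fun_on A UNIV g" using False tangent_not_smooth[OF A tgX] by blast
        define r where "r = t * c p"
        have g': "smooth_fun_on A UNIV (\<lambda>x. g (\<Phi> (- r) x))" by (rule global_flow_smooth_fun[OF A \<Phi> g])
        have "X (\<Phi> r p) (\<lambda>x. g (\<Phi> (- r) x)) = X p g"
          using global_flow_push[OF A \<Phi> g', of p r] by (simp add: global_flow_minus[OF A \<Phi>])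
        moreover have "Z (\<Phi> r p) h * X (\<Phi> r p) f = X (\<Phi> r p) f" for f
          using fun_cong[OF fun_cong[OF ZX], of "\<Phi> r p" f] smooth_vector_field_tangent[OF A Z]
          by (simp add: scale_vf_def differential_def)
        ultimately show ?thesis using False by (metis mult_cancel_right1 \<Psi>_def r_def)
      qed
      \<comment> \<open>Invariance of \<open>h\<close> reduces the integrand of the average to
        \<open>Z (\<Psi> t p) h\<close>, the constant 1.\<close>
      then have "Y p h = 1" by (simp add: Y_def flow_average_def hinv)
      then show ?thesis by simp
    qed simp
    then have "hamiltonian_vf A (wedge Y X) X" by (rule hamiltonian_vf_wedge[OF A X Y h, OF Xh])
    ultimately show ?thesis using Y by (simp add: avg)
  qed
  ultimately show ?thesis unfolding Let_def by blast
qed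

end
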